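(* Let $\epsilon>1$, $0<x<1$ with $\epsilon x\neq 1$, let $a,c$ be finite constants, and set $\alpha=1/x$. Then, as $\lambda\to+\infty$, $$F_1(\lambda;x)\sim\frac{G(\lambda)}{2x}\left\{e^{-\lambda\psi(\alpha)}f(\alpha)\,\mathrm{erfc}\,(\pm\lambda^{1/2}p)+\frac{e^{-\lambda\psi(\epsilon)}}{\pi}\sum_{k\geq 0}d_{2k}\,\frac{\Gamma(k+\frac12)}{\lambda^{k+\frac12}}\right\},$$ where the upper sign applies when $\alpha>\epsilon$ (that is, $\epsilon x<1$) and the lower sign when $\alpha<\epsilon$ (that is, $\epsilon x>1$).
   Context: $F_1(\lambda;x)={}_2F_1(a+\epsilon\lambda,1;c+\lambda;x)$ is the Gauss hypergeometric function, $\Gamma$ is the gamma function and $\mathrm{erfc}$ is the complementary error function. The following notation is used: $$\psi(t)=(\epsilon-1)\log(t-1)-\epsilon\log t,\qquad f(t)=t^{a-1}(t-1)^{c-a-1},$$ with logarithms and powers real/principal for $t>1$ (branch cut along $(-\infty,1]$), and $$G(\lambda)=\frac{\Gamma(c+\lambda)\,\Gamma(1+a-c+(\epsilon-1)\lambda)}{\Gamma(a+\epsilon\lambda)}.$$ The only zero of $\psi'$ is at $t=\epsilon$, and $\psi''(\epsilon)=-\epsilon^{-1}(\epsilon-1)^{-1}<0$. Set $$p=(\psi(\epsilon)-\psi(\alpha))^{1/2}>0,\qquad \kappa=\left(\tfrac12|\psi''(\epsilon)|\right)^{1/2}>0,$$ and $u_\alpha=-ip$ if $\alpha>\epsilon$,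 $u_\alpha=+ip$ if $\alpha<\epsilon$. Definition of the coefficients $d_{2k}$: let $t=t(u)$ be the function analytic near $u=0$ determined by $u^2=\psi(t)-\psi(\epsilon)$, $t(0)=\epsilon$, $t'(0)=i/\kappa$. Let $$h(u)=\frac{f(t(u))\,t'(u)}{t(u)-\alpha}-\frac{f(\alpha)}{u-u_\alpha},$$ which is analytic near $u=0$, with Taylor expansion $h(u)=\sum_{k\ge0}\hat d_k u^k$. Then $d_{2k}=i\,\hat d_{2k}$. The symbol $\sim$ is understood as follows: the sum inside the braces is an asymptotic series in the Poincaré sense, i.e. for each $N\ge 0$, when the sum is truncated after the terms $k<N$, the error inside the braces is $e^{-\lambda\psi(\epsilon)}\,O(\lambda^{-N-1/2})$ as $\lambda\to+\infty$. *)

theory Defs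
  imports "HOL-Complex_Analysis.Complex_Analysis" "HOL-Library.Landau_Symbols"
begin

text \<open>The Gauss series; it represents the hypergeometric function for \<open>norm z < 1\<close> and
  \<open>c\<close> not a nonpositive integer.\<close>
definition hyp2F1 :: "complex \<Rightarrow> complex \<Rightarrow> complex \<Rightarrow> complex \<Rightarrow> complex" where
  "hyp2F1 a b c z = eval_fps (fps_hypergeo [a, b] [c] 1) z"

definition erfc :: "real \<Rightarrow> real" where
  "erfc y = 2 / sqrt pi * integral {y..} (\<lambda>s. exp (- s\<^sup>2))"

text \<open>Polymorphic so that it can be used both on the real half-line \<open>t > 1\<close> and on the complex
  plane cut along \<open>(-\<infinity>, 1]\<close>.\<close>
definition psi :: "real \<Rightarrow> 'a :: ln \<Rightarrow> 'a" where
  "psi \<epsilon> t = of_real (\<epsilon> - 1) * ln (t - 1) - of_real \<epsilon> * ln t"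

definition amp :: "complex \<Rightarrow> complex \<Rightarrow> complex \<Rightarrow> complex" where
  "amp a c t = t powr (a - 1) * (t - 1) powr (c - a - 1)"

definition Gfac :: "real \<Rightarrow> complex \<Rightarrow> complex \<Rightarrow> real \<Rightarrow> complex" where
  "Gfac \<epsilon> a c L =
     Gamma (c + of_real L) * Gamma (1 + a - c + of_real ((\<epsilon> - 1) * L))
       / Gamma (a + of_real (\<epsilon> * L))"

definition kappa :: "real \<Rightarrow> real" where
  "kappa \<epsilon> = sqrt (1 / 2 * \<bar>deriv (deriv (psi \<epsilon>)) \<epsilon>\<bar>)"

definition pdist :: "real \<Rightarrow> real \<Rightarrow> real" where
  "pdist \<epsilon> \<alpha> = sqrt (psi \<epsilon> \<epsilon> - psi \<epsilon> \<alpha>)"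

definition pole_u :: "real \<Rightarrow> real \<Rightarrow> complex" where
  "pole_u \<epsilon> \<alpha> =
     (if \<alpha> > \<epsilon> then - \<i> * of_real (pdist \<epsilon> \<alpha>) else \<i> * of_real (pdist \<epsilon> \<alpha>))"

definition is_saddle_param :: "real \<Rightarrow> (complex \<Rightarrow> complex) \<Rightarrow> bool" where
  "is_saddle_param \<epsilon> t \<longleftrightarrow>
     t analytic_on {0} \<and>
     (\<forall>\<^sub>F u in nhds 0. u\<^sup>2 = psi \<epsilon> (t u) - psi \<epsilon> (of_real \<epsilon>)) \<and>
     t 0 = of_real \<epsilon> \<and>
     deriv t 0 = \<i> / of_real (kappa \<epsilon>)"

text \<open>The conditions determine only the germ at \<open>0\<close>, so a representative is chosen; only its
  Taylor coefficients at \<open>0\<close> are used below.\<close>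
definition saddle_param :: "real \<Rightarrow> complex \<Rightarrow> complex" where
  "saddle_param \<epsilon> = (SOME t. is_saddle_param \<epsilon> t)"

definition hfun :: "real \<Rightarrow> real \<Rightarrow> complex \<Rightarrow> complex \<Rightarrow> complex \<Rightarrow> complex" where
  "hfun \<epsilon> \<alpha> a c u =
     amp a c (saddle_param \<epsilon> u) * deriv (saddle_param \<epsilon>) u / (saddle_param \<epsilon> u - of_real \<alpha>)
       - amp a c (of_real \<alpha>) / (u - pole_u \<epsilon> \<alpha>)"

text \<open>Defined for every index \<open>m\<close>; the expansion uses the even ones.\<close>
definition dcoeff :: "real \<Rightarrow> real \<Rightarrow> complex \<Rightarrow> complex \<Rightarrow> nat \<Rightarrow> complex" where
  "dcoeff \<epsilon> \<alpha> a c m = \<i> * fps_nth (fps_expansion (hfun \<epsilon> \<alpha> a c) 0) m"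

end

theory Submission
  imports Defs "HOL-Probability.Sinc_Integral"
begin

text \<open>The substitution \<open>t = 1 / s\<close> turns the loop around the branch point \<open>1\<close> into the vertical line
  \<open>Re s = 1 / \<epsilon>\<close> through the saddle point. There Cauchy's beta integral
  \<open>\<integral> s\<^sup>-\<^sup>P (1 - s)\<^sup>-\<^sup>Q ds = 2 \<pi> \<i> \<Gamma>(P + Q - 1) / (\<Gamma>(P) \<Gamma>(Q))\<close>, applied to every term of the geometric series of
  \<open>1 / (s - x)\<close>, represents \<open>F\<^sub>1 / G\<close> exactly, up to the residue at \<open>s = x\<close> when the line passes to the left
  of \<open>x\<close>. The beta integral itself follows from its contiguity relations, which leave only the limit
  \<open>P + n, Q + n\<close> with \<open>n \<rightarrow> \<infinity>\<close> to be computed.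

  Away from the saddle the modulus of the integrand on the line is exponentially smaller; near the saddle
  the line is replaced by the image of a real \<open>u\<close>-interval, where Watson's lemma gives the Taylor
  coefficients of \<open>f(t) t'(u) / (t - \<alpha>)\<close>. Since \<open>\<alpha>\<close> stays away from the saddle, the Taylor coefficients of
  the subtracted pole \<open>f(\<alpha>) / (u - u\<^sub>\<alpha>)\<close> cancel the classical asymptotic expansion of \<open>erfc\<close>.\<close>

section \<open>Beta integrands on vertical lines\<close>

text \<open>On the line \<open>Re s = 1 / \<epsilon>\<close> both \<open>|s|\<close> and
  \<open>|1 - s|\<close> grow with the distance from the real axis, so the saddle is the only
  maximum of the modulus there. No global steepest descent contour has to be built; the exact path
  in \<open>u\<close> enters only on a small disc. The double sign records on which side of the pole
  this line passes: to the right of \<open>s = x\<close> exactly when \<alpha> > \<epsilon>.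
  Otherwise a residue appears, and it is the 2 in \<open>erfc (- y) = 2 - erfc y\<close>. The beta
  integral is needed for complex \<open>P\<close> and \<open>Q\<close>, where the integrand is
  oscillating and Laplace's method does not apply to it directly. On the midline
  \<open>Re s = 1/2\<close>, however, \<open>s * (1 - s) = 1/4 + y^2\<close> is real and positive,
  so raising both parameters by \<open>n\<close> only multiplies by the \<open>n\<close>-th power of
  a positive kernel. The limit of large \<open>n\<close> then concerns real masses concentrating at
  one point, and comparison with the pair \<open>(1, 2)\<close> fixes the constant.\<close>

text \<open>The integral is taken with respect to \<open>y\<close>, so it differs from the contour integral by the factor \<open>\<i>\<close>.\<close>

definition vline :: "real \<Rightarrow> (complex \<Rightarrow> complex) \<Rightarrow> complex" where
  "vline \<sigma> g = (LINT y|lborel. g (Complex \<sigma> y))"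

lemma has_integral_vertical_primitive:
  assumes "a \<le> b"
    and "\<And>y. a \<le> y \<Longrightarrow> y \<le> b \<Longrightarrow> (F has_field_derivative g (Complex \<sigma> y)) (at (Complex \<sigma> y))"
  shows "((\<lambda>y. \<i> * g (Complex \<sigma> y)) has_integral F (Complex \<sigma> b) - F (Complex \<sigma> a)) {a..b}"
proof (rule fundamental_theorem_of_calculus[OF assms(1)])
  fix y assume y: "y \<in> {a..b}"
  have "((\<lambda>y. Complex \<sigma> y) has_vector_derivative \<i>) (at y)"
    by (simp add: Complex_eq has_vector_derivative_def) (auto intro!: derivative_eq_intros simp: scaleR_conv_of_real)
  from field_vector_diff_chain_at[OF this assms(2)] y
  have "((F \<circ> Complex \<sigma>) has_vector_derivative \<i> * g (Complex \<sigma> y)) (at y)" by auto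
  thus "((\<lambda>y. F (Complex \<sigma> y)) has_vector_derivative \<i> * g (Complex \<sigma> y)) (at y within {a..b})"
    by (auto simp: o_def intro: has_vector_derivative_at_within)
qed

text \<open>The truncation is symmetric because a pole will be split off an integrand: its two
  pieces need not be integrable over the whole line separately, and are treated as limits over
  \<open>{-T..T}\<close>.\<close>

lemma LINT_tendsto_truncated:
  fixes f :: "real \<Rightarrow> complex"
  assumes f: "integrable lborel f"
  shows "((\<lambda>T. integral {-T..T} f) \<longlongrightarrow> (LINT y|lborel. f y)) at_top"
proof -
  have "((\<lambda>T. LINT y|lborel. indicator {-T..T} y *\<^sub>R f y) \<longlongrightarrow> (LINT y|lborel. f y)) at_top"
  proof (rule integral_dominated_convergence_at_top[where w="\<lambda>y. norm (f y)"])
    show "AE y in lborel. ((\<lambda>T. indicator {-T..T} y *\<^sub>R f y) \<longlongrightarrow> f y) at_top"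
    proof (rule AE_I2)
      fix y :: real
      have "\<forall>\<^sub>F T in at_top. indicator {-T..T} y *\<^sub>R f y = f y"
        using eventually_ge_at_top[of "\<bar>y\<bar>"] by eventually_elim (auto simp: indicator_def)
      thus "((\<lambda>T. indicator {-T..T} y *\<^sub>R f y) \<longlongrightarrow> f y) at_top"
        by (rule tendsto_eventually)
    qed
  qed (use f in \<open>auto simp: indicator_def intro!: always_eventually\<close>)
  moreover have "(LINT y|lborel. indicator {-T..T} y *\<^sub>R f y) = integral {-T..T} f" for T
  proof -
    have "set_integrable lborel {-T..T} f"
      unfolding set_integrable_def using f by (rule integrable_mult_indicator[rotated]) auto
    from set_borel_integral_eq_integral(2)[OF this] show ?thesis
      by (simp add: set_lebesgue_integral_def)
  qed
  ultimately show ?thesis by simp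
qed

lemma integrable_Poisson_kernel:
  fixes m :: real
  assumes "m > 0"
  shows "integrable lborel (\<lambda>y. B / (m\<^sup>2 + y\<^sup>2))"
proof -
  have 1: "integrable lborel (\<lambda>y::real. inverse (1 + y\<^sup>2))"
    using integrable_inverse_1_plus_square by (simp add: set_integrable_def)
  have "integrable lborel (\<lambda>y. inverse (1 + (0 + (1/m) * y)\<^sup>2))"
    using lborel_integrable_real_affine[OF 1, of "1/m" 0] assms by simp
  hence "integrable lborel (\<lambda>y. (B / m\<^sup>2) * inverse (1 + (0 + (1/m) * y)\<^sup>2))" by simp
  moreover have "(B / m\<^sup>2) * inverse (1 + (0 + (1/m) * y)\<^sup>2) = B / (m\<^sup>2 + y\<^sup>2)" for y
    using assms by (simp add: power_divide divide_simps)
  ultimately show ?thesis by simp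
qed

text \<open>\<open>1/4 + y^2\<close> is \<open>s * (1 - s)\<close> on the line
  \<open>Re s = 1/2\<close>, so this is the beta integral for \<open>P = Q = 1\<close>.\<close>

lemma LINT_Poisson_kernel: "(LINT y|lborel. 1 / (1/4 + y\<^sup>2)) = 2 * (pi::real)"
proof -
  have 1: "(LINT y|lborel. inverse (1 + y\<^sup>2)) = pi"
    using LBINT_inverse_1_plus_square
    by (simp add: interval_lebesgue_integral_def set_lebesgue_integral_def)
  have "pi = \<bar>2\<bar> *\<^sub>R (LINT y|lborel. inverse (1 + (0 + 2*y)\<^sup>2))"
    using lborel_integral_real_affine[of 2 "\<lambda>y::real. inverse (1 + y\<^sup>2)" 0] 1 by simp
  also have "\<dots> = (LINT y|lborel. 2 * inverse (1 + (0 + 2*y)\<^sup>2))" by simp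
  also have "(\<lambda>y::real. 2 * inverse (1 + (0 + 2*y)\<^sup>2)) = (\<lambda>y. (1/2) * (1 / (1/4 + y\<^sup>2)))"
    by (auto simp: fun_eq_iff power_mult_distrib divide_simps)
  also have "(LINT y|lborel. (1/2) * (1 / (1/4 + y\<^sup>2))) = (1/2) * (LINT y|lborel. 1 / (1/4 + y\<^sup>2 :: real))"
    by (rule integral_mult_right_zero)
  finally show ?thesis by linarith
qed

section \<open>The beta integrand on the strip where \<open>s\<close> and \<open>1 - s\<close> both
  avoid the cut\<close>

definition strip :: "complex set" where "strip = {s. 0 < Re s \<and> Re s < 1}"

lemma open_strip: "open strip" and convex_strip: "convex strip"
proof -
  have *: "strip = {s. Re s > 0} \<inter> {s. Re s < 1}" by (auto simp: strip_def)
  show "open strip" unfolding * by (intro open_Int open_halfspace_Re_gt open_halfspace_Re_lt)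
  show "convex strip" unfolding * by (intro convex_Int convex_halfspace_Re_gt convex_halfspace_Re_lt)
qed

lemma Complex_in_strip [simp]: "Complex \<sigma> y \<in> strip \<longleftrightarrow> 0 < \<sigma> \<and> \<sigma> < 1"
  by (simp add: strip_def)

definition bfun :: "complex \<Rightarrow> complex \<Rightarrow> complex \<Rightarrow> complex" where
  "bfun P Q s = s powr (-P) * (1 - s) powr (-Q)"

lemma strip_nonpos_Reals: "s \<in> strip \<Longrightarrow> s \<notin> \<real>\<^sub>\<le>\<^sub>0" "s \<in> strip \<Longrightarrow> 1 - s \<notin> \<real>\<^sub>\<le>\<^sub>0"
  by (auto simp: strip_def complex_nonpos_Reals_iff)

lemma bfun_DERIV:
  assumes "s \<in> strip"
  shows "(bfun P Q has_field_derivative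
    (-P * bfun (P + 1) Q s + Q * bfun P (Q + 1) s)) (at s)"
proof -
  have e: "- (P + 1) = - P - 1" "- (Q + 1) = - Q - 1" by auto
  show ?thesis
    unfolding bfun_def e using strip_nonpos_Reals[OF assms]
    by (auto intro!: derivative_eq_intros simp: mult_ac)
qed

lemma bfun_holomorphic: "bfun P Q holomorphic_on strip"
  using bfun_DERIV by (meson holomorphic_onI field_differentiable_def field_differentiable_at_within)

lemma bfun_continuous_line:
  assumes "0 < \<sigma>" "\<sigma> < 1" shows "continuous_on UNIV (\<lambda>y. bfun P Q (Complex \<sigma> y))"
proof -
  have "continuous_on UNIV (Complex \<sigma>)" unfolding Complex_eq[abs_def] by (intro continuous_intros)
  moreover have "continuous_on (range (Complex \<sigma>)) (bfun P Q)"
    using holomorphic_on_imp_continuous_on[OF bfun_holomorphic] assms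
    by (rule_tac continuous_on_subset) auto
  ultimately show ?thesis using continuous_on_compose[of UNIV "Complex \<sigma>" "bfun P Q"] by (simp add: o_def)
qed

text \<open>One power of \<open>norm s\<close> is kept for decay in the imaginary direction; the
  remaining \<open>Re P - 1\<close> are bounded at the left edge \<open>m\<close>. The exponential
  absorbs the factor \<open>exp (Im P * Arg s)\<close> that a complex exponent produces.\<close>

lemma norm_cpowr_le:
  assumes "Re P \<ge> 1" "0 < m" "m \<le> Re s"
  shows "norm (s powr (-P)) \<le> m powr (1 - Re P) * exp (pi * \<bar>Im P\<bar>) / norm s"
proof -
  have ms: "m \<le> norm s" "norm s > 0" using assms complex_Re_le_cmod[of s] by linarith+
  have "\<bar>Arg s\<bar> \<le> pi" using mpi_less_Arg[of s] Arg_le_pi[of s] by linarith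
  from mult_right_mono[OF this abs_ge_zero[of "Im P"]] have "Im P * Arg s \<le> pi * \<bar>Im P\<bar>"
    using abs_ge_self[of "Im P * Arg s"]
    by (simp add: abs_mult mult.commute)
  hence "norm (s powr (-P)) \<le> norm s powr (- Re P) * exp (pi * \<bar>Im P\<bar>)"
    by (simp add: norm_powr_complex mult_left_mono)
  also have "norm s powr (-Re P) = norm s powr (1 - Re P) * inverse (norm s)"
    using ms by (simp add: powr_diff powr_minus divide_simps)
  also have "norm s powr (1 - Re P) \<le> m powr (1 - Re P)"
    using ms assms by (intro powr_mono2') auto
  finally show ?thesis by (simp add: divide_inverse mult_ac mult_right_mono)
qed

definition beta_bound :: "complex \<Rightarrow> complex \<Rightarrow> real \<Rightarrow> real" where
  "beta_bound P Q m = m powr (1 - Re P) * exp (pi * \<bar>Im P\<bar>) * (m powr (1 - Re Q) * exp (pi * \<bar>Im Q\<bar>))"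

lemma beta_bound_nonneg: "beta_bound P Q m \<ge> 0" by (simp add: beta_bound_def)

text \<open>Each of the two powers contributes one factor of decay, together a Poisson kernel. The
  bound depends on \<open>Re s\<close> only through \<open>m\<close>, so it serves all lines of a
  closed substrip at once, as line shifts require.\<close>

lemma norm_bfun_le:
  assumes "Re P \<ge> 1" "Re Q \<ge> 1" "0 < m" "m \<le> Re s" "Re s \<le> 1 - m"
  shows "norm (bfun P Q s) \<le> beta_bound P Q m / (m\<^sup>2 + (Im s)\<^sup>2)"
proof -
  have ms: "m \<le> Re s" "m \<le> Re (1 - s)" using assms by auto
  have 0: "m\<^sup>2 + (Im s)\<^sup>2 > 0" using assms by (simp add: add_pos_nonneg)
  have "sqrt (m\<^sup>2 + (Im s)\<^sup>2) \<le> norm s" "sqrt (m\<^sup>2 + (Im s)\<^sup>2) \<le> norm (1 - s)"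
    using assms by (auto simp: cmod_def)
  hence "sqrt (m\<^sup>2 + (Im s)\<^sup>2) * sqrt (m\<^sup>2 + (Im s)\<^sup>2) \<le> norm s * norm (1 - s)"
    by (intro mult_mono) auto
  hence 1: "m\<^sup>2 + (Im s)\<^sup>2 \<le> norm s * norm (1 - s)" using 0 by simp
  have "norm (bfun P Q s) \<le> (m powr (1 - Re P) * exp (pi * \<bar>Im P\<bar>) / norm s) *
     (m powr (1 - Re Q) * exp (pi * \<bar>Im Q\<bar>) / norm (1 - s))"
    unfolding bfun_def norm_mult using ms assms by (intro mult_mono norm_cpowr_le) auto
  also have "\<dots> = beta_bound P Q m / (norm s * norm (1 - s))" by (simp add: beta_bound_def)
  also have "\<dots> \<le> beta_bound P Q m / (m\<^sup>2 + (Im s)\<^sup>2)"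
    using 0 1 beta_bound_nonneg by (intro divide_left_mono) (auto intro!: mult_pos_pos)
  finally show ?thesis .
qed

lemma integrable_bfun_times:
  assumes "Re P \<ge> 1" "Re Q \<ge> 1" "0 < \<sigma>" "\<sigma> < 1"
    and "continuous_on UNIV (\<lambda>y. k (Complex \<sigma> y))" "\<And>y. norm (k (Complex \<sigma> y)) \<le> K"
  shows "integrable lborel (\<lambda>y. bfun P Q (Complex \<sigma> y) * k (Complex \<sigma> y))"
proof (rule Bochner_Integration.integrable_bound)
  let ?m = "min \<sigma> (1 - \<sigma>)"
  show "integrable lborel (\<lambda>y. beta_bound P Q ?m * K / (?m\<^sup>2 + y\<^sup>2))"
    using assms by (intro integrable_Poisson_kernel) auto
  show "(\<lambda>y. bfun P Q (Complex \<sigma> y) * k (Complex \<sigma> y)) \<in> borel_measurable lborel"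
    using bfun_continuous_line[OF assms(3,4)] assms(5)
    by (auto intro!: borel_measurable_continuous_onI continuous_intros)
  have "norm (bfun P Q (Complex \<sigma> y) * k (Complex \<sigma> y)) \<le> beta_bound P Q ?m * K / (?m\<^sup>2 + y\<^sup>2)" for y
  proof -
    have "norm (bfun P Q (Complex \<sigma> y) * k (Complex \<sigma> y)) \<le> beta_bound P Q ?m / (?m\<^sup>2 + y\<^sup>2) * K"
      unfolding norm_mult using assms norm_bfun_le[of P Q ?m "Complex \<sigma> y"] beta_bound_nonneg
      by (intro mult_mono) auto
    thus ?thesis by simp
  qed
  thus "AE y in lborel. norm (bfun P Q (Complex \<sigma> y) * k (Complex \<sigma> y)) \<le> norm (beta_bound P Q ?m * K / (?m\<^sup>2 + y\<^sup>2))"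
    by (intro AE_I2) (smt (verit) real_norm_def)
qed

lemma integrable_bfun:
  assumes "Re P \<ge> 1" "Re Q \<ge> 1" "0 < \<sigma>" "\<sigma> < 1"
  shows "integrable lborel (\<lambda>y. bfun P Q (Complex \<sigma> y))"
  using integrable_bfun_times[OF assms, of "\<lambda>_. 1" 1] by simp

lemma vline_derivative_zero:
  assumes "\<And>y. (F has_field_derivative g (Complex \<sigma> y)) (at (Complex \<sigma> y))"
    and int: "integrable lborel (\<lambda>y. g (Complex \<sigma> y))"
    and "((\<lambda>y. F (Complex \<sigma> y)) \<longlongrightarrow> 0) at_top" "((\<lambda>y. F (Complex \<sigma> y)) \<longlongrightarrow> 0) at_bot"
  shows "vline \<sigma> g = 0"
proof -
  have "((\<lambda>T. integral {-T..T} (\<lambda>y. \<i> * g (Complex \<sigma> y))) \<longlongrightarrow> (LINT y|lborel. \<i> * g (Complex \<sigma> y))) at_top"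
    by (rule LINT_tendsto_truncated) (use int in auto)
  hence 1: "((\<lambda>T. integral {-T..T} (\<lambda>y. \<i> * g (Complex \<sigma> y))) \<longlongrightarrow> \<i> * vline \<sigma> g) at_top"
    by (simp add: vline_def)
  have "((\<lambda>T. F (Complex \<sigma> (-T))) \<longlongrightarrow> 0) at_top"
    using filterlim_compose[OF assms(4) filterlim_uminus_at_bot_at_top] by simp
  from tendsto_diff[OF assms(3) this]
  have "((\<lambda>T. F (Complex \<sigma> T) - F (Complex \<sigma> (-T))) \<longlongrightarrow> 0) at_top" by simp
  moreover have "\<forall>\<^sub>F T in at_top. F (Complex \<sigma> T) - F (Complex \<sigma> (-T)) = integral {-T..T} (\<lambda>y. \<i> * g (Complex \<sigma> y))"
    using eventually_ge_at_top[of 0]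
    by eventually_elim (intro integral_unique[symmetric] has_integral_vertical_primitive assms, auto)
  ultimately have "((\<lambda>T. integral {-T..T} (\<lambda>y. \<i> * g (Complex \<sigma> y))) \<longlongrightarrow> 0) at_top"
    by (rule Lim_transform_eventually)
  with 1 have "\<i> * vline \<sigma> g = 0" by (rule tendsto_unique[rotated]) simp
  thus ?thesis by simp
qed

lemma filterlim_Complex_at_infinity:
  "filterlim (Complex \<sigma>) at_infinity at_top" "filterlim (Complex \<sigma>) at_infinity at_bot"
proof -
  have *: "norm (Complex \<sigma> y) \<ge> \<bar>y\<bar>" for y using abs_Im_le_cmod[of "Complex \<sigma> y"] by simp
  have "filterlim (\<lambda>y. norm (Complex \<sigma> y)) at_top at_top"
    by (rule filterlim_at_top_mono[OF filterlim_ident always_eventually])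
       (use * in \<open>meson abs_ge_self order_trans\<close>)
  thus "filterlim (Complex \<sigma>) at_infinity at_top" by (simp add: filterlim_at_infinity_conv_norm_at_top)
  have "filterlim (\<lambda>y. norm (Complex \<sigma> y)) at_top at_bot"
    by (rule filterlim_at_top_mono[OF filterlim_uminus_at_top_at_bot always_eventually])
       (use * in \<open>meson abs_ge_minus_self order_trans\<close>)
  thus "filterlim (Complex \<sigma>) at_infinity at_bot" by (simp add: filterlim_at_infinity_conv_norm_at_top)
qed

lemma bfun_tendsto_0:
  assumes "Re P \<ge> 1" "Re Q \<ge> 1" "0 < \<sigma>" "\<sigma> < 1"
  shows "((\<lambda>y. bfun P Q (Complex \<sigma> y)) \<longlongrightarrow> 0) at_top" "((\<lambda>y. bfun P Q (Complex \<sigma> y)) \<longlongrightarrow> 0) at_bot"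
proof -
  let ?m = "min \<sigma> (1 - \<sigma>)"
  have b: "norm (bfun P Q (Complex \<sigma> y)) \<le> beta_bound P Q ?m / (?m\<^sup>2 + y\<^sup>2)" for y
    using assms norm_bfun_le[of P Q ?m "Complex \<sigma> y"] by simp
  have t: "((\<lambda>y. beta_bound P Q ?m / (?m\<^sup>2 + y\<^sup>2)) \<longlongrightarrow> 0) at_top"
    by (intro tendsto_divide_0[OF tendsto_const] filterlim_at_top_imp_at_infinity
         filterlim_tendsto_add_at_top[OF tendsto_const] filterlim_pow_at_top filterlim_ident) auto
  from t show "((\<lambda>y. bfun P Q (Complex \<sigma> y)) \<longlongrightarrow> 0) at_top"
    by (rule Lim_null_comparison[rotated]) (use b in auto)
  have "((\<lambda>y. beta_bound P Q ?m / (?m\<^sup>2 + y\<^sup>2)) \<longlongrightarrow> 0) at_bot"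
    using filterlim_compose[OF t filterlim_uminus_at_top_at_bot] by simp
  thus "((\<lambda>y. bfun P Q (Complex \<sigma> y)) \<longlongrightarrow> 0) at_bot"
    by (rule Lim_null_comparison[rotated]) (use b in auto)
qed

section \<open>Contiguity relations and the value at (1, 2)\<close>

abbreviation bline :: "complex \<Rightarrow> complex \<Rightarrow> complex" where "bline P Q \<equiv> vline (1/2) (bfun P Q)"

text \<open>Integration by parts: \<open>bfun P Q\<close> vanishes at both ends of the line, so its
  derivative integrates to zero.\<close>

lemma bline_balance:
  assumes "Re P \<ge> 1" "Re Q \<ge> 1"
  shows "P * bline (P + 1) Q = Q * bline P (Q + 1)"
proof -
  have i: "integrable lborel (\<lambda>y. bfun (P + 1) Q (Complex (1/2) y))"
    "integrable lborel (\<lambda>y. bfun P (Q + 1) (Complex (1/2) y))"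
    using assms by (auto intro!: integrable_bfun)
  have "vline (1/2) (\<lambda>s. -P * bfun (P + 1) Q s + Q * bfun P (Q + 1) s) = 0"
    using assms i by (intro vline_derivative_zero[where F="bfun P Q"] bfun_DERIV bfun_tendsto_0) auto
  hence "-P * bline (P + 1) Q + Q * bline P (Q + 1) = 0"
    using i by (simp add: vline_def)
  thus ?thesis by (simp add: algebra_simps)
qed

lemma bfun_shift_P: "s \<in> strip \<Longrightarrow> bfun (P + 1) Q s = bfun P Q s / s"
  by (auto simp: bfun_def strip_def powr_diff)

lemma bfun_shift_Q: "s \<in> strip \<Longrightarrow> bfun P (Q + 1) s = bfun P Q s / (1 - s)"
  by (auto simp: bfun_def strip_def powr_diff)

text \<open>Partial fractions: \<open>1 / (s * (1 - s)) = 1 / s + 1 / (1 - s)\<close>.\<close>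

lemma bline_sum:
  assumes "Re P \<ge> 1" "Re Q \<ge> 1"
  shows "bline (P + 1) (Q + 1) = bline (P + 1) Q + bline P (Q + 1)"
proof -
  have i: "integrable lborel (\<lambda>y. bfun (P + 1) Q (Complex (1/2) y))"
    "integrable lborel (\<lambda>y. bfun P (Q + 1) (Complex (1/2) y))"
    using assms by (auto intro!: integrable_bfun)
  have "bfun (P + 1) (Q + 1) s = bfun (P + 1) Q s + bfun P (Q + 1) s" if "s \<in> strip" for s
  proof -
    from that have "s \<noteq> 0" "1 - s \<noteq> 0" by (auto simp: strip_def)
    thus ?thesis
      by (simp only: bfun_shift_P[OF that] bfun_shift_Q[OF that]) (simp add: divide_simps algebra_simps)
  qed
  thus ?thesis using i by (simp add: vline_def)
qed

lemma bline_Suc_Q: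
  assumes "Re P \<ge> 1" "Re Q \<ge> 1"
  shows "bline (P + 1) (Q + 1) = (P + Q) / Q * bline (P + 1) Q"
proof -
  have "Q \<noteq> 0" using assms by auto
  moreover have "Q * bline (P + 1) (Q + 1) = (P + Q) * bline (P + 1) Q"
    using bline_balance[OF assms] bline_sum[OF assms] by (simp add: algebra_simps)
  ultimately show ?thesis by (simp add: field_simps)
qed

lemma bline_Suc_P:
  assumes "Re P \<ge> 1" "Re Q \<ge> 1"
  shows "bline (P + 1) (Q + 1) = (P + Q) / P * bline P (Q + 1)"
proof -
  have "P \<noteq> 0" using assms by auto
  moreover have "P * bline (P + 1) (Q + 1) = (P + Q) * bline P (Q + 1)"
    using bline_balance[OF assms] bline_sum[OF assms] by (simp add: algebra_simps)
  ultimately show ?thesis by (simp add: field_simps)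
qed

text \<open>First \<open>Q\<close> and then \<open>P\<close> is lowered. The second relation is
  applied at \<open>Q - 1\<close>, which must itself have real part at least 1; this is the origin
  of the bound 2 on \<open>Re Q\<close> in what follows.\<close>

lemma bline_Suc_both:
  assumes "Re P \<ge> 1" "Re Q \<ge> 2"
  shows "bline (P + 1) (Q + 1) = (P + Q - 1) * (P + Q) / (P * Q) * bline P Q"
  using bline_Suc_Q[of P Q] bline_Suc_P[of P "Q - 1"] assms by simp

text \<open>The case \<open>P = Q = 1\<close> is a Poisson integral. The identity
  \<open>1 / (s^2 * (1 - s)) = 1 / (s * (1 - s)) + 1 / s^2\<close>, whose last term has a primitive
  vanishing at both ends, carries it to \<open>(2, 1)\<close>, and \<open>bline_balance\<close>
  swaps the arguments. The pair \<open>(1, 2)\<close> is the smallest one to which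
  \<open>bline_Suc_both\<close> applies.\<close>

lemma bline_1_2: "bline 1 2 = 2 * of_real pi"
proof -
  have eq: "bfun 1 1 (Complex (1/2) y) = of_real (1 / (1/4 + y\<^sup>2))" for y
  proof -
    have "Complex (1/2) y * (1 - Complex (1/2) y) = of_real (1/4 + y\<^sup>2)"
      by (simp add: complex_eq_iff power2_eq_square)
    moreover have "bfun 1 1 s = 1 / (s * (1 - s))" for s
      by (simp add: bfun_def powr_minus divide_inverse)
    ultimately show ?thesis by (simp only: of_real_divide of_real_1)
  qed
  have 1: "bline 1 1 = 2 * of_real pi"
    unfolding vline_def eq integral_complex_of_real LINT_Poisson_kernel by simp
  have i: "integrable lborel (\<lambda>y. bfun 1 1 (Complex (1/2) y))"
      "integrable lborel (\<lambda>y. bfun 2 1 (Complex (1/2) y))"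
    by (auto intro!: integrable_bfun)
  have d: "bfun 2 1 s = bfun 1 1 s + 1 / s\<^sup>2" if "s \<in> strip" for s
  proof -
    from that have "s \<noteq> 0" "1 - s \<noteq> 0" by (auto simp: strip_def)
    moreover have b1: "bfun 1 1 s = 1 / (s * (1 - s))"
      by (simp add: bfun_def powr_minus divide_inverse)
    moreover have "bfun 2 1 s = bfun 1 1 s / s" using bfun_shift_P[OF that, of 1 1] by simp
    ultimately show ?thesis by (simp add: divide_simps power2_eq_square) algebra
  qed
  have d': "1 / (Complex (1/2) y)\<^sup>2 = bfun 2 1 (Complex (1/2) y) - bfun 1 1 (Complex (1/2) y)" for y
    using d[of "Complex (1/2) y"] by simp
  have i2: "integrable lborel (\<lambda>y. 1 / (Complex (1/2) y)\<^sup>2)"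
    unfolding d' using i by auto
  have "vline (1/2) (\<lambda>s. 1 / s\<^sup>2) = 0"
  proof (rule vline_derivative_zero[where F="\<lambda>s. - inverse s"])
    show "((\<lambda>s. - inverse s) has_field_derivative 1 / (Complex (1/2) y)\<^sup>2) (at (Complex (1/2) y))" for y
    proof -
      have "Complex (1/2) y \<noteq> 0" by (simp add: complex_eq_iff)
      moreover have "((\<lambda>s. - inverse s) has_field_derivative 1 / s\<^sup>2) (at s)" if "s \<noteq> 0" for s :: complex
        using that by (auto intro!: derivative_eq_intros simp: power2_eq_square divide_inverse)
      ultimately show ?thesis by blast
    qed
    show "((\<lambda>y. - inverse (Complex (1 / 2) y)) \<longlongrightarrow> 0) at_top" "((\<lambda>y. - inverse (Complex (1 / 2) y)) \<longlongrightarrow> 0) at_bot"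
      using filterlim_compose[OF tendsto_inverse_0 filterlim_Complex_at_infinity(1)[of "1/2"], THEN tendsto_minus]
        filterlim_compose[OF tendsto_inverse_0 filterlim_Complex_at_infinity(2)[of "1/2"], THEN tendsto_minus] by simp_all
  qed (use i2 in simp)
  moreover have "vline (1/2) (\<lambda>s. 1 / s\<^sup>2) = bline 2 1 - bline 1 1"
    unfolding vline_def d' using i by (intro Bochner_Integration.integral_diff)
  ultimately have "bline 2 1 = bline 1 1" by simp
  moreover have "bline (1 + 1) 1 = bline 1 (1 + 1)" using bline_balance[of 1 1] by simp
  ultimately show ?thesis using 1 by (simp only: one_add_one)
qed

section \<open>Common shifts of both parameters and concentration at the midpoint\<close>

definition pker :: "real \<Rightarrow> real" where "pker y = 1 / (1/4 + y\<^sup>2)"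

lemma pker_pos: "pker y > 0" by (simp add: pker_def add_pos_nonneg)

lemma half_line_mult: "Complex (1/2) y * (1 - Complex (1/2) y) = of_real (1/4 + y\<^sup>2)"
  by (simp add: complex_eq_iff power2_eq_square)

text \<open>On the midline \<open>s * (1 - s)\<close> is real, so a common shift of both parameters
  multiplies the integrand by a power of one positive kernel, whatever the complex \<open>P\<close>
  and \<open>Q\<close> are.\<close>

lemma bfun_half_line_shift:
  "bfun (P + of_nat n) (Q + of_nat n) (Complex (1/2) y) = bfun P Q (Complex (1/2) y) * of_real (pker y ^ n)"
proof (induction n)
  case (Suc n)
  let ?z = "Complex (1/2) y"
  have z: "?z \<in> strip" by simp
  have "bfun (P + of_nat (Suc n)) (Q + of_nat (Suc n)) ?z = bfun ((P + of_nat n) + 1) ((Q + of_nat n) + 1) ?z"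
    by (simp add: add_ac)
  also have "\<dots> = bfun (P + of_nat n) (Q + of_nat n) ?z / (?z * (1 - ?z))"
    by (simp only: bfun_shift_P[OF z] bfun_shift_Q[OF z] divide_divide_eq_left mult.commute)
  also have "\<dots> = bfun P Q ?z * of_real (pker y ^ Suc n)"
    by (simp only: Suc half_line_mult pker_def) (simp add: divide_simps)
  finally show ?case .
qed auto

lemma bfun_1_1_half_line: "bfun 1 1 (Complex (1/2) y) = of_real (pker y)"
proof -
  have "bfun 1 1 s = 1 / (s * (1 - s))" for s
    by (simp add: bfun_def powr_minus divide_inverse)
  thus ?thesis by (simp only: half_line_mult pker_def of_real_divide of_real_1)
qed

text \<open>The normalising mass of the kernel. The exponent starts at one because
  \<open>pker ^ 0\<close> is not integrable, so \<open>bdiag n\<close> belongs to the parameter pair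
  \<open>(n + 1, n + 1)\<close>.\<close>

definition bdiag :: "nat \<Rightarrow> real" where "bdiag n = (LINT y|lborel. pker y ^ Suc n)"

lemma bline_diag: "bline (of_nat (Suc n)) (of_nat (Suc n)) = of_real (bdiag n)"
proof -
  have "bfun (of_nat (Suc n)) (of_nat (Suc n)) (Complex (1/2) y) = of_real (pker y ^ Suc n)" for y
    using bfun_half_line_shift[of 1 n 1 y] by (simp add: bfun_1_1_half_line)
  thus ?thesis unfolding vline_def bdiag_def by (simp only: integral_complex_of_real)
qed

lemma integrable_pker_power: "integrable lborel (\<lambda>y. pker y ^ Suc n)"
proof -
  have "bfun (of_nat (Suc n)) (of_nat (Suc n)) (Complex (1/2) y) = of_real (pker y ^ Suc n)" for y
    using bfun_half_line_shift[of 1 n 1 y] by (simp add: bfun_1_1_half_line)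
  moreover have "integrable lborel (\<lambda>y. bfun (of_nat (Suc n)) (of_nat (Suc n)) (Complex (1/2) y))"
    by (intro integrable_bfun) auto
  ultimately have "integrable lborel (\<lambda>y. complex_of_real (pker y ^ Suc n))" by simp
  thus ?thesis by (simp only: complex_of_real_integrable_eq)
qed

text \<open>Contiguity at \<open>P = Q = n + 2\<close>; the pair \<open>(2, 2)\<close> is the first
  diagonal one that \<open>bline_Suc_both\<close> covers, hence the recursion starts at
  \<open>bdiag 1\<close>.\<close>

lemma bdiag_Suc: "bdiag (Suc (Suc n)) = bdiag (Suc n) * ((2 * real n + 3) * (2 * real n + 4) / (real n + 2)\<^sup>2)"
proof -
  have "complex_of_real (bdiag (Suc (Suc n))) = of_real (bdiag (Suc n) * ((2 * real n + 3) * (2 * real n + 4) / (real n + 2)\<^sup>2))"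
    using bline_Suc_both[of "of_nat (Suc (Suc n))" "of_nat (Suc (Suc n))"] bline_diag[of "Suc n"] bline_diag[of "Suc (Suc n)"]
    by (simp add: algebra_simps power2_eq_square)
  thus ?thesis by (simp only: of_real_eq_iff)
qed

lemma bdiag_pos: "bdiag (Suc n) > 0"
proof (induction n)
  case 0
  have "bline 2 2 = bline 2 1 + bline 1 2" "bline 2 1 = bline 1 2" using bline_sum[of 1 1] bline_balance[of 1 1] by simp_all
  hence "complex_of_real (bdiag 1) = of_real (4 * pi)" using bline_diag[of 1] by (simp add: bline_1_2)
  hence "bdiag 1 = 4 * pi" by (simp only: of_real_eq_iff)
  thus ?case by simp
next
  case (Suc n)
  have "(2 * real n + 3) * (2 * real n + 4) / (real n + 2)\<^sup>2 > 0"
    by (intro divide_pos_pos mult_pos_pos) auto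
  with Suc show ?case unfolding bdiag_Suc by (rule mult_pos_pos)
qed

text \<open>The quotient is the mean of \<open>1 / pker y = 1/4 + y^2\<close> under the normalised
  kernel \<open>pker ^ (n + 2)\<close>, so the limit 1/4 says that the mean of \<open>y^2\<close>
  tends to zero.\<close>

lemma bdiag_ratio: "(\<lambda>n. bdiag n / bdiag (Suc n)) \<longlonglongrightarrow> 1/4"
proof (rule LIMSEQ_offset[where k=1])
  have "bdiag (n + 1) / bdiag (Suc (n + 1)) = (real n + 2)\<^sup>2 / ((2 * real n + 3) * (2 * real n + 4))" for n
    using bdiag_pos[of n] by (simp add: bdiag_Suc)
  moreover have "(\<lambda>n. (real n + 2)\<^sup>2 / ((2 * real n + 3) * (2 * real n + 4))) \<longlonglongrightarrow> 1/4" by real_asymp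
  ultimately show "(\<lambda>n. bdiag (n + 1) / bdiag (Suc (n + 1))) \<longlonglongrightarrow> 1/4" by simp
qed

text \<open>The kernels concentrate at the midpoint. Their second moments are controlled by the exact ratio of
  consecutive masses, so no tail estimate is needed.\<close>

lemma bline_diag_shift_limit:
  assumes "Re P \<ge> 1" "Re Q \<ge> 1"
  shows "(\<lambda>n. bline (P + of_nat n) (Q + of_nat n) / of_real (bdiag n)) \<longlonglongrightarrow> bfun P Q (1/2) / 4"
proof -
  \<comment> \<open>One kernel is divided out of the integrand. What is left, \<open>k\<close>, is
    bounded, and the powers \<open>pker ^ (n + 1)\<close> that multiply it are integrable from
    \<open>n = 0\<close> on.\<close>
  define k where "k = (\<lambda>y. bfun P Q (Complex (1/2) y) * of_real (1/4 + y\<^sup>2))"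
  have k0: "k 0 = bfun P Q (1/2) / 4"
  proof -
    have "Complex (1/2) 0 = 1/2" by (simp add: complex_eq_iff)
    thus ?thesis by (simp only: k_def) simp
  qed
  define K where "K = beta_bound P Q (1/2)"
  have kK: "norm (k y) \<le> K" for y
  proof -
    have "0 < 1/4 + y\<^sup>2" by (simp add: add_pos_nonneg)
    moreover have "norm (bfun P Q (Complex (1/2) y)) \<le> K / (1/4 + y\<^sup>2)"
      using norm_bfun_le[OF assms, of "1/2" "Complex (1/2) y"] by (simp add: K_def power2_eq_square)
    ultimately show ?thesis unfolding k_def norm_mult norm_of_real by (simp add: pos_le_divide_eq)
  qed
  have kcont: "continuous_on UNIV k"
    unfolding k_def using bfun_continuous_line[of "1/2" P Q] by (intro continuous_intros) auto
  have Mk: "bline (P + of_nat n) (Q + of_nat n) = (LINT y|lborel. of_real (pker y ^ Suc n) * k y)" for n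
  proof -
    have "bfun (P + of_nat n) (Q + of_nat n) (Complex (1/2) y) = of_real (pker y ^ Suc n) * k y" for y
    proof -
      have "(1/4 + y\<^sup>2) * pker y = 1" by (simp add: pker_def add_nonneg_eq_0_iff)
      hence "complex_of_real ((1/4 + y\<^sup>2) * pker y) = 1" by simp
      hence "complex_of_real (1/4 + y\<^sup>2) * of_real (pker y) = 1" by (simp only: of_real_mult)
      thus ?thesis unfolding bfun_half_line_shift k_def by (simp add: mult_ac del: of_real_add)
    qed
    thus ?thesis by (simp add: vline_def)
  qed
  have ik: "integrable lborel (\<lambda>y. of_real (pker y ^ Suc n) * k y)" for n
  proof (rule Bochner_Integration.integrable_bound)
    show "integrable lborel (\<lambda>y. K * pker y ^ Suc n)" using integrable_pker_power[of n] by simp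
    show "(\<lambda>y. of_real (pker y ^ Suc n) * k y) \<in> borel_measurable lborel"
    proof (intro borel_measurable_times)
      show "(\<lambda>y. complex_of_real (pker y ^ Suc n)) \<in> borel_measurable lborel"
        using integrable_pker_power[of n] borel_measurable_integrable complex_of_real_integrable_eq by blast
      show "k \<in> borel_measurable lborel" using kcont by (simp add: borel_measurable_continuous_onI)
    qed
    show "AE y in lborel. norm (of_real (pker y ^ Suc n) * k y) \<le> norm (K * pker y ^ Suc n)"
    proof (rule AE_I2)
      fix y
      have "norm (of_real (pker y ^ Suc n) * k y) = \<bar>pker y ^ Suc n\<bar> * norm (k y)"
        by (simp only: norm_mult norm_of_real)
      also have "\<dots> \<le> \<bar>pker y ^ Suc n\<bar> * \<bar>K\<bar>"
        using kK[of y] by (intro mult_left_mono) auto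
      finally show "norm (of_real (pker y ^ Suc n) * k y) \<le> norm (K * pker y ^ Suc n)"
        by (simp only: real_norm_def abs_mult mult.commute)
    qed
  qed
  \<comment> \<open>Chebyshev's argument: a deviation of at most \<open>\<eta> + D * y^2\<close> in
    \<open>k\<close> costs \<open>\<eta>\<close> plus \<open>D\<close> times the mean of
    \<open>y^2\<close>. That mean is \<open>bdiag n / bdiag (Suc n) - 1/4\<close>, because
    \<open>pker y * y^2 = 1 - pker y / 4\<close>.\<close>
  have main: "norm (bline (P + of_nat (Suc n)) (Q + of_nat (Suc n)) / of_real (bdiag (Suc n)) - k 0)
      \<le> \<eta> + D * (bdiag n / bdiag (Suc n) - 1/4)"
    if D: "\<And>y. norm (k y - k 0) \<le> \<eta> + D * y\<^sup>2" for \<eta> D n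
  proof -
    let ?n = "Suc n"
    have i: "integrable lborel (\<lambda>y. pker y ^ Suc ?n)" "integrable lborel (\<lambda>y. pker y ^ ?n)"
      using integrable_pker_power by blast+
    have "norm (bline (P + of_nat ?n) (Q + of_nat ?n) - of_real (bdiag ?n) * k 0)
       = norm (LINT y|lborel. of_real (pker y ^ Suc ?n) * (k y - k 0))"
    proof -
      have "complex_of_real (bdiag ?n) = (LINT y|lborel. of_real (pker y ^ Suc ?n))"
        unfolding bdiag_def integral_complex_of_real ..
      moreover have "integrable lborel (\<lambda>y. complex_of_real (pker y ^ Suc ?n))"
        using i by (simp only: complex_of_real_integrable_eq)
      ultimately have "bline (P + of_nat ?n) (Q + of_nat ?n) - of_real (bdiag ?n) * k 0
         = (LINT y|lborel. of_real (pker y ^ Suc ?n) * k y) - (LINT y|lborel. of_real (pker y ^ Suc ?n) * k 0)"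
        unfolding Mk by simp
      also have "\<dots> = (LINT y|lborel. of_real (pker y ^ Suc ?n) * k y - of_real (pker y ^ Suc ?n) * k 0)"
        using ik[of ?n] i(1) by (intro Bochner_Integration.integral_diff[symmetric] integrable_mult_left)
           (simp_all only: complex_of_real_integrable_eq)
      finally show ?thesis by (simp only: right_diff_distrib)
    qed
    also have "\<dots> \<le> (LINT y|lborel. \<eta> * pker y ^ Suc ?n + D * (pker y ^ ?n - pker y ^ Suc ?n / 4))"
    proof (rule order_trans[OF integral_norm_bound], rule integral_mono[OF integrable_norm])
      show "integrable lborel (\<lambda>y. of_real (pker y ^ Suc ?n) * (k y - k 0))"
        unfolding right_diff_distrib using ik[of ?n] i(1)
        by (intro Bochner_Integration.integrable_diff integrable_mult_left)
           (simp_all only: complex_of_real_integrable_eq)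
      show "integrable lborel (\<lambda>y. \<eta> * pker y ^ Suc ?n + D * (pker y ^ ?n - pker y ^ Suc ?n / 4))"
        using i by (intro Bochner_Integration.integrable_add integrable_mult_right
             Bochner_Integration.integrable_diff integrable_divide) auto
      fix y
      have "pker y * (1/4 + y\<^sup>2) = 1" by (simp add: pker_def add_nonneg_eq_0_iff)
      hence e: "pker y * y\<^sup>2 = 1 - pker y / 4" by (simp add: algebra_simps)
      have "norm (of_real (pker y ^ Suc ?n) * (k y - k 0)) = pker y ^ Suc ?n * norm (k y - k 0)"
        using pker_pos[of y] by (simp add: norm_mult norm_power)
      also have "\<dots> \<le> pker y ^ Suc ?n * (\<eta> + D * y\<^sup>2)"
        using pker_pos[of y] D by (intro mult_left_mono) auto
      also have "\<dots> = \<eta> * pker y ^ Suc ?n + D * (pker y ^ ?n * (pker y * y\<^sup>2))"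
        by (simp add: algebra_simps)
      also have "\<dots> = \<eta> * pker y ^ Suc ?n + D * (pker y ^ ?n - pker y ^ Suc ?n / 4)"
        unfolding e by (simp add: algebra_simps)
      finally show "norm (of_real (pker y ^ Suc ?n) * (k y - k 0)) \<le> \<dots>" .
    qed
    also have "\<dots> = \<eta> * bdiag ?n + D * (bdiag n - bdiag ?n / 4)"
      unfolding bdiag_def using i by (subst Bochner_Integration.integral_add) auto
    finally have "norm (bline (P + of_nat ?n) (Q + of_nat ?n) - of_real (bdiag ?n) * k 0) \<le> \<eta> * bdiag ?n + D * (bdiag n - bdiag ?n / 4)" .
    hence "norm (bline (P + of_nat ?n) (Q + of_nat ?n) - of_real (bdiag ?n) * k 0) / bdiag ?n \<le> (\<eta> * bdiag ?n + D * (bdiag n - bdiag ?n / 4)) / bdiag ?n"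
      using bdiag_pos[of n] by (intro divide_right_mono) auto
    also have "(\<eta> * bdiag ?n + D * (bdiag n - bdiag ?n / 4)) / bdiag ?n = \<eta> + D * (bdiag n / bdiag (Suc n) - 1/4)"
      using bdiag_pos[of n] by (simp add: field_simps)
    also have "norm (bline (P + of_nat ?n) (Q + of_nat ?n) - of_real (bdiag ?n) * k 0) / bdiag ?n
       = norm ((bline (P + of_nat ?n) (Q + of_nat ?n) - of_real (bdiag ?n) * k 0) / of_real (bdiag ?n))"
      using bdiag_pos[of n] by (simp add: norm_divide)
    also have "(bline (P + of_nat ?n) (Q + of_nat ?n) - of_real (bdiag ?n) * k 0) / of_real (bdiag ?n)
       = bline (P + of_nat ?n) (Q + of_nat ?n) / of_real (bdiag ?n) - k 0"
      using bdiag_pos[of n] by (simp add: diff_divide_distrib)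
    finally show ?thesis .
  qed
  have "(\<lambda>n. bline (P + of_nat (Suc n)) (Q + of_nat (Suc n)) / of_real (bdiag (Suc n))) \<longlonglongrightarrow> k 0"
  proof (rule metric_LIMSEQ_I)
    fix r :: real assume r: "r > 0"
    have "isCont k 0" using kcont by (simp add: continuous_on_eq_continuous_at)
    then obtain \<delta> where \<delta>: "\<delta> > 0" "\<And>y. \<bar>y\<bar> < \<delta> \<Longrightarrow> norm (k y - k 0) < r/2"
      using r unfolding continuous_at_eps_delta dist_norm by (metis half_gt_zero diff_zero real_norm_def)
    \<comment> \<open>Chosen so that beyond \<open>\<delta>\<close> the trivial bound
      \<open>2 * K\<close> on the deviation is at most \<open>D * y^2\<close>.\<close>
    define D where "D = 2 * K / \<delta>\<^sup>2"
    have K0: "K \<ge> 0" using kK[of 0] norm_ge_zero order_trans by blast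
    have D: "norm (k y - k 0) \<le> r/2 + D * y\<^sup>2" for y
    proof (cases "\<bar>y\<bar> < \<delta>")
      case True
      have "0 \<le> D * y\<^sup>2" using K0 by (simp add: D_def)
      with \<delta>(2)[OF True] show ?thesis by linarith
    next
      case False
      hence "\<delta>\<^sup>2 \<le> y\<^sup>2" using \<delta>(1) by (simp add: abs_le_square_iff[symmetric])
      hence "2 * K \<le> D * y\<^sup>2" using \<delta>(1) K0 by (simp add: D_def field_simps mult_left_mono)
      moreover have "norm (k y - k 0) \<le> 2 * K" using kK[of y] kK[of 0] norm_triangle_ineq4[of "k y" "k 0"] by linarith
      ultimately show ?thesis using r by linarith
    qed
    have "(\<lambda>n. r/2 + D * (bdiag n / bdiag (Suc n) - 1/4)) \<longlonglongrightarrow> r/2 + D * (1/4 - 1/4)"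
      by (intro tendsto_intros bdiag_ratio)
    from order_tendstoD(2)[OF this, of r] r
    have "\<forall>\<^sub>F n in sequentially. r/2 + D * (bdiag n / bdiag (Suc n) - 1/4) < r" by simp
    then obtain n0 where "\<And>n. n \<ge> n0 \<Longrightarrow> r/2 + D * (bdiag n / bdiag (Suc n) - 1/4) < r"
      by (auto simp: eventually_sequentially)
    thus "\<exists>no. \<forall>n\<ge>no. dist (bline (P + of_nat (Suc n)) (Q + of_nat (Suc n)) / of_real (bdiag (Suc n))) (k 0) < r"
      unfolding dist_norm using main[OF D] order.strict_trans1 by blast
  qed
  thus ?thesis unfolding k0 by (rule LIMSEQ_imp_Suc)
qed

section \<open>Gamma asymptotics and Cauchy's beta integral\<close>

definition gamma_scale :: "complex \<Rightarrow> nat \<Rightarrow> complex" where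
  "gamma_scale z n = fact (n - 1) * exp (z * of_real (ln (real n)))"

lemma gamma_scale_nonzero: "gamma_scale z n \<noteq> 0" by (simp add: gamma_scale_def)

text \<open>Euler's limit for Gamma: its approximants \<open>Gamma_series'\<close> contain
  \<open>pochhammer z n\<close>, which is \<open>Gamma (z + n) / Gamma z\<close>.\<close>

lemma Gamma_shift_asymp:
  assumes "z \<notin> \<int>\<^sub>\<le>\<^sub>0"
  shows "(\<lambda>n. Gamma (z + of_nat n) / gamma_scale z n) \<longlonglongrightarrow> 1"
proof -
  have G: "Gamma z \<noteq> 0" using assms by (simp add: Gamma_eq_zero_iff)
  have "(\<lambda>n. Gamma z / Gamma_series' z n) \<longlonglongrightarrow> Gamma z / Gamma z"
    using G by (intro tendsto_intros Gamma_series'_LIMSEQ)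
  moreover have "Gamma z / Gamma_series' z n = Gamma (z + of_nat n) / gamma_scale z n" for n
    using G assms by (simp add: Gamma_series'_def gamma_scale_def pochhammer_Gamma)
  ultimately show ?thesis using G by simp
qed

definition beta_recip :: "complex \<Rightarrow> complex \<Rightarrow> complex" where
  "beta_recip P Q = Gamma (P + Q - 1) / (Gamma P * Gamma Q)"

lemma Re_pos_not_nonpos_Int: "Re z > 0 \<Longrightarrow> z \<notin> \<int>\<^sub>\<le>\<^sub>0"
  by (auto elim!: nonpos_Ints_cases)

lemma Gamma_nonzero_Re_pos: "Re z > 0 \<Longrightarrow> Gamma z \<noteq> 0"
  by (simp add: Gamma_eq_zero_iff Re_pos_not_nonpos_Int)

text \<open>The recursion is that of \<open>bline_Suc_both\<close>, so the quotient of the integral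
  and its claimed value is invariant under common shifts.\<close>

lemma beta_recip_Suc_both:
  assumes "Re P \<ge> 1" "Re Q \<ge> 2"
  shows "beta_recip (P + 1) (Q + 1) = (P + Q - 1) * (P + Q) / (P * Q) * beta_recip P Q"
proof -
  have G: "Gamma (z + 1) = z * Gamma z" if "Re z > 0" for z :: complex
    using that by (intro Gamma_plus1 Re_pos_not_nonpos_Int)
  have e: "P + 1 + (Q + 1) - 1 = P + Q + 1" "P + Q = (P + Q - 1) + 1" by simp_all
  have "Gamma (P + Q + 1) = (P + Q) * ((P + Q - 1) * Gamma (P + Q - 1))"
    using assms G[of "P + Q"] G[of "P + Q - 1"] by simp
  moreover have "Gamma (P + 1) = P * Gamma P" "Gamma (Q + 1) = Q * Gamma Q"
    using assms by (auto intro!: G)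
  ultimately show ?thesis unfolding beta_recip_def e(1) by (simp add: mult_ac)
qed

lemma bline_over_Bq:
  assumes "Re P \<ge> 1" "Re Q \<ge> 2"
  shows "bline (P + of_nat n) (Q + of_nat n) / beta_recip (P + of_nat n) (Q + of_nat n) = bline P Q / beta_recip P Q"
proof (induction n)
  case (Suc n)
  let ?P = "P + of_nat n" and ?Q = "Q + of_nat n"
  have 1: "Re ?P \<ge> 1" "Re ?Q \<ge> 2" using assms by auto
  have nz: "(?P + ?Q - 1) * (?P + ?Q) / (?P * ?Q) \<noteq> 0"
  proof -
    have "?P + ?Q - 1 \<noteq> 0" "?P + ?Q \<noteq> 0" "?P \<noteq> 0" "?Q \<noteq> 0"
      using 1 by (auto simp only: complex_eq_iff plus_complex.simps minus_complex.simps zero_complex.simps one_complex.simps)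
    thus ?thesis by simp
  qed
  have "bline (?P + 1) (?Q + 1) / beta_recip (?P + 1) (?Q + 1) = bline ?P ?Q / beta_recip ?P ?Q"
    using nz unfolding bline_Suc_both[OF 1] beta_recip_Suc_both[OF 1] by (rule mult_divide_mult_cancel_left)
  with Suc show ?case by (simp add: add_ac)
qed auto

lemma beta_recip_shift_asymp:
  assumes "Re P \<ge> 1" "Re Q \<ge> 1"
  shows "(\<lambda>n. beta_recip (P + of_nat n) (Q + of_nat n) / (gamma_scale (P + Q - 1) (2 * n) / (gamma_scale P n * gamma_scale Q n))) \<longlonglongrightarrow> 1"
proof -
  have 1: "(\<lambda>n. Gamma (P + Q - 1 + of_nat (2 * n)) / gamma_scale (P + Q - 1) (2 * n)) \<longlonglongrightarrow> 1"
  proof (rule LIMSEQ_subseq_LIMSEQ[OF Gamma_shift_asymp, unfolded o_def])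
    show "strict_mono (\<lambda>n::nat. 2 * n)" by (auto simp: strict_mono_def)
  qed (use assms in \<open>auto intro!: Re_pos_not_nonpos_Int\<close>)
  have 2: "(\<lambda>n. Gamma (P + of_nat n) / gamma_scale P n) \<longlonglongrightarrow> 1" "(\<lambda>n. Gamma (Q + of_nat n) / gamma_scale Q n) \<longlonglongrightarrow> 1"
    using assms by (auto intro!: Gamma_shift_asymp Re_pos_not_nonpos_Int)
  have "(\<lambda>n. (Gamma (P + Q - 1 + of_nat (2 * n)) / gamma_scale (P + Q - 1) (2 * n)) /
      ((Gamma (P + of_nat n) / gamma_scale P n) * (Gamma (Q + of_nat n) / gamma_scale Q n))) \<longlonglongrightarrow> 1 / (1 * 1)"
    by (intro tendsto_divide tendsto_mult 1 2) auto
  moreover have "P + of_nat n + (Q + of_nat n) - 1 = P + Q - 1 + of_nat (2 * n)" for n by simp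
  ultimately show ?thesis unfolding beta_recip_def by (simp add: field_simps)
qed

text \<open>The factorials and the powers of \<open>n\<close> agree for both parameter pairs; only
  the power of 2 coming from \<open>ln (2 * n)\<close> in the numerator remembers
  \<open>P + Q\<close>. The 3 is the sum of the reference pair \<open>(1, 2)\<close>.\<close>

lemma gamma_scale_ratio:
  assumes "n > 0"
  shows "gamma_scale (P + Q - 1) (2 * n) / (gamma_scale P n * gamma_scale Q n) =
    exp ((P + Q - 3) * of_real (ln 2)) * (gamma_scale 2 (2 * n) / (gamma_scale 1 n * gamma_scale 2 n))"
proof -
  have ln: "ln (real (2 * n)) = ln 2 + ln (real n)" using assms by (simp add: ln_mult)
  have "exp ((P + Q - 1) * (of_real (ln 2) + of_real (ln (real n)))) * (exp (of_real (ln (real n))) * exp (2 * of_real (ln (real n))))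
      = exp ((P + Q - 3) * complex_of_real (ln 2)) * exp (2 * (of_real (ln 2) + of_real (ln (real n)))) *
        (exp (P * of_real (ln (real n))) * exp (Q * of_real (ln (real n))))"
    by (simp add: exp_add[symmetric] algebra_simps)
  thus ?thesis
    unfolding gamma_scale_def ln by (simp add: divide_simps mult_ac)
qed

text \<open>Relative to the reference pair \<open>(1, 2)\<close>, the shifted integrals and the
  shifted Gamma quotients have the same limit \<open>q\<close>, that is 2 to the power
  \<open>P + Q - 3\<close>: for the integrals it is read off the integrand at the midpoint
  \<open>1/2\<close>, for Gamma it comes from the doubled shift in the numerator. Since the quotient
  of integral and Gamma expression does not change under shifts, it equals the one at
  \<open>(1, 2)\<close>, which is \<open>2 * pi\<close>.\<close>

theorem Cauchy_beta_integral:
  assumes P: "Re P \<ge> 1" and Q: "Re Q \<ge> 2"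
  shows "bline P Q = 2 * of_real pi * Gamma (P + Q - 1) / (Gamma P * Gamma Q)"
proof -
  define q where "q = exp ((P + Q - 3) * complex_of_real (ln 2))"
  have half: "bfun P Q (1/2) = exp ((P + Q) * complex_of_real (ln 2))" for P Q
  proof -
    have "Ln (1/2) = - complex_of_real (ln 2)"
      using Ln_of_real[of "1/2"] by (simp add: ln_div)
    thus ?thesis by (simp add: bfun_def powr_def exp_add[symmetric] algebra_simps)
  qed
  have "(\<lambda>n. (bline (P + of_nat n) (Q + of_nat n) / of_real (bdiag n)) / (bline (1 + of_nat n) (2 + of_nat n) / of_real (bdiag n)))
        \<longlonglongrightarrow> (bfun P Q (1/2) / 4) / (bfun 1 2 (1/2) / 4)"
    using P Q by (intro tendsto_divide bline_diag_shift_limit) (auto simp: half)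
  also have "(bfun P Q (1/2) / 4) / (bfun 1 2 (1/2) / 4) = q"
    unfolding half q_def by (simp add: exp_diff[symmetric] algebra_simps)
  finally have "(\<lambda>n. (bline (P + of_nat n) (Q + of_nat n) / of_real (bdiag n)) / (bline (1 + of_nat n) (2 + of_nat n) / of_real (bdiag n))) \<longlonglongrightarrow> q" .
  moreover have "\<forall>\<^sub>F n in sequentially. (bline (P + of_nat n) (Q + of_nat n) / of_real (bdiag n)) / (bline (1 + of_nat n) (2 + of_nat n) / of_real (bdiag n))
      = bline (P + of_nat n) (Q + of_nat n) / bline (1 + of_nat n) (2 + of_nat n)"
    using eventually_gt_at_top[of 0]
  proof eventually_elim
    case (elim n)
    then obtain m where "n = Suc m" by (cases n) auto
    with bdiag_pos[of m] show ?case by simp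
  qed
  ultimately have lM: "(\<lambda>n. bline (P + of_nat n) (Q + of_nat n) / bline (1 + of_nat n) (2 + of_nat n)) \<longlonglongrightarrow> q"
    by (rule Lim_transform_eventually)
  let ?s = "\<lambda>P Q n. gamma_scale (P + Q - 1) (2 * n) / (gamma_scale P n * gamma_scale Q n)"
  have "(\<lambda>n. q * ((beta_recip (P + of_nat n) (Q + of_nat n) / ?s P Q n) / (beta_recip (1 + of_nat n) (2 + of_nat n) / ?s 1 2 n))) \<longlonglongrightarrow> q * (1 / 1)"
    using P Q by (intro tendsto_intros beta_recip_shift_asymp) auto
  moreover have "\<forall>\<^sub>F n in sequentially. q * ((beta_recip (P + of_nat n) (Q + of_nat n) / ?s P Q n) / (beta_recip (1 + of_nat n) (2 + of_nat n) / ?s 1 2 n))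
      = beta_recip (P + of_nat n) (Q + of_nat n) / beta_recip (1 + of_nat n) (2 + of_nat n)"
    using eventually_gt_at_top[of 0]
  proof eventually_elim
    case (elim n)
    have s: "?s P Q n = q * ?s 1 2 n" using gamma_scale_ratio[OF elim, of P Q] by (simp add: q_def)
    have "?s 1 2 n \<noteq> 0" "q \<noteq> 0" by (simp_all add: gamma_scale_nonzero q_def)
    thus ?case unfolding s by simp
  qed
  ultimately have lB: "(\<lambda>n. beta_recip (P + of_nat n) (Q + of_nat n) / beta_recip (1 + of_nat n) (2 + of_nat n)) \<longlonglongrightarrow> q"
    using Lim_transform_eventually by force
  have q0: "q \<noteq> 0" by (simp add: q_def)
  have "(\<lambda>n. (bline (P + of_nat n) (Q + of_nat n) / bline (1 + of_nat n) (2 + of_nat n)) /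
      (beta_recip (P + of_nat n) (Q + of_nat n) / beta_recip (1 + of_nat n) (2 + of_nat n))) \<longlonglongrightarrow> q / q"
    by (rule tendsto_divide[OF lM lB q0])
  moreover have "(bline (P + of_nat n) (Q + of_nat n) / bline (1 + of_nat n) (2 + of_nat n)) /
      (beta_recip (P + of_nat n) (Q + of_nat n) / beta_recip (1 + of_nat n) (2 + of_nat n)) = (bline P Q / beta_recip P Q) / (bline 1 2 / beta_recip 1 2)" for n
  proof -
    have "(bline (P + of_nat n) (Q + of_nat n) / bline (1 + of_nat n) (2 + of_nat n)) /
      (beta_recip (P + of_nat n) (Q + of_nat n) / beta_recip (1 + of_nat n) (2 + of_nat n)) =
      (bline (P + of_nat n) (Q + of_nat n) / beta_recip (P + of_nat n) (Q + of_nat n)) /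
      (bline (1 + of_nat n) (2 + of_nat n) / beta_recip (1 + of_nat n) (2 + of_nat n))"
      by (simp add: divide_simps)
    thus ?thesis using bline_over_Bq[OF P Q, of n] bline_over_Bq[of 1 2 n] by simp
  qed
  ultimately have "(bline P Q / beta_recip P Q) / (bline 1 2 / beta_recip 1 2) = 1"
    using q0 by (simp add: LIMSEQ_const_iff)
  moreover have "beta_recip 1 2 = 1" using Gamma_plus1[of "1::complex"] by (simp add: beta_recip_def)
  ultimately have "bline P Q / beta_recip P Q = 2 * of_real pi" by (simp add: bline_1_2 split: if_splits)
  moreover have "beta_recip P Q \<noteq> 0" using P Q by (simp add: beta_recip_def Gamma_nonzero_Re_pos)
  ultimately show ?thesis by (simp add: beta_recip_def field_simps)
qed

section \<open>Moving the line across a pole\<close>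

lemma continuous_on_line:
  assumes "continuous_on S g" "\<And>y. Complex \<sigma> y \<in> S"
  shows "continuous_on A (\<lambda>y. g (Complex \<sigma> y))"
proof -
  have "continuous_on A (Complex \<sigma>)" unfolding Complex_eq[abs_def] by (intro continuous_intros)
  moreover have "continuous_on (Complex \<sigma> ` A) g"
    using assms by (auto intro: continuous_on_subset)
  ultimately show ?thesis using continuous_on_compose[of A "Complex \<sigma>" g] by (simp add: o_def)
qed

text \<open>Cauchy's theorem through a primitive on the convex strip: the two integrals differ by
  increments of the primitive along horizontal segments at the heights \<open>T\<close> and
  \<open>-T\<close>. Only decay of \<open>q\<close> enters, so \<open>q\<close> may be a difference
  quotient of order \<open>1 / |y|\<close>, which is too slow for integrability.\<close>

lemma truncated_shift:
  assumes q: "q holomorphic_on strip" and \<sigma>: "0 < \<sigma>1" "\<sigma>1 \<le> \<sigma>2" "\<sigma>2 < 1"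
    and b: "\<And>\<sigma> y. \<sigma>1 \<le> \<sigma> \<Longrightarrow> \<sigma> \<le> \<sigma>2 \<Longrightarrow> y \<noteq> 0 \<Longrightarrow> norm (q (Complex \<sigma> y)) \<le> b \<bar>y\<bar>"
    and b0: "(b \<longlongrightarrow> 0) at_top"
  shows "((\<lambda>T. integral {-T..T} (\<lambda>y. q (Complex \<sigma>2 y)) - integral {-T..T} (\<lambda>y. q (Complex \<sigma>1 y))) \<longlongrightarrow> 0) at_top"
proof -
  obtain F where F: "\<And>s. s \<in> strip \<Longrightarrow> (F has_field_derivative q s) (at s within strip)"
    using holomorphic_convex_primitive'[OF convex_strip open_strip q] by blast
  hence F': "(F has_field_derivative q s) (at s)" if "s \<in> strip" for s
    using at_within_open[OF that open_strip] that by metis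
  have int: "integral {-T..T} (\<lambda>y. q (Complex \<sigma> y)) = (F (Complex \<sigma> T) - F (Complex \<sigma> (-T))) / \<i>"
    if "0 < \<sigma>" "\<sigma> < 1" "0 \<le> T" for \<sigma> T
  proof -
    have "((\<lambda>y. \<i> * q (Complex \<sigma> y)) has_integral (F (Complex \<sigma> T) - F (Complex \<sigma> (-T)))) {-T..T}"
      using that by (intro has_integral_vertical_primitive F') auto
    from has_integral_mult_right[OF this, of "1/\<i>"] show ?thesis by (intro integral_unique) auto
  qed
  have d: "norm (F (Complex \<sigma>2 y) - F (Complex \<sigma>1 y)) \<le> b \<bar>y\<bar> * (\<sigma>2 - \<sigma>1)" if "y \<noteq> 0" for y
  proof -
    have seg: "\<exists>\<sigma>. s = Complex \<sigma> y \<and> \<sigma>1 \<le> \<sigma> \<and> \<sigma> \<le> \<sigma>2" if "s \<in> closed_segment (Complex \<sigma>1 y) (Complex \<sigma>2 y)" for s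
    proof -
      from that obtain u where u: "0 \<le> u" "u \<le> 1" "s = (1 - u) *\<^sub>R Complex \<sigma>1 y + u *\<^sub>R Complex \<sigma>2 y"
        by (auto simp: closed_segment_def)
      have "s = Complex (\<sigma>1 + u * (\<sigma>2 - \<sigma>1)) y" by (simp add: u(3) complex_eq_iff algebra_simps)
      moreover have "0 \<le> u * (\<sigma>2 - \<sigma>1)" "u * (\<sigma>2 - \<sigma>1) \<le> 1 * (\<sigma>2 - \<sigma>1)"
        using u \<sigma> mult_right_mono[of u 1 "\<sigma>2 - \<sigma>1"] by auto
      ultimately show ?thesis by (intro exI[of _ "\<sigma>1 + u * (\<sigma>2 - \<sigma>1)"]) auto
    qed
    have "norm (F (Complex \<sigma>2 y) - F (Complex \<sigma>1 y)) \<le> b \<bar>y\<bar> * norm (Complex \<sigma>2 y - Complex \<sigma>1 y)"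
    proof (rule field_differentiable_bound[where S="closed_segment (Complex \<sigma>1 y) (Complex \<sigma>2 y)" and f'=q])
      fix s assume "s \<in> closed_segment (Complex \<sigma>1 y) (Complex \<sigma>2 y)"
      with seg obtain \<sigma> where s: "s = Complex \<sigma> y" "\<sigma>1 \<le> \<sigma>" "\<sigma> \<le> \<sigma>2" by blast
      hence "s \<in> strip" using \<sigma> by simp
      thus "(F has_field_derivative q s) (at s within closed_segment (Complex \<sigma>1 y) (Complex \<sigma>2 y))"
        by (rule has_field_derivative_at_within[OF F'])
      show "norm (q s) \<le> b \<bar>y\<bar>" unfolding s(1) using s(2,3) that by (rule b)
    qed auto
    also have "norm (Complex \<sigma>2 y - Complex \<sigma>1 y) = \<sigma>2 - \<sigma>1" using \<sigma> by (simp add: cmod_def)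
    finally show ?thesis .
  qed
  have "((\<lambda>T. 2 * (b T * (\<sigma>2 - \<sigma>1))) \<longlongrightarrow> 2 * (0 * (\<sigma>2 - \<sigma>1))) at_top"
    by (intro tendsto_intros b0)
  hence lim: "((\<lambda>T. 2 * (b T * (\<sigma>2 - \<sigma>1))) \<longlongrightarrow> 0) at_top" by simp
  show ?thesis
  proof (rule Lim_null_comparison[OF _ lim])
    show "\<forall>\<^sub>F T in at_top. norm (integral {-T..T} (\<lambda>y. q (Complex \<sigma>2 y)) - integral {-T..T} (\<lambda>y. q (Complex \<sigma>1 y)))
       \<le> 2 * (b T * (\<sigma>2 - \<sigma>1))"
      using eventually_gt_at_top[of 0]
    proof eventually_elim
      case (elim T)
      have "integral {-T..T} (\<lambda>y. q (Complex \<sigma>2 y)) - integral {-T..T} (\<lambda>y. q (Complex \<sigma>1 y))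
        = ((F (Complex \<sigma>2 T) - F (Complex \<sigma>1 T)) - (F (Complex \<sigma>2 (-T)) - F (Complex \<sigma>1 (-T)))) / \<i>"
        using elim \<sigma> by (simp add: int field_simps)
      also have "norm \<dots> \<le> norm (F (Complex \<sigma>2 T) - F (Complex \<sigma>1 T)) + norm (F (Complex \<sigma>2 (-T)) - F (Complex \<sigma>1 (-T)))"
        unfolding norm_divide by (simp add: norm_triangle_ineq4)
      also have "\<dots> \<le> 2 * (b T * (\<sigma>2 - \<sigma>1))"
        using d[of T] d[of "-T"] elim by simp
      finally show ?case .
    qed
  qed
qed

lemma vline_shift:
  assumes "q holomorphic_on strip" and "0 < \<sigma>1" "\<sigma>1 \<le> \<sigma>2" "\<sigma>2 < 1"
    and "\<And>\<sigma> y. \<sigma>1 \<le> \<sigma> \<Longrightarrow> \<sigma> \<le> \<sigma>2 \<Longrightarrow> y \<noteq> 0 \<Longrightarrow> norm (q (Complex \<sigma> y)) \<le> b \<bar>y\<bar>"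
    and "(b \<longlongrightarrow> 0) at_top"
    and i: "integrable lborel (\<lambda>y. q (Complex \<sigma>1 y))" "integrable lborel (\<lambda>y. q (Complex \<sigma>2 y))"
  shows "vline \<sigma>2 q = vline \<sigma>1 q"
  using tendsto_unique[OF _ tendsto_diff[OF LINT_tendsto_truncated[OF i(2)] LINT_tendsto_truncated[OF i(1)]]
      truncated_shift[OF assms(1-6)]]
  by (simp add: vline_def)

text \<open>The primitive is \<open>- \<i> * Ln (Complex \<beta> y)\<close> up to constants, split
  into an angle and a logarithm. Written with \<open>arctan (y / \<beta>)\<close> the angle is
  smooth on the whole line for either sign of \<beta>, and the logarithm is even in \<open>y\<close>
  and cancels on a symmetric interval.\<close>

lemma integral_pole_line:
  assumes "\<beta> \<noteq> 0" "T \<ge> 0"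
  shows "((\<lambda>y. 1 / Complex \<beta> y) has_integral of_real (2 * arctan (T / \<beta>))) {-T..T}"
proof -
  let ?F = "\<lambda>y. of_real (arctan (y / \<beta>)) - \<i> / 2 * of_real (ln (\<beta>\<^sup>2 + y\<^sup>2))"
  have "((\<lambda>y. 1 / Complex \<beta> y) has_integral ?F T - ?F (-T)) {-T..T}"
  proof (rule fundamental_theorem_of_calculus)
    fix y assume "y \<in> {-T..T}"
    have pos: "\<beta>\<^sup>2 + y\<^sup>2 > 0" using assms by (simp add: add_pos_nonneg)
    have e: "1 + (y / \<beta>)\<^sup>2 = (\<beta>\<^sup>2 + y\<^sup>2) / \<beta>\<^sup>2"
      using assms by (simp add: power_divide add_divide_distrib)
    have "((\<lambda>y. arctan (y / \<beta>)) has_real_derivative inverse (1 + (y / \<beta>)\<^sup>2) * (1 / \<beta>)) (at y within {-T..T})"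
      by (intro DERIV_chain2[OF DERIV_arctan]) (use assms in \<open>auto intro!: derivative_eq_intros\<close>)
    moreover have "inverse (1 + (y / \<beta>)\<^sup>2) * (1 / \<beta>) = \<beta> / (\<beta>\<^sup>2 + y\<^sup>2)"
      unfolding e using assms by (simp add: power2_eq_square)
    ultimately have 1: "((\<lambda>y. arctan (y / \<beta>)) has_real_derivative \<beta> / (\<beta>\<^sup>2 + y\<^sup>2)) (at y within {-T..T})"
      by simp
    have 2: "((\<lambda>y. ln (\<beta>\<^sup>2 + y\<^sup>2)) has_real_derivative 2 * y / (\<beta>\<^sup>2 + y\<^sup>2)) (at y within {-T..T})"
      using pos by (auto intro!: derivative_eq_intros)
    have "(?F has_vector_derivative (of_real (\<beta> / (\<beta>\<^sup>2 + y\<^sup>2)) - \<i> / 2 * of_real (2 * y / (\<beta>\<^sup>2 + y\<^sup>2)))) (at y within {-T..T})"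
      using has_vector_derivative_of_real[OF 1] has_vector_derivative_of_real[OF 2]
      by (intro has_vector_derivative_diff has_vector_derivative_mult_right)
    moreover have "of_real (\<beta> / (\<beta>\<^sup>2 + y\<^sup>2)) - \<i> / 2 * of_real (2 * y / (\<beta>\<^sup>2 + y\<^sup>2)) = 1 / Complex \<beta> y"
    proof -
      define r where "r = \<beta>\<^sup>2 + y\<^sup>2"
      have "\<beta> / r * \<beta> + y / r * y = (\<beta>\<^sup>2 + y\<^sup>2) / r"
        by (simp add: power2_eq_square add_divide_distrib)
      also have "\<dots> = 1" unfolding r_def by (rule divide_self[OF less_imp_neq[OF pos, symmetric]])
      finally have "Complex (\<beta> / r) (- (y / r)) * Complex \<beta> y = 1"
        by (simp add: complex_eq_iff)
      hence "Complex (\<beta> / r) (- (y / r)) = 1 / Complex \<beta> y"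
        using assms by (subst eq_divide_eq) (auto simp: complex_eq_iff)
      moreover have "of_real (\<beta> / r) - \<i> / 2 * of_real (2 * y / r) = Complex (\<beta> / r) (- (y / r))"
        unfolding Complex_eq by simp
      ultimately show ?thesis unfolding r_def by simp
    qed
    ultimately show "(?F has_vector_derivative 1 / Complex \<beta> y) (at y within {-T..T})" by simp
  qed (use assms in auto)
  thus ?thesis by (simp add: arctan_minus)
qed

text \<open>With \<open>w (of_real x) / (s - of_real x)\<close> subtracted, the quotient is
  holomorphic and of order \<open>1 / |y|\<close>, so the preceding shift applies. The subtracted
  fraction has truncated integrals tending to \<pi> times \<open>w (of_real x)\<close> right of the
  pole and to minus that left of it; the difference is the residue.\<close>

lemma vline_shift_pole:
  assumes w: "w holomorphic_on strip" and \<sigma>: "0 < \<sigma>1" "\<sigma>1 < x" "x < \<sigma>2" "\<sigma>2 < 1"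
    and b: "\<And>\<sigma> y. \<sigma>1 \<le> \<sigma> \<Longrightarrow> \<sigma> \<le> \<sigma>2 \<Longrightarrow> norm (w (Complex \<sigma> y)) \<le> K"
    and i: "integrable lborel (\<lambda>y. w (Complex \<sigma>1 y) / (Complex \<sigma>1 y - of_real x))"
       "integrable lborel (\<lambda>y. w (Complex \<sigma>2 y) / (Complex \<sigma>2 y - of_real x))"
  shows "vline \<sigma>2 (\<lambda>s. w s / (s - of_real x)) = vline \<sigma>1 (\<lambda>s. w s / (s - of_real x)) + 2 * of_real pi * w (of_real x)"
proof -
  define q where "q = (\<lambda>s. if s = of_real x then deriv w (of_real x) else (w s - w (of_real x)) / (s - of_real x))"
  have q: "q holomorphic_on strip"
    unfolding q_def by (rule pole_lemma_open[OF w open_strip])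
  have bq: "norm (q (Complex \<sigma> y)) \<le> (\<lambda>y. (K + norm (w (of_real x))) / y) \<bar>y\<bar>" if "\<sigma>1 \<le> \<sigma>" "\<sigma> \<le> \<sigma>2" "y \<noteq> 0" for \<sigma> y
  proof -
    have ne: "Complex \<sigma> y \<noteq> of_real x" using that by (auto simp: complex_eq_iff)
    have "\<bar>y\<bar> \<le> norm (Complex \<sigma> y - of_real x)" using abs_Im_le_cmod[of "Complex \<sigma> y - of_real x"] by simp
    moreover have "norm (w (Complex \<sigma> y) - w (of_real x)) \<le> K + norm (w (of_real x))"
      using b[OF that(1,2), of y] norm_triangle_ineq4[of "w (Complex \<sigma> y)" "w (of_real x)"] by linarith
    moreover from this have "0 \<le> K + norm (w (of_real x))" using norm_ge_zero order_trans by blast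
    ultimately have "norm (w (Complex \<sigma> y) - w (of_real x)) / norm (Complex \<sigma> y - of_real x) \<le> (K + norm (w (of_real x))) / \<bar>y\<bar>"
      using that by (intro frac_le) auto
    thus ?thesis using ne by (simp add: q_def norm_divide)
  qed
  have "((\<lambda>y. (K + norm (w (of_real x))) / y) \<longlongrightarrow> 0) at_top"
    by (intro tendsto_divide_0[OF tendsto_const] filterlim_at_top_imp_at_infinity filterlim_ident)
  from truncated_shift[OF q \<sigma>(1) _ \<sigma>(4) bq this]
  have L1: "((\<lambda>T. integral {-T..T} (\<lambda>y. q (Complex \<sigma>2 y)) - integral {-T..T} (\<lambda>y. q (Complex \<sigma>1 y))) \<longlongrightarrow> 0) at_top"
    using \<sigma> by simp
  have split: "integral {-T..T} (\<lambda>y. w (Complex \<sigma> y) / (Complex \<sigma> y - of_real x)) =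
      integral {-T..T} (\<lambda>y. q (Complex \<sigma> y)) + w (of_real x) * of_real (2 * arctan (T / (\<sigma> - x)))"
    if "0 < \<sigma>" "\<sigma> < 1" "\<sigma> \<noteq> x" "T \<ge> 0" for \<sigma> T
  proof -
    have ne: "Complex \<sigma> y \<noteq> of_real x" for y using that by (auto simp: complex_eq_iff)
    have e: "Complex \<sigma> y - of_real x = Complex (\<sigma> - x) y" for y by (simp add: complex_eq_iff)
    have eq: "w (Complex \<sigma> y) / (Complex \<sigma> y - of_real x) = q (Complex \<sigma> y) + w (of_real x) * (1 / Complex (\<sigma> - x) y)" for y
      using ne[of y] unfolding e[symmetric] by (simp add: q_def diff_divide_distrib)
    have "continuous_on {-T..T} (\<lambda>y. q (Complex \<sigma> y))"
      using that by (intro continuous_on_line[OF holomorphic_on_imp_continuous_on[OF q]]) auto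
    hence "(\<lambda>y. q (Complex \<sigma> y)) integrable_on {-T..T}" by (rule integrable_continuous_interval)
    from has_integral_add[OF integrable_integral[OF this] has_integral_mult_right[OF integral_pole_line[of "\<sigma> - x" T], of "w (of_real x)"]]
    show ?thesis unfolding eq using that by (intro integral_unique) auto
  qed
  have at: "((\<lambda>T. arctan (T / (\<sigma>2 - x))) \<longlongrightarrow> pi/2) at_top"
  proof (rule filterlim_compose[OF tendsto_arctan_at_top])
    show "filterlim (\<lambda>T. T / (\<sigma>2 - x)) at_top at_top"
      using filterlim_tendsto_pos_mult_at_top[OF tendsto_const[of "1/(\<sigma>2-x)"] _ filterlim_ident] \<sigma> by simp
  qed
  have at2: "((\<lambda>T. arctan (T / (\<sigma>1 - x))) \<longlongrightarrow> -(pi/2)) at_top"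
  proof (rule filterlim_compose[OF tendsto_arctan_at_bot])
    show "filterlim (\<lambda>T. T / (\<sigma>1 - x)) at_bot at_top"
      using filterlim_tendsto_neg_mult_at_bot[OF tendsto_const[of "1/(\<sigma>1-x)"] _ filterlim_ident] \<sigma> by simp
  qed
  have "((\<lambda>T. (integral {-T..T} (\<lambda>y. q (Complex \<sigma>2 y)) - integral {-T..T} (\<lambda>y. q (Complex \<sigma>1 y))) +
     (w (of_real x) * of_real (2 * arctan (T / (\<sigma>2 - x))) - w (of_real x) * of_real (2 * arctan (T / (\<sigma>1 - x))))) \<longlongrightarrow>
     0 + (w (of_real x) * of_real (2 * (pi/2)) - w (of_real x) * of_real (2 * (-(pi/2))))) at_top"
    by (intro tendsto_add tendsto_diff tendsto_mult tendsto_const tendsto_of_real L1 at at2)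
  moreover have "\<forall>\<^sub>F T in at_top. (integral {-T..T} (\<lambda>y. q (Complex \<sigma>2 y)) - integral {-T..T} (\<lambda>y. q (Complex \<sigma>1 y))) +
     (w (of_real x) * of_real (2 * arctan (T / (\<sigma>2 - x))) - w (of_real x) * of_real (2 * arctan (T / (\<sigma>1 - x)))) =
    integral {-T..T} (\<lambda>y. w (Complex \<sigma>2 y) / (Complex \<sigma>2 y - of_real x)) - integral {-T..T} (\<lambda>y. w (Complex \<sigma>1 y) / (Complex \<sigma>1 y - of_real x))"
    using eventually_ge_at_top[of 0]
  proof eventually_elim
    case (elim T)
    show ?case using \<sigma> elim split[of \<sigma>1 T] split[of \<sigma>2 T] by (simp only:) auto
  qed
  ultimately have "((\<lambda>T. integral {-T..T} (\<lambda>y. w (Complex \<sigma>2 y) / (Complex \<sigma>2 y - of_real x)) - integral {-T..T} (\<lambda>y. w (Complex \<sigma>1 y) / (Complex \<sigma>1 y - of_real x)))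
    \<longlongrightarrow> 0 + (w (of_real x) * of_real (2 * (pi/2)) - w (of_real x) * of_real (2 * (-(pi/2))))) at_top"
    by (rule Lim_transform_eventually)
  note L = this
  have e: "0 + (w (of_real x) * of_real (2 * (pi/2)) - w (of_real x) * of_real (2 * (-(pi/2)))) = 2 * of_real pi * w (of_real x)"
    by simp
  have "vline \<sigma>2 (\<lambda>s. w s / (s - of_real x)) - vline \<sigma>1 (\<lambda>s. w s / (s - of_real x)) = 2 * of_real pi * w (of_real x)"
    unfolding vline_def e[symmetric]
    by (rule tendsto_unique[OF trivial_limit_at_top_linorder tendsto_diff[OF LINT_tendsto_truncated[OF i(2)] LINT_tendsto_truncated[OF i(1)]] L])
  thus ?thesis by (subst add.commute) (simp only: diff_eq_eq)
qed

section \<open>The hypergeometric function as a line integral\<close>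

lemma vline_bfun_shift:
  assumes "Re P \<ge> 1" "Re Q \<ge> 1" "0 < \<sigma>1" "\<sigma>1 \<le> \<sigma>2" "\<sigma>2 < 1"
  shows "vline \<sigma>2 (bfun P Q) = vline \<sigma>1 (bfun P Q)"
proof (rule vline_shift[OF bfun_holomorphic assms(3-5)])
  define m where "m = min \<sigma>1 (1 - \<sigma>2)"
  have m: "m > 0" "m \<le> \<sigma>1" "\<sigma>2 \<le> 1 - m" using assms by (auto simp: m_def)
  show "norm (bfun P Q (Complex \<sigma> y)) \<le> (\<lambda>y. beta_bound P Q m / (m\<^sup>2 + y\<^sup>2)) \<bar>y\<bar>" if "\<sigma>1 \<le> \<sigma>" "\<sigma> \<le> \<sigma>2" for \<sigma> y
    using norm_bfun_le[of P Q m "Complex \<sigma> y"] assms m that by simp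
  show "((\<lambda>y. beta_bound P Q m / (m\<^sup>2 + y\<^sup>2)) \<longlongrightarrow> 0) at_top"
    by (intro tendsto_divide_0[OF tendsto_const] filterlim_at_top_imp_at_infinity
         filterlim_tendsto_add_at_top[OF tendsto_const] filterlim_pow_at_top filterlim_ident) auto
qed (use assms in \<open>auto intro!: integrable_bfun\<close>)

lemma vline_bfun:
  assumes "Re P \<ge> 1" "Re Q \<ge> 2" "0 < \<sigma>" "\<sigma> < 1"
  shows "vline \<sigma> (bfun P Q) = 2 * of_real pi * Gamma (P + Q - 1) / (Gamma P * Gamma Q)"
proof -
  have "vline \<sigma> (bfun P Q) = bline P Q"
    using vline_bfun_shift[of P Q \<sigma> "1/2"] vline_bfun_shift[of P Q "1/2" \<sigma>] assms
    by (cases "\<sigma> \<le> 1/2") auto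
  thus ?thesis using Cauchy_beta_integral assms by simp
qed

lemma bfun_shift_P_power:
  assumes "s \<in> strip"
  shows "bfun (P + of_nat n) Q s = bfun P Q s / s ^ n"
proof (induction n)
  case (Suc n)
  have "bfun (P + of_nat (Suc n)) Q s = bfun ((P + of_nat n) + 1) Q s" by (simp add: add_ac)
  also have "\<dots> = bfun P Q s / s ^ Suc n"
    by (simp only: bfun_shift_P[OF assms] Suc) (simp add: field_simps)
  finally show ?case .
qed auto

lemma integrable_bfun_pole:
  assumes "Re P \<ge> 1" "Re Q \<ge> 1" "0 < \<sigma>" "\<sigma> < 1" "\<sigma> \<noteq> x"
  shows "integrable lborel (\<lambda>y. bfun P Q (Complex \<sigma> y) / (Complex \<sigma> y - of_real x))"
proof -
  have ne: "Complex \<sigma> y \<noteq> of_real x" for y using assms by (auto simp: complex_eq_iff)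
  have "integrable lborel (\<lambda>y. bfun P Q (Complex \<sigma> y) * (\<lambda>s. inverse (s - of_real x)) (Complex \<sigma> y))"
  proof (rule integrable_bfun_times[where K="inverse \<bar>\<sigma> - x\<bar>"])
    show "continuous_on UNIV (\<lambda>y. inverse (Complex \<sigma> y - of_real x))"
      using ne by (intro continuous_on_inverse continuous_on_diff continuous_on_const)
         (auto simp: Complex_eq[abs_def] intro!: continuous_intros)
    show "norm (inverse (Complex \<sigma> y - of_real x)) \<le> inverse \<bar>\<sigma> - x\<bar>" for y
      unfolding norm_inverse using abs_Re_le_cmod[of "Complex \<sigma> y - of_real x"] assms
      by (intro le_imp_inverse_le) auto
  qed (use assms in auto)
  thus ?thesis by (simp add: divide_inverse)
qed

text \<open>On a line to the right of \<open>x\<close> the ratio \<open>x / s\<close> has norm at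
  most \<open>x / \<sigma> < 1\<close>, so \<open>1 / (s - x)\<close> may be expanded. The
  \<open>n\<close>-th term is the beta integral at \<open>P = C + n\<close> and yields
  \<open>Gamma (A + n) / Gamma (C + n)\<close>, the Pochhammer quotient of the Gauss series with
  second parameter 1.\<close>

lemma hyp2F1_vline_right:
  assumes C: "Re C \<ge> 2" and Q: "Re Q \<ge> 2" and x: "0 < x" "x < \<sigma>" "\<sigma> < 1"
  shows "vline \<sigma> (\<lambda>s. bfun (C - 1) Q s / (s - of_real x)) =
    2 * of_real pi * (hyp2F1 (C + Q - 1) 1 C (of_real x) * Gamma (C + Q - 1) / (Gamma C * Gamma Q))"
proof -
  define A where "A = C + Q - 1"
  define g where "g = (\<lambda>s. bfun (C - 1) Q s / (s - of_real x))"
  define X where "X = complex_of_real x"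
  define I where "I = (LINT y|lborel. norm (g (Complex \<sigma> y)))"
  have ig: "integrable lborel (\<lambda>y. g (Complex \<sigma> y))"
    unfolding g_def using assms by (intro integrable_bfun_pole) auto
  have ib: "integrable lborel (\<lambda>y. bfun (C + of_nat n) Q (Complex \<sigma> y))" for n
    using assms by (intro integrable_bfun) auto
  have nz: "Gamma A \<noteq> 0" "Gamma C \<noteq> 0" "Gamma Q \<noteq> 0" "A \<notin> \<int>\<^sub>\<le>\<^sub>0" "C \<notin> \<int>\<^sub>\<le>\<^sub>0"
    using C Q by (auto intro!: Gamma_nonzero_Re_pos Re_pos_not_nonpos_Int simp: A_def)
  define t where "t = (\<lambda>n. X ^ n * vline \<sigma> (bfun (C + of_nat n) Q))"
  \<comment> \<open>The finite geometric sum keeps its exact remainder, so interchanging series and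
    integral reduces to bounding that remainder by a multiple of
    \<open>(x / \<sigma>) ^ m\<close>.\<close>
  have expand: "(\<Sum>n<m. X ^ n * bfun (C + of_nat n) Q s) = g s - (X / s) ^ m * g s"
    if s: "s \<in> strip" "s \<noteq> X" for s m
  proof -
    have s0: "s \<noteq> 0" using s by (auto simp: strip_def)
    have b: "bfun (C + of_nat n) Q s = bfun (C - 1) Q s / s ^ Suc n" for n
      using bfun_shift_P_power[OF s(1), of "C - 1" "Suc n" Q] by simp
    have "(\<Sum>n<m. X ^ n * bfun (C + of_nat n) Q s) = bfun (C - 1) Q s / s * (\<Sum>n<m. (X / s) ^ n)"
      unfolding b by (simp add: sum_distrib_left power_divide mult_ac)
    also have "(\<Sum>n<m. (X / s) ^ n) = (1 - (X / s) ^ m) / (1 - X / s)"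
      using s s0 by (subst sum_gp_strict) auto
    also have "bfun (C - 1) Q s / s * ((1 - (X / s) ^ m) / (1 - X / s)) = bfun (C - 1) Q s * (1 - (X / s) ^ m) / (s * (1 - X / s))"
      by simp
    also have "s * (1 - X / s) = s - X" using s0 by (simp add: right_diff_distrib)
    also have "bfun (C - 1) Q s * (1 - (X / s) ^ m) / (s - X) = g s - (X / s) ^ m * g s"
      by (simp add: g_def X_def right_diff_distrib diff_divide_distrib)
    finally show ?thesis .
  qed
  have ne: "Complex \<sigma> y \<noteq> X" for y using x by (auto simp: complex_eq_iff X_def)
  have rem: "norm (vline \<sigma> g - (\<Sum>n<m. t n)) \<le> (x / \<sigma>) ^ m * I" for m
  proof -
    have "(\<Sum>n<m. t n) = (LINT y|lborel. (\<Sum>n<m. X ^ n * bfun (C + of_nat n) Q (Complex \<sigma> y)))"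
      unfolding t_def vline_def using ib by (subst Bochner_Integration.integral_sum) auto
    hence "vline \<sigma> g - (\<Sum>n<m. t n) = (LINT y|lborel. g (Complex \<sigma> y) - (\<Sum>n<m. X ^ n * bfun (C + of_nat n) Q (Complex \<sigma> y)))"
      unfolding vline_def using ib ig by (subst Bochner_Integration.integral_diff) auto
    also have "\<dots> = (LINT y|lborel. (X / Complex \<sigma> y) ^ m * g (Complex \<sigma> y))"
      using x ne by (simp add: expand)
    also have "norm \<dots> \<le> (LINT y|lborel. norm ((X / Complex \<sigma> y) ^ m * g (Complex \<sigma> y)))"
      by (rule integral_norm_bound)
    also have "\<dots> \<le> (LINT y|lborel. (x / \<sigma>) ^ m * norm (g (Complex \<sigma> y)))"
    proof (rule integral_mono)
      have "integrable lborel (\<lambda>y. g (Complex \<sigma> y) - (\<Sum>n<m. X ^ n * bfun (C + of_nat n) Q (Complex \<sigma> y)))"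
        using ib ig by simp
      hence "integrable lborel (\<lambda>y. (X / Complex \<sigma> y) ^ m * g (Complex \<sigma> y))"
        using x ne by (simp add: expand)
      thus "integrable lborel (\<lambda>y. norm ((X / Complex \<sigma> y) ^ m * g (Complex \<sigma> y)))" by (rule integrable_norm)
      show "integrable lborel (\<lambda>y. (x / \<sigma>) ^ m * norm (g (Complex \<sigma> y)))" using ig by simp
      fix y
      have "\<sigma> \<le> norm (Complex \<sigma> y)" using complex_Re_le_cmod[of "Complex \<sigma> y"] by simp
      hence "norm (X / Complex \<sigma> y) \<le> x / \<sigma>"
        unfolding norm_divide X_def using x by (intro frac_le) auto
      thus "norm ((X / Complex \<sigma> y) ^ m * g (Complex \<sigma> y)) \<le> (x / \<sigma>) ^ m * norm (g (Complex \<sigma> y))"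
        unfolding norm_mult norm_power by (intro mult_right_mono power_mono) auto
    qed
    also have "\<dots> = (x / \<sigma>) ^ m * I" unfolding I_def by (rule integral_mult_right_zero)
    finally show ?thesis .
  qed
  have "(\<lambda>m. (x / \<sigma>) ^ m * I) \<longlonglongrightarrow> 0 * I"
    by (rule tendsto_mult[OF LIMSEQ_power_zero tendsto_const]) (use x in auto)
  hence "(\<lambda>m. vline \<sigma> g - (\<Sum>n<m. t n)) \<longlonglongrightarrow> 0"
    using Lim_null_comparison[of "\<lambda>m. vline \<sigma> g - (\<Sum>n<m. t n)" "\<lambda>m. (x / \<sigma>) ^ m * I"] rem
    by (simp add: always_eventually)
  from tendsto_diff[OF tendsto_const[of "vline \<sigma> g"] this] have tS: "t sums vline \<sigma> g" by (simp add: sums_def)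
  have teq: "t n = (2 * of_real pi * Gamma A / (Gamma C * Gamma Q)) * (fps_nth (fps_hypergeo [A, 1] [C] 1) n * X ^ n)" for n
  proof -
    have "vline \<sigma> (bfun (C + of_nat n) Q) = 2 * of_real pi * Gamma (A + of_nat n) / (Gamma (C + of_nat n) * Gamma Q)"
      using assms by (subst vline_bfun) (auto simp: A_def algebra_simps)
    moreover have "Gamma (A + of_nat n) = pochhammer A n * Gamma A" "Gamma (C + of_nat n) = pochhammer C n * Gamma C"
      using nz by (simp_all add: pochhammer_Gamma)
    moreover have "pochhammer 1 n = (fact n :: complex)" by (simp add: pochhammer_fact)
    ultimately show ?thesis by (simp add: t_def mult_ac)
  qed
  from tS have "(\<lambda>n. (2 * of_real pi * Gamma A / (Gamma C * Gamma Q)) * (fps_nth (fps_hypergeo [A, 1] [C] 1) n * X ^ n)) sums vline \<sigma> g"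
    unfolding teq[abs_def] .
  from sums_mult_D[OF this] nz have "(\<lambda>n. fps_nth (fps_hypergeo [A, 1] [C] 1) n * X ^ n) sums (vline \<sigma> g / (2 * of_real pi * Gamma A / (Gamma C * Gamma Q)))"
    by simp
  hence "hyp2F1 A 1 C X = vline \<sigma> g / (2 * of_real pi * Gamma A / (Gamma C * Gamma Q))"
    unfolding hyp2F1_def eval_fps_def by (rule sums_unique[symmetric])
  moreover have "g = (\<lambda>s. bfun (C - 1) Q s / (s - X))" by (simp add: g_def X_def)
  ultimately show ?thesis using nz unfolding A_def[symmetric] X_def[symmetric] by simp
qed

text \<open>For \<sigma> < \<open>x\<close> the geometric series diverges near the real point of the
  line, so the line is compared across the pole with one halfway between \<open>x\<close> and
  1.\<close>

lemma hyp2F1_vline: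
  assumes C: "Re C \<ge> 2" and Q: "Re Q \<ge> 2" and x: "0 < x" "x < 1" "0 < \<sigma>" "\<sigma> < 1" "\<sigma> \<noteq> x"
  shows "2 * of_real pi * (hyp2F1 (C + Q - 1) 1 C (of_real x) * Gamma (C + Q - 1) / (Gamma C * Gamma Q)) =
    vline \<sigma> (\<lambda>s. bfun (C - 1) Q s / (s - of_real x)) + (if \<sigma> < x then 2 * of_real pi * bfun (C - 1) Q (of_real x) else 0)"
proof (cases "\<sigma> < x")
  case True
  define \<sigma>2 where "\<sigma>2 = (x + 1) / 2"
  have \<sigma>2: "x < \<sigma>2" "\<sigma>2 < 1" using x by (auto simp: \<sigma>2_def)
  define m where "m = min \<sigma> (1 - \<sigma>2)"
  have m: "m > 0" "m \<le> \<sigma>" "\<sigma>2 \<le> 1 - m" using x \<sigma>2 by (auto simp: m_def)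
  have "norm (bfun (C - 1) Q (Complex \<sigma>' y)) \<le> beta_bound (C - 1) Q m / m\<^sup>2" if "\<sigma> \<le> \<sigma>'" "\<sigma>' \<le> \<sigma>2" for \<sigma>' y
  proof -
    have "norm (bfun (C - 1) Q (Complex \<sigma>' y)) \<le> beta_bound (C - 1) Q m / (m\<^sup>2 + y\<^sup>2)"
      using norm_bfun_le[of "C - 1" Q m "Complex \<sigma>' y"] C Q m that by simp
    also have "\<dots> \<le> beta_bound (C - 1) Q m / m\<^sup>2"
      using m by (intro divide_left_mono beta_bound_nonneg mult_pos_pos) (auto simp: add_pos_nonneg)
    finally show ?thesis .
  qed
  from vline_shift_pole[OF bfun_holomorphic x(3) True \<sigma>2 this integrable_bfun_pole integrable_bfun_pole]
  have "vline \<sigma>2 (\<lambda>s. bfun (C - 1) Q s / (s - of_real x)) =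
     vline \<sigma> (\<lambda>s. bfun (C - 1) Q s / (s - of_real x)) + 2 * of_real pi * bfun (C - 1) Q (of_real x)"
    using C Q x \<sigma>2 by simp
  with hyp2F1_vline_right[OF C Q x(1) \<sigma>2] True show ?thesis by simp
next
  case False
  with hyp2F1_vline_right[OF C Q x(1) _ x(4)] x show ?thesis by simp
qed

section \<open>The complementary error function\<close>

abbreviation gauss :: "real \<Rightarrow> real" where "gauss \<equiv> \<lambda>s. exp (- s\<^sup>2)"

lemma gauss_integral: "has_bochner_integral lborel gauss (sqrt pi)"
  using has_bochner_integral_even_function[OF gaussian_moment_0] by simp

lemma integrable_gauss: "integrable lborel gauss"
  and LINT_gauss: "(LINT s|lborel. gauss s) = sqrt pi"
  using gauss_integral by (auto simp: has_bochner_integral_iff)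

definition gauss_tail :: "real \<Rightarrow> real" where
  "gauss_tail y = (LINT s|lborel. indicator {y..} s * gauss s)"

lemma integrable_gauss_indicator: "A \<in> sets lborel \<Longrightarrow> integrable lborel (\<lambda>s. indicator A s * gauss s)"
  using integrable_mult_indicator[OF _ integrable_gauss] by simp

lemma erfc_gtail: "erfc y = 2 / sqrt pi * gauss_tail y"
proof -
  have "set_integrable lborel {y..} gauss"
    unfolding set_integrable_def using integrable_gauss_indicator[of "{y..}"] by simp
  from set_borel_integral_eq_integral(2)[OF this] show ?thesis
    by (simp add: erfc_def gauss_tail_def set_lebesgue_integral_def)
qed

lemma gauss_tail_minus: "gauss_tail (-y) = sqrt pi - gauss_tail y"
proof -
  have "gauss_tail (-y) = (LINT s|lborel. indicator {-y..} (-s) * gauss (-s))"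
    unfolding gauss_tail_def using lborel_integral_real_affine[of "-1" "\<lambda>s. indicator {-y..} s * gauss s" 0] by simp
  also have "\<dots> = (LINT s|lborel. indicator {..y} s * gauss s)"
    by (intro Bochner_Integration.integral_cong) (auto simp: indicator_def)
  finally have 1: "gauss_tail (-y) = \<dots>" .
  have "(LINT s|lborel. indicator {..y} s * gauss s) + gauss_tail y = (LINT s|lborel. indicator {..y} s * gauss s + indicator {y..} s * gauss s)"
    unfolding gauss_tail_def by (intro Bochner_Integration.integral_add[symmetric] integrable_gauss_indicator) auto
  also have "\<dots> = (LINT s|lborel. gauss s)"
  proof (rule integral_cong_AE)
    have "AE s in lborel. s \<noteq> y" by (rule AE_lborel_singleton)
    thus "AE s in lborel. indicator {..y} s * gauss s + indicator {y..} s * gauss s = gauss s"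
      by eventually_elim (auto simp: indicator_def)
  qed auto
  finally show ?thesis using 1 by (simp add: LINT_gauss)
qed

text \<open>The constant 2 will account for the residue at \<open>s = x\<close>, which is present
  exactly for the lower sign.\<close>

lemma erfc_minus: "erfc (-y) = 2 - erfc y"
  by (simp add: erfc_gtail gauss_tail_minus field_simps)

lemma gauss_tail_eq_integral:
  assumes "0 \<le> y"
  shows "gauss_tail y = gauss_tail 0 - integral {0..y} gauss"
proof -
  have "integral {0..y} gauss = (LINT s|lborel. indicator {0..y} s * gauss s)"
  proof -
    have "set_integrable lborel {0..y} gauss"
      unfolding set_integrable_def using integrable_gauss_indicator[of "{0..y}"] by simp
    from set_borel_integral_eq_integral(2)[OF this] show ?thesis
      by (simp add: set_lebesgue_integral_def)
  qed
  hence "integral {0..y} gauss + gauss_tail y = (LINT s|lborel. indicator {0..y} s * gauss s + indicator {y..} s * gauss s)"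
    unfolding gauss_tail_def by (simp add: Bochner_Integration.integral_add integrable_gauss_indicator)
  also have "\<dots> = gauss_tail 0"
    unfolding gauss_tail_def
  proof (rule integral_cong_AE)
    have "AE s in lborel. s \<noteq> y" by (rule AE_lborel_singleton)
    thus "AE s in lborel. indicator {0..y} s * gauss s + indicator {y..} s * gauss s = indicator {0..} s * gauss s"
      by eventually_elim (use assms in \<open>auto simp: indicator_def\<close>)
  qed auto
  finally show ?thesis by simp
qed

lemma erfc_DERIV:
  assumes "y > 0"
  shows "(erfc has_real_derivative - 2 / sqrt pi * gauss y) (at y)"
proof -
  have "((\<lambda>u. integral {0..u} gauss) has_real_derivative gauss y) (at y within {0..y + 1})"
    using assms by (intro integral_has_real_derivative) (auto intro!: continuous_intros)
  hence "((\<lambda>u. integral {0..u} gauss) has_real_derivative gauss y) (at y)"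
    using assms by (subst (asm) at_within_interior) (auto simp: interior_atLeastAtMost_real)
  hence "((\<lambda>u. 2 / sqrt pi * (gauss_tail 0 - integral {0..u} gauss)) has_real_derivative 2 / sqrt pi * (0 - gauss y)) (at y)"
    by (intro DERIV_cmult DERIV_diff DERIV_const)
  hence "((\<lambda>u. 2 / sqrt pi * (gauss_tail 0 - integral {0..u} gauss)) has_real_derivative - 2 / sqrt pi * gauss y) (at y)"
    by simp
  moreover have "\<forall>\<^sub>F u in nhds y. u \<in> {0<..}" using assms by (intro eventually_nhds_in_open) auto
  hence "\<forall>\<^sub>F u in nhds y. 2 / sqrt pi * (gauss_tail 0 - integral {0..u} gauss) = erfc u"
  proof eventually_elim
    case (elim u)
    thus ?case using gauss_tail_eq_integral[of u] by (simp add: erfc_gtail)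
  qed
  ultimately show ?thesis by (subst (asm) DERIV_cong_ev[OF refl _ refl])
qed

lemma erfc_tendsto_0: "(erfc \<longlongrightarrow> 0) at_top"
proof -
  have "((\<lambda>y. LINT s|lborel. indicator {y..} s * gauss s) \<longlongrightarrow> (LINT s|(lborel :: real measure). (0::real))) at_top"
  proof (rule integral_dominated_convergence_at_top[where w=gauss])
    show "AE s in lborel. ((\<lambda>y. indicator {y..} s * gauss s) \<longlongrightarrow> 0) at_top"
    proof (rule AE_I2)
      fix s :: real
      have "\<forall>\<^sub>F y in at_top. indicator {y..} s * gauss s = 0"
        using eventually_gt_at_top[of s] by eventually_elim (auto simp: indicator_def)
      thus "((\<lambda>y. indicator {y..} s * gauss s) \<longlongrightarrow> 0) at_top" by (rule tendsto_eventually)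
    qed
  qed (auto simp: integrable_gauss indicator_def intro!: always_eventually)
  hence "(gauss_tail \<longlongrightarrow> 0) at_top" by (simp add: gauss_tail_def[abs_def])
  from tendsto_mult[OF tendsto_const this, of "2 / sqrt pi"] show ?thesis by (simp add: erfc_gtail[abs_def])
qed

lemma nonneg_of_antimono_tendsto_0:
  fixes f f' :: "real \<Rightarrow> real"
  assumes "\<And>y. y > 0 \<Longrightarrow> (f has_real_derivative f' y) (at y)" "\<And>y. y > 0 \<Longrightarrow> f' y \<le> 0"
    and "(f \<longlongrightarrow> 0) at_top" "y > 0"
  shows "f y \<ge> 0"
proof (rule tendsto_upperbound[OF assms(3)])
  show "\<forall>\<^sub>F z in at_top. f z \<le> f y"
    using eventually_ge_at_top[of y]
  proof eventually_elim
    case (elim z)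
    show ?case
    proof (rule DERIV_nonpos_imp_nonincreasing[OF elim])
      fix w assume "y \<le> w" "w \<le> z"
      hence "w > 0" using assms(4) by linarith
      thus "\<exists>d. DERIV f w :> d \<and> d \<le> 0" using assms(1,2) by blast
    qed
  qed
qed simp

section \<open>Asymptotic expansion of \<open>erfc\<close> with an explicit remainder\<close>

definition erfc_cf :: "nat \<Rightarrow> real" where "erfc_cf k = (-1) ^ k * Gamma (real k + 1/2)"

lemma erfc_cf_Suc: "2 * erfc_cf (Suc k) = - (2 * real k + 1) * erfc_cf k"
proof -
  have "real k + 1/2 \<notin> \<int>\<^sub>\<le>\<^sub>0" by (auto elim!: nonpos_Ints_cases)
  hence "Gamma (real (Suc k) + 1/2) = (real k + 1/2) * Gamma (real k + 1/2)"
    using Gamma_plus1[of "real k + 1/2"] by (simp add: add_ac)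
  thus ?thesis by (simp add: erfc_cf_def algebra_simps)
qed

lemma gauss_over_power_DERIV:
  assumes "y > 0"
  shows "((\<lambda>y. gauss y / y ^ (2 * k + 1)) has_real_derivative
    - gauss y * (2 / y ^ (2 * k) + (2 * real k + 1) / y ^ (2 * k + 2))) (at y)"
proof -
  define q where "q = y ^ (2 * k)"
  have q: "q \<noteq> 0" "y \<noteq> 0" using assms by (auto simp: q_def)
  have "((\<lambda>y. gauss y) has_real_derivative gauss y * (- (2 * y))) (at y)"
    by (auto intro!: derivative_eq_intros)
  moreover have "((\<lambda>y. y ^ (2 * k + 1)) has_real_derivative (2 * real k + 1) * q) (at y)"
    using DERIV_pow[of "2 * k + 1" y UNIV] by (simp add: q_def add.commute)
  ultimately have "((\<lambda>y. gauss y / y ^ (2 * k + 1)) has_real_derivative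
      (gauss y * (- (2 * y)) * y ^ (2 * k + 1) - gauss y * ((2 * real k + 1) * q)) / (y ^ (2 * k + 1) * y ^ (2 * k + 1))) (at y)"
    using q by (intro DERIV_divide) auto
  also have "y ^ (2 * k + 1) = y * q" by (simp add: q_def)
  also have "(gauss y * (- (2 * y)) * (y * q) - gauss y * ((2 * real k + 1) * q)) / ((y * q) * (y * q))
      = - gauss y * (2 / q + (2 * real k + 1) / (y * y * q))"
    using q by (simp add: divide_simps) (simp add: algebra_simps)
  also have "y * y * q = y ^ (2 * k + 2)" by (simp add: q_def power_add power2_eq_square)
  finally show ?thesis by (simp add: q_def)
qed

text \<open>By the recursion for \<open>erfc_cf\<close>, the second part of each differentiated term
  cancels the first part of the next, so only the two ends survive. The term with
  \<open>erfc_cf 0\<close> is, after division by \<pi>, the derivative of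
  \<open>erfc\<close>.\<close>

lemma erfc_partial_DERIV:
  assumes "y > 0"
  shows "((\<lambda>y. \<Sum>k<N. erfc_cf k * (gauss y / y ^ (2 * k + 1))) has_real_derivative
    2 * gauss y * (erfc_cf N / y ^ (2 * N) - erfc_cf 0)) (at y)"
proof -
  have tel: "erfc_cf k * (- gauss y * (2 / y ^ (2 * k) + (2 * real k + 1) / y ^ (2 * k + 2)))
     = 2 * gauss y * (erfc_cf (Suc k) / y ^ (2 * Suc k) - erfc_cf k / y ^ (2 * k))" for k
  proof -
    have gen: "e * (- g * (2 / B + m / A)) = 2 * g * (S / A - e / B)" if "2 * S = - m * e" for e g A B m S :: real
    proof -
      have "2 * g * (S / A - e / B) = g * ((2 * S) * inverse A - 2 * e * inverse B)"
        by (simp add: divide_inverse right_diff_distrib)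
      also have "\<dots> = e * (- g * (2 / B + m / A))"
        unfolding that by (simp add: divide_inverse algebra_simps)
      finally show ?thesis by simp
    qed
    show ?thesis using gen[OF erfc_cf_Suc[of k]] by simp
  qed
  have "((\<lambda>y. \<Sum>k<N. erfc_cf k * (gauss y / y ^ (2 * k + 1))) has_real_derivative
    (\<Sum>k<N. erfc_cf k * (- gauss y * (2 / y ^ (2 * k) + (2 * real k + 1) / y ^ (2 * k + 2))))) (at y)"
    by (intro DERIV_sum DERIV_cmult gauss_over_power_DERIV assms)
  also have "(\<Sum>k<N. erfc_cf k * (- gauss y * (2 / y ^ (2 * k) + (2 * real k + 1) / y ^ (2 * k + 2))))
      = 2 * gauss y * (\<Sum>k<N. erfc_cf (Suc k) / y ^ (2 * Suc k) - erfc_cf k / y ^ (2 * k))"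
    unfolding tel sum_distrib_left ..
  also have "\<dots> = 2 * gauss y * (erfc_cf N / y ^ (2 * N) - erfc_cf 0)"
    by (subst sum_lessThan_telescope) simp
  finally show ?thesis .
qed

lemma gauss_over_power_tendsto_0: "((\<lambda>y. gauss y / y ^ (2 * k + 1)) \<longlongrightarrow> 0) at_top"
proof (rule Lim_null_comparison)
  show "((\<lambda>y::real. inverse y) \<longlongrightarrow> 0) at_top" by (rule tendsto_inverse_0_at_top[OF filterlim_ident])
  show "\<forall>\<^sub>F y in at_top. norm (gauss y / y ^ (2 * k + 1)) \<le> inverse y"
    using eventually_ge_at_top[of 1]
  proof eventually_elim
    case (elim y)
    have "y ^ 1 \<le> y ^ (2 * k + 1)" using elim by (intro power_increasing) auto
    hence "gauss y / y ^ (2 * k + 1) \<le> 1 / y ^ 1" using elim by (intro frac_le) auto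
    thus ?case using elim by (simp add: inverse_eq_divide)
  qed
qed

text \<open>The remainder \<open>R\<close> and the bound \<open>B\<close>, the modulus of the first
  omitted term, both vanish at infinity and satisfy \<open>|R'| <= - B'\<close>. Hence
  \<open>B + R\<close> and \<open>B - R\<close> decrease to zero and are nonnegative.\<close>

lemma erfc_expansion_bound:
  assumes "y > 0"
  shows "\<bar>erfc y - (\<Sum>k<N. erfc_cf k * (gauss y / y ^ (2 * k + 1))) / pi\<bar> \<le> \<bar>erfc_cf N\<bar> / pi * (gauss y / y ^ (2 * N + 1))"
proof -
  define R where "R = (\<lambda>y. erfc y - (\<Sum>k<N. erfc_cf k * (gauss y / y ^ (2 * k + 1))) / pi)"
  define B where "B = (\<lambda>y. \<bar>erfc_cf N\<bar> / pi * (gauss y / y ^ (2 * N + 1)))"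
  define B' where "B' = (\<lambda>y. \<bar>erfc_cf N\<bar> / pi * (- gauss y * (2 / y ^ (2 * N) + (2 * real N + 1) / y ^ (2 * N + 2))))"
  define R' where "R' = (\<lambda>y. - 2 * (erfc_cf N / pi) * (gauss y / y ^ (2 * N)))"
  have e0: "erfc_cf 0 / pi = 1 / sqrt pi"
    by (simp add: erfc_cf_def Gamma_one_half_real field_simps)
  have R: "(R has_real_derivative R' y) (at y)" if "y > 0" for y
  proof -
    have "(R has_real_derivative (- 2 / sqrt pi * gauss y) - 2 * gauss y * (erfc_cf N / y ^ (2 * N) - erfc_cf 0) / pi) (at y)"
      unfolding R_def by (intro DERIV_diff DERIV_cdivide erfc_DERIV erfc_partial_DERIV that)
    also have "(- 2 / sqrt pi * gauss y) - 2 * gauss y * (erfc_cf N / y ^ (2 * N) - erfc_cf 0) / pi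
       = - 2 * (erfc_cf N / pi) * (gauss y / y ^ (2 * N)) + 2 * gauss y * (erfc_cf 0 / pi - 1 / sqrt pi)"
      by (simp add: algebra_simps diff_divide_distrib)
    also have "\<dots> = R' y" unfolding e0 by (simp add: R'_def)
    finally show ?thesis .
  qed
  have B: "(B has_real_derivative B' y) (at y)" if "y > 0" for y
    unfolding B_def B'_def by (intro DERIV_cmult gauss_over_power_DERIV that)
  have le: "\<bar>R' y\<bar> \<le> - B' y" if "y > 0" for y
  proof -
    have "\<bar>R' y\<bar> = \<bar>erfc_cf N\<bar> / pi * (gauss y * (2 / y ^ (2 * N)))"
      using that by (simp add: R'_def abs_mult)
    also have "\<dots> \<le> \<bar>erfc_cf N\<bar> / pi * (gauss y * (2 / y ^ (2 * N) + (2 * real N + 1) / y ^ (2 * N + 2)))"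
      using that by (intro mult_left_mono) auto
    also have "\<dots> = - B' y" by (simp add: B'_def)
    finally show ?thesis .
  qed
  have "(R \<longlongrightarrow> 0 - (\<Sum>k<N. erfc_cf k * 0) / pi) at_top"
    unfolding R_def by (intro tendsto_diff tendsto_divide tendsto_sum tendsto_mult tendsto_const erfc_tendsto_0 gauss_over_power_tendsto_0) auto
  hence R0: "(R \<longlongrightarrow> 0) at_top" by simp
  have "(B \<longlongrightarrow> \<bar>erfc_cf N\<bar> / pi * 0) at_top"
    unfolding B_def by (rule tendsto_mult[OF tendsto_const gauss_over_power_tendsto_0])
  hence B0: "(B \<longlongrightarrow> 0) at_top" by simp
  have "B y + R y \<ge> 0"
  proof (rule nonneg_of_antimono_tendsto_0[where f="\<lambda>y. B y + R y" and f'="\<lambda>y. B' y + R' y"])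
    show "((\<lambda>y. B y + R y) \<longlongrightarrow> 0) at_top" using tendsto_add[OF B0 R0] by simp
    show "B' y + R' y \<le> 0" if "y > 0" for y using le[OF that] by linarith
  qed (auto intro: DERIV_add R B assms)
  moreover have "B y - R y \<ge> 0"
  proof (rule nonneg_of_antimono_tendsto_0[where f="\<lambda>y. B y - R y" and f'="\<lambda>y. B' y - R' y"])
    show "((\<lambda>y. B y - R y) \<longlongrightarrow> 0) at_top" using tendsto_diff[OF B0 R0] by simp
    show "B' y - R' y \<le> 0" if "y > 0" for y using le[OF that] by linarith
  qed (auto intro: DERIV_diff R B assms)
  ultimately show ?thesis unfolding R_def B_def by linarith
qed

section \<open>Watson's lemma\<close>

definition gmom :: "real \<Rightarrow> nat \<Rightarrow> real \<Rightarrow> real" where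
  "gmom r j L = integral {-r..r} (\<lambda>u. u ^ j * exp (- L * u\<^sup>2))"

lemma gmom_integrable: "(\<lambda>u. u ^ j * exp (- L * u\<^sup>2)) integrable_on {-r..r::real}"
  by (intro integrable_continuous_interval continuous_intros)

lemma gmom_odd: "gmom r (2 * k + 1) L = 0"
proof -
  have "gmom r (2 * k + 1) L = integral {-r..r} (\<lambda>u. (-u) ^ (2 * k + 1) * exp (- L * (-u)\<^sup>2))"
    unfolding gmom_def using Henstock_Kurzweil_Integration.integral_reflect_real[of r "-r" "\<lambda>u. u ^ (2 * k + 1) * exp (- L * u\<^sup>2)"] by simp
  also have "\<dots> = integral {-r..r} (\<lambda>u. - (u ^ (2 * k + 1) * exp (- L * u\<^sup>2)))"
    by (intro Henstock_Kurzweil_Integration.integral_cong) simp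
  also have "\<dots> = - gmom r (2 * k + 1) L" by (simp add: gmom_def)
  finally show ?thesis by simp
qed

text \<open>Integrates the derivative of \<open>u ^ (2 * k + 1) * exp (- L * u^2)\<close>. The
  boundary values are what distinguishes truncated moments from those over the whole line.\<close>

lemma gmom_recurrence:
  assumes "r > 0" "L > 0"
  shows "gmom r (2 * Suc k) L = (real k + 1/2) / L * gmom r (2 * k) L - r ^ (2 * k + 1) * exp (- L * r\<^sup>2) / L"
proof -
  define F where "F = (\<lambda>u::real. u ^ (2 * k + 1) * exp (- L * u\<^sup>2))"
  have "((\<lambda>u. (2 * real k + 1) * (u ^ (2 * k) * exp (- L * u\<^sup>2)) - 2 * L * (u ^ (2 * Suc k) * exp (- L * u\<^sup>2))) has_integral F r - F (-r)) {-r..r}"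
  proof (rule fundamental_theorem_of_calculus)
    fix u :: real
    have "(F has_real_derivative (real (2 * k + 1) * u ^ (2 * k)) * exp (- L * u\<^sup>2) + (exp (- L * u\<^sup>2) * (- L * (2 * u))) * u ^ (2 * k + 1)) (at u within {-r..r})"
      unfolding F_def
    proof (rule DERIV_mult)
      show "((\<lambda>u. u ^ (2 * k + 1)) has_real_derivative real (2 * k + 1) * u ^ (2 * k)) (at u within {-r..r})"
        using DERIV_pow[of "2 * k + 1" u] by simp
      show "((\<lambda>u. exp (- L * u\<^sup>2)) has_real_derivative exp (- L * u\<^sup>2) * (- L * (2 * u))) (at u within {-r..r})"
        by (auto intro!: derivative_eq_intros)
    qed
    thus "(F has_vector_derivative (2 * real k + 1) * (u ^ (2 * k) * exp (- L * u\<^sup>2)) - 2 * L * (u ^ (2 * Suc k) * exp (- L * u\<^sup>2))) (at u within {-r..r})"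
      unfolding has_real_derivative_iff_has_vector_derivative[symmetric] by (simp add: algebra_simps)
  qed (use assms in simp)
  hence "integral {-r..r} (\<lambda>u. (2 * real k + 1) * (u ^ (2 * k) * exp (- L * u\<^sup>2)) - 2 * L * (u ^ (2 * Suc k) * exp (- L * u\<^sup>2))) = F r - F (-r)"
    by (rule integral_unique)
  also have "F (-r) = - F r" by (simp add: F_def)
  also have "integral {-r..r} (\<lambda>u. (2 * real k + 1) * (u ^ (2 * k) * exp (- L * u\<^sup>2)) - 2 * L * (u ^ (2 * Suc k) * exp (- L * u\<^sup>2)))
     = (2 * real k + 1) * gmom r (2 * k) L - 2 * L * gmom r (2 * Suc k) L"
    unfolding gmom_def
    by (subst Henstock_Kurzweil_Integration.integral_diff)
       (intro integrable_on_mult_right gmom_integrable | simp only: Henstock_Kurzweil_Integration.integral_mult_right)+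
  finally have "(2 * real k + 1) * gmom r (2 * k) L - 2 * L * gmom r (2 * Suc k) L = 2 * F r" by simp
  hence "gmom r (2 * Suc k) L = ((2 * real k + 1) * gmom r (2 * k) L - 2 * F r) / (2 * L)"
    using assms by (simp add: field_simps)
  also have "\<dots> = (real k + 1/2) / L * gmom r (2 * k) L - F r / L"
    using assms by (simp add: diff_divide_distrib add_divide_distrib ring_distribs)
  finally show ?thesis by (simp add: F_def)
qed

lemma LINT_gauss_scaled:
  assumes "L > 0"
  shows "integrable lborel (\<lambda>u. exp (- L * u\<^sup>2))" "(LINT u|lborel. exp (- L * u\<^sup>2)) = sqrt pi / sqrt L"
proof -
  have e: "exp (- (0 + sqrt L * u)\<^sup>2) = exp (- L * u\<^sup>2)" for u
    using assms by (simp add: power_mult_distrib)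
  show "integrable lborel (\<lambda>u. exp (- L * u\<^sup>2))"
    using lborel_integrable_real_affine[OF integrable_gauss, of "sqrt L" 0] assms unfolding e by simp
  have "sqrt pi = sqrt L * (LINT u|lborel. exp (- L * u\<^sup>2))"
    using lborel_integral_real_affine[of "sqrt L" gauss 0] assms unfolding e by (simp add: LINT_gauss)
  thus "(LINT u|lborel. exp (- L * u\<^sup>2)) = sqrt pi / sqrt L" using assms by (simp add: field_simps)
qed

text \<open>Outside \<open>{-r..r}\<close> one has \<open>L * u^2 >= (L - 1) * r^2 + u^2\<close>.
  Reserving one Gaussian keeps the tail integrable uniformly in \<open>L\<close> and is the source
  of the factor \<open>exp (r^2)\<close>.\<close>

lemma gmom_0_bound:
  assumes "r > 0" "L \<ge> 1"
  shows "\<bar>gmom r 0 L - sqrt pi / sqrt L\<bar> \<le> sqrt pi * exp (r\<^sup>2) * exp (- L * r\<^sup>2)"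
proof -
  have L: "L > 0" using assms by simp
  note i = LINT_gauss_scaled[OF L]
  have si: "set_integrable lborel {-r..r} (\<lambda>u. exp (- L * u\<^sup>2))"
    unfolding set_integrable_def by (rule integrable_mult_indicator) (use i in auto)
  have "gmom r 0 L = (LINT u|lborel. indicator {-r..r} u * exp (- L * u\<^sup>2))"
    using set_borel_integral_eq_integral(2)[OF si] by (simp add: gmom_def set_lebesgue_integral_def)
  moreover have "(LINT u|lborel. exp (- L * u\<^sup>2) - indicator {-r..r} u * exp (- L * u\<^sup>2))
      = (LINT u|lborel. exp (- L * u\<^sup>2)) - (LINT u|lborel. indicator {-r..r} u * exp (- L * u\<^sup>2))"
    using si by (intro Bochner_Integration.integral_diff i(1)) (simp add: set_integrable_def)
  ultimately have eq: "sqrt pi / sqrt L - gmom r 0 L = (LINT u|lborel. exp (- L * u\<^sup>2) - indicator {-r..r} u * exp (- L * u\<^sup>2))"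
    using i(2) by simp
  have "norm (sqrt pi / sqrt L - gmom r 0 L) \<le> (LINT u|lborel. norm (exp (- L * u\<^sup>2) - indicator {-r..r} u * exp (- L * u\<^sup>2)))"
    unfolding eq by (rule integral_norm_bound)
  also have "\<dots> \<le> (LINT u|lborel. exp (r\<^sup>2) * exp (- L * r\<^sup>2) * gauss u)"
  proof (rule integral_mono)
    show "integrable lborel (\<lambda>u. norm (exp (- L * u\<^sup>2) - indicator {-r..r} u * exp (- L * u\<^sup>2)))"
      using si by (intro integrable_norm Bochner_Integration.integrable_diff i(1)) (simp add: set_integrable_def)
    show "integrable lborel (\<lambda>u. exp (r\<^sup>2) * exp (- L * r\<^sup>2) * gauss u)" using integrable_gauss by simp
    fix u :: real
    show "norm (exp (- L * u\<^sup>2) - indicator {-r..r} u * exp (- L * u\<^sup>2)) \<le> exp (r\<^sup>2) * exp (- L * r\<^sup>2) * gauss u"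
    proof (cases "u \<in> {-r..r}")
      case False
      hence "r\<^sup>2 \<le> u\<^sup>2" using assms by (auto simp: abs_le_square_iff[symmetric])
      hence "(L - 1) * r\<^sup>2 \<le> (L - 1) * u\<^sup>2" using assms by (intro mult_left_mono) auto
      hence "- L * u\<^sup>2 \<le> r\<^sup>2 + - L * r\<^sup>2 + - u\<^sup>2" by (simp add: algebra_simps)
      hence "exp (- L * u\<^sup>2) \<le> exp (r\<^sup>2 + - L * r\<^sup>2 + - u\<^sup>2)" by (simp only: exp_le_cancel_iff)
      thus ?thesis using False by (simp add: exp_add[symmetric])
    qed simp
  qed
  also have "\<dots> = sqrt pi * exp (r\<^sup>2) * exp (- L * r\<^sup>2)" by (simp add: LINT_gauss)
  finally show ?thesis by (simp add: abs_minus_commute)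
qed

text \<open>The moment of order \<open>2 * k\<close> of \<open>exp (- L * u^2)\<close> over the
  whole real line.\<close>

definition gterm :: "nat \<Rightarrow> real \<Rightarrow> real" where
  "gterm k L = Gamma (real k + 1/2) / L powr (real k + 1/2)"

lemma gterm_Suc:
  assumes "L > 0" shows "gterm (Suc k) L = (real k + 1/2) / L * gterm k L"
proof -
  have "real k + 1/2 \<notin> \<int>\<^sub>\<le>\<^sub>0" by (auto elim!: nonpos_Ints_cases)
  hence "Gamma (real (Suc k) + 1/2) = (real k + 1/2) * Gamma (real k + 1/2)"
    using Gamma_plus1[of "real k + 1/2"] by (simp add: add_ac)
  moreover have "L powr (real (Suc k) + 1/2) = L * L powr (real k + 1/2)"
    using assms powr_add[of L 1 "real k + 1/2"] by (simp add: add_ac)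
  ultimately show ?thesis by (simp add: gterm_def)
qed

text \<open>Truncated and full moments obey the same recursion up to the boundary term, so an
  exponentially small difference is passed on from \<open>k\<close> to \<open>k + 1\<close>.\<close>

lemma gmom_even_asymp:
  assumes r: "r > 0"
  shows "(\<lambda>L. gmom r (2 * k) L - gterm k L) \<in> O[at_top](\<lambda>L. exp (- L * r\<^sup>2))"
proof (induction k)
  case 0
  show ?case
  proof (rule bigoI)
    show "\<forall>\<^sub>F L in at_top. norm (gmom r (2 * 0) L - gterm 0 L) \<le> sqrt pi * exp (r\<^sup>2) * norm (exp (- L * r\<^sup>2))"
      using eventually_ge_at_top[of 1]
    proof eventually_elim
      case (elim L)
      have "gterm 0 L = sqrt pi / sqrt L" using elim by (simp add: gterm_def Gamma_one_half_real powr_half_sqrt)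
      thus ?case using gmom_0_bound[OF r elim] by simp
    qed
  qed
next
  case (Suc k)
  have inv: "(\<lambda>L::real. (real k + 1/2) / L) \<in> O[at_top](\<lambda>_. 1)" "(\<lambda>L::real. - (r ^ (2 * k + 1)) / L) \<in> O[at_top](\<lambda>_. 1)"
    by real_asymp+
  have "(\<lambda>L. (real k + 1/2) / L * (gmom r (2 * k) L - gterm k L)) \<in> O[at_top](\<lambda>L. 1 * exp (- L * r\<^sup>2))"
    by (rule landau_o.big.mult[OF inv(1) Suc])
  moreover have "(\<lambda>L. - (r ^ (2 * k + 1)) / L * exp (- L * r\<^sup>2)) \<in> O[at_top](\<lambda>L. 1 * exp (- L * r\<^sup>2))"
    by (rule landau_o.big.mult[OF inv(2) landau_o.big_refl])
  ultimately have H: "(\<lambda>L. (real k + 1/2) / L * (gmom r (2 * k) L - gterm k L) + - (r ^ (2 * k + 1)) / L * exp (- L * r\<^sup>2)) \<in> O[at_top](\<lambda>L. exp (- L * r\<^sup>2))"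
    by (intro sum_in_bigo) simp_all
  have E: "\<forall>\<^sub>F L in at_top. (real k + 1/2) / L * (gmom r (2 * k) L - gterm k L) + - (r ^ (2 * k + 1)) / L * exp (- L * r\<^sup>2) = gmom r (2 * Suc k) L - gterm (Suc k) L"
    using eventually_gt_at_top[of 0]
  proof eventually_elim
    case (elim L)
    show ?case unfolding gmom_recurrence[OF r elim] gterm_Suc[OF elim] by (simp add: right_diff_distrib)
  qed
  show ?case by (rule iffD1[OF landau_o.big.in_cong[OF E] H])
qed

definition tcoeff :: "(complex \<Rightarrow> complex) \<Rightarrow> nat \<Rightarrow> complex" where
  "tcoeff f j = (deriv ^^ j) f 0 / fact j"

lemma sum_even_odd: "(\<Sum>j\<le>2 * N. f j) = (\<Sum>k\<le>N. f (2 * k)) + (\<Sum>k<N. f (2 * k + 1))"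
  for f :: "nat \<Rightarrow> 'a :: ab_group_add"
  by (induction N) (simp_all add: algebra_simps)

lemma Taylor_remainder_bound:
  assumes "f holomorphic_on ball 0 R" "0 < r" "r < R"
  obtains B where "B \<ge> 0" "\<And>w. norm w \<le> r \<Longrightarrow> norm (f w - (\<Sum>j\<le>n. tcoeff f j * w ^ j)) \<le> B * norm w ^ Suc n"
proof -
  have "continuous_on (cball 0 r) ((deriv ^^ Suc n) f)"
  proof (rule continuous_on_subset)
    show "continuous_on (ball 0 R) ((deriv ^^ Suc n) f)"
      using assms by (intro holomorphic_on_imp_continuous_on holomorphic_higher_deriv) auto
  qed (use assms in auto)
  hence "bounded ((deriv ^^ Suc n) f ` cball 0 r)"
    by (intro compact_imp_bounded compact_continuous_image) auto
  then obtain B where B: "B > 0" "\<And>w. w \<in> cball 0 r \<Longrightarrow> norm ((deriv ^^ Suc n) f w) \<le> B"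
    by (auto simp: bounded_pos)
  have "norm (f w - (\<Sum>j\<le>n. tcoeff f j * w ^ j)) \<le> B / fact n * norm w ^ Suc n" if w: "norm w \<le> r" for w
  proof -
    have "norm ((deriv ^^ 0) f w - (\<Sum>j\<le>n. (deriv ^^ j) f 0 * (w - 0) ^ j / fact j)) \<le> B * norm (w - 0) ^ Suc n / fact n"
    proof (rule complex_Taylor[where S="cball 0 r"])
      fix i and z :: complex assume z: "z \<in> cball 0 r" "i \<le> n"
      hence "z \<in> ball 0 R" using assms by auto
      hence "((deriv ^^ i) f has_field_derivative deriv ((deriv ^^ i) f) z) (at z)"
        using assms by (intro holomorphic_derivI[where S="ball 0 R"] holomorphic_higher_deriv) auto
      thus "((deriv ^^ i) f has_field_derivative (deriv ^^ Suc i) f z) (at z within cball 0 r)"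
        by (simp add: has_field_derivative_at_within)
    qed (use B w assms in auto)
    thus ?thesis by (simp add: tcoeff_def)
  qed
  thus ?thesis using B(1) by (intro that[of "B / fact n"]) auto
qed

lemma exp_bigo_powr:
  fixes \<eta> b :: real
  assumes "\<eta> > 0" shows "(\<lambda>L. exp (- L * \<eta>)) \<in> O[at_top](\<lambda>L. L powr b)"
  using assms by real_asymp

lemma gterm_bigo: "(\<lambda>L. gterm k L) \<in> O[at_top](\<lambda>L. L powr (- real k - 1/2))"
proof (rule bigoI)
  show "\<forall>\<^sub>F L in at_top. norm (gterm k L) \<le> \<bar>Gamma (real k + 1/2)\<bar> * norm (L powr (- real k - 1/2))"
    using eventually_gt_at_top[of 0]
  proof eventually_elim
    case (elim L)
    have e: "- real k - 1/2 = - (real k + 1/2)" by simp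
    show ?case unfolding e powr_minus gterm_def
      by (simp only: divide_inverse real_norm_def abs_mult order.refl)
  qed
qed

lemma gmom_even_bigo:
  assumes "r > 0" shows "(\<lambda>L. gmom r (2 * k) L) \<in> O[at_top](\<lambda>L. L powr (- real k - 1/2))"
proof -
  have "(\<lambda>L. exp (- L * r\<^sup>2)) \<in> O[at_top](\<lambda>L. L powr (- real k - 1/2))"
    using assms by (intro exp_bigo_powr) auto
  from sum_in_bigo(1)[OF landau_o.big_trans[OF gmom_even_asymp[OF assms, of k] this] gterm_bigo[of k]]
  show ?thesis by simp
qed

lemma bigo_of_real:
  assumes "f \<in> O[F](g)"
  shows "(\<lambda>x. complex_of_real (f x)) \<in> O[F](\<lambda>x. complex_of_real (g x))"
  using assms by (simp add: bigo_def)

lemma bigo_cmult: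
  fixes c :: "'a :: real_normed_field"
  assumes "f \<in> O[F](g)" shows "(\<lambda>x. c * f x) \<in> O[F](g)"
  using assms by (cases "c = 0") auto

theorem Watson_symmetric:
  fixes K :: "complex \<Rightarrow> complex"
  assumes K: "K holomorphic_on ball 0 R" and r: "0 < r" "r < R"
  shows "(\<lambda>L. integral {-r..r} (\<lambda>u. of_real (exp (- L * u\<^sup>2)) * K (of_real u)) -
      (\<Sum>k<N. tcoeff K (2 * k) * of_real (gterm k L))) \<in> O[at_top](\<lambda>L. of_real (L powr (- real N - 1/2)))"
proof -
  obtain B where B: "B \<ge> 0" "\<And>w. norm w \<le> r \<Longrightarrow> norm (K w - (\<Sum>j\<le>2*N. tcoeff K j * w ^ j)) \<le> B * norm w ^ Suc (2*N)"
    using Taylor_remainder_bound[OF K r] by blast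
  have Kc: "continuous_on {-r..r} (\<lambda>u. K (of_real u))"
  proof (rule continuous_on_compose2[OF holomorphic_on_imp_continuous_on[OF K]])
    show "of_real ` {-r..r} \<subseteq> ball (0::complex) R" using r by auto
  qed (intro continuous_intros)
  define S where "S = (\<lambda>u::real. \<Sum>j\<le>2*N. tcoeff K j * of_real u ^ j)"
  define rest where "rest = (\<lambda>L. integral {-r..r} (\<lambda>u. of_real (exp (- L * u\<^sup>2)) * (K (of_real u) - S u)))"
  have mom: "((\<lambda>u. of_real (exp (- L * u\<^sup>2)) * S u) has_integral (\<Sum>k\<le>N. tcoeff K (2 * k) * of_real (gmom r (2 * k) L))) {-r..r}" for L
  proof -
    have "((\<lambda>u. \<Sum>j\<le>2*N. tcoeff K j * of_real (u ^ j * exp (- L * u\<^sup>2))) has_integral (\<Sum>j\<le>2*N. tcoeff K j * of_real (gmom r j L))) {-r..r}"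
      unfolding gmom_def
      by (intro has_integral_sum has_integral_mult_right has_integral_of_real integrable_integral gmom_integrable) auto
    also have "(\<Sum>j\<le>2*N. tcoeff K j * of_real (gmom r j L)) = (\<Sum>k\<le>N. tcoeff K (2 * k) * of_real (gmom r (2 * k) L))"
      unfolding sum_even_odd gmom_odd by simp
    finally show ?thesis by (simp add: S_def sum_distrib_left mult_ac)
  qed
  have Sc: "continuous_on {-r..r} S" unfolding S_def by (intro continuous_intros)
  have ri: "(\<lambda>u. of_real (exp (- L * u\<^sup>2)) * (K (of_real u) - S u)) integrable_on {-r..r}" for L
    by (intro integrable_continuous_interval continuous_intros Kc Sc)
  have split: "integral {-r..r} (\<lambda>u. of_real (exp (- L * u\<^sup>2)) * K (of_real u)) - (\<Sum>k<N. tcoeff K (2 * k) * of_real (gterm k L))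
     = (\<Sum>k<N. tcoeff K (2 * k) * of_real (gmom r (2 * k) L - gterm k L)) + (tcoeff K (2 * N) * of_real (gmom r (2 * N) L) + rest L)" for L
  proof -
    have "((\<lambda>u. of_real (exp (- L * u\<^sup>2)) * S u + of_real (exp (- L * u\<^sup>2)) * (K (of_real u) - S u)) has_integral
       (\<Sum>k\<le>N. tcoeff K (2 * k) * of_real (gmom r (2 * k) L)) + rest L) {-r..r}"
      unfolding rest_def by (intro has_integral_add mom integrable_integral ri)
    hence "integral {-r..r} (\<lambda>u. of_real (exp (- L * u\<^sup>2)) * K (of_real u)) = (\<Sum>k\<le>N. tcoeff K (2 * k) * of_real (gmom r (2 * k) L)) + rest L"
      by (intro integral_unique) (simp add: ring_distribs)
    thus ?thesis
      by (simp add: lessThan_Suc_atMost[symmetric] right_diff_distrib sum_subtractf)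
  qed
  have rest: "rest \<in> O[at_top](\<lambda>L. of_real (L powr (- real N - 1/2)))"
  proof -
    have "norm (rest L) \<le> (B * r) * gmom r (2 * N) L" for L
    proof -
      have "norm (rest L) \<le> integral {-r..r} (\<lambda>u. (B * r) * (u ^ (2 * N) * exp (- L * u\<^sup>2)))"
        unfolding rest_def
      proof (rule Henstock_Kurzweil_Integration.integral_norm_bound_integral[OF ri])
        show "(\<lambda>u. (B * r) * (u ^ (2 * N) * exp (- L * u\<^sup>2))) integrable_on {-r..r}"
          by (intro integrable_continuous_interval continuous_intros)
        fix u assume u: "u \<in> {-r..r}"
        \<comment> \<open>One factor \<open>|u|\<close> of the remainder is given up for
          \<open>r\<close>, leaving an even moment; the moment of order \<open>2 * N\<close> is
          already as small as claimed.\<close>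
        have "norm (K (of_real u) - S u) \<le> B * \<bar>u\<bar> ^ Suc (2 * N)"
          using B(2)[of "of_real u"] u unfolding S_def by (auto simp: abs_le_iff)
        also have "\<dots> = B * \<bar>u\<bar> * u ^ (2 * N)" by (simp add: power_even_abs)
        also have "\<dots> \<le> B * r * u ^ (2 * N)"
          using B(1) u by (intro mult_right_mono mult_left_mono) auto
        finally show "norm (of_real (exp (- L * u\<^sup>2)) * (K (of_real u) - S u)) \<le> (B * r) * (u ^ (2 * N) * exp (- L * u\<^sup>2))"
          unfolding norm_mult by (simp add: mult_ac mult_right_mono)
      qed
      thus ?thesis by (simp add: gmom_def)
    qed
    hence "rest \<in> O[at_top](\<lambda>L. complex_of_real (gmom r (2 * N) L))"
      using B r by (intro bigoI[of _ "B * r"] always_eventually allI) (auto intro: order_trans[OF _ mult_left_mono[OF abs_ge_self]])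
    from landau_o.big_trans[OF this bigo_of_real[OF gmom_even_bigo[OF r(1)]]] show ?thesis .
  qed
  have "(\<lambda>L. of_real (gmom r (2 * k) L - gterm k L)) \<in> O[at_top](\<lambda>L. complex_of_real (L powr (- real N - 1/2)))" for k
    by (rule bigo_of_real, rule landau_o.big_trans[OF gmom_even_asymp exp_bigo_powr]) (use r in auto)
  moreover have "(\<lambda>L. of_real (gmom r (2 * N) L)) \<in> O[at_top](\<lambda>L. complex_of_real (L powr (- real N - 1/2)))"
    by (rule bigo_of_real[OF gmom_even_bigo[OF r(1)]])
  ultimately show ?thesis
    unfolding split by (intro sum_in_bigo(1) big_sum_in_bigo bigo_cmult rest)
qed

section \<open>The saddle point\<close>

lemma halfplane_nonpos_Reals:
  assumes "Re z > 1" shows "z \<notin> \<real>\<^sub>\<le>\<^sub>0" "z - 1 \<notin> \<real>\<^sub>\<le>\<^sub>0" "z \<noteq> 0" "z - 1 \<noteq> 0"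
  using assms by (auto simp: complex_nonpos_Reals_iff)

lemma psi_DERIV_complex:
  fixes z :: complex
  assumes "Re z > 1"
  shows "(psi \<epsilon> has_field_derivative (of_real \<epsilon> - z) / (z * (z - 1))) (at z)"
proof -
  have "((\<lambda>t. of_real (\<epsilon> - 1) * Ln (t - 1) - of_real \<epsilon> * Ln t) has_field_derivative
      of_real (\<epsilon> - 1) * (inverse (z - 1)) - of_real \<epsilon> * inverse z) (at z)"
    using halfplane_nonpos_Reals[OF assms]
    by (intro DERIV_diff DERIV_cmult DERIV_chain'[where g=Ln and f="\<lambda>t. t - 1", THEN DERIV_cong])
       (auto intro!: derivative_eq_intros)
  moreover have "of_real (\<epsilon> - 1) * (inverse (z - 1)) - of_real \<epsilon> * inverse z = (of_real \<epsilon> - z) / (z * (z - 1))"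
    using halfplane_nonpos_Reals[OF assms] by (simp add: divide_simps) (simp add: algebra_simps)
  ultimately show ?thesis by (simp add: psi_def[abs_def])
qed

lemma psi_DERIV_real:
  fixes t :: real
  assumes "t > 1"
  shows "(psi \<epsilon> has_real_derivative (\<epsilon> - t) / (t * (t - 1))) (at t)"
proof -
  have "((\<lambda>t. (\<epsilon> - 1) * ln (t - 1) - \<epsilon> * ln t) has_real_derivative (\<epsilon> - 1) * (1 / (t - 1)) - \<epsilon> * (1 / t)) (at t)"
    using assms by (auto intro!: derivative_eq_intros)
  moreover have "(\<epsilon> - 1) * (1 / (t - 1)) - \<epsilon> * (1 / t) = (\<epsilon> - t) / (t * (t - 1))"
    using assms by (simp add: divide_simps) (simp add: algebra_simps)
  ultimately show ?thesis by (simp add: psi_def[abs_def])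
qed

lemma kappa_eq:
  assumes "\<epsilon> > 1"
  shows "kappa \<epsilon> = sqrt (1 / (2 * \<epsilon> * (\<epsilon> - 1)))"
proof -
  have "\<forall>\<^sub>F t in nhds \<epsilon>. t \<in> {1<..}" using assms by (intro eventually_nhds_in_open) auto
  hence ev: "\<forall>\<^sub>F t in nhds \<epsilon>. deriv (psi \<epsilon>) t = (\<epsilon> - t) / (t * (t - 1))"
    by eventually_elim (auto intro!: DERIV_imp_deriv psi_DERIV_real)
  have "((\<lambda>t. (\<epsilon> - t) / (t * (t - 1))) has_real_derivative (- (\<epsilon> * (\<epsilon> - 1))) / ((\<epsilon> * (\<epsilon> - 1)) * (\<epsilon> * (\<epsilon> - 1)))) (at \<epsilon>)"
    using assms by (auto intro!: derivative_eq_intros)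
  hence "(deriv (psi \<epsilon>) has_real_derivative (- (\<epsilon> * (\<epsilon> - 1))) / ((\<epsilon> * (\<epsilon> - 1)) * (\<epsilon> * (\<epsilon> - 1)))) (at \<epsilon>)"
    by (subst DERIV_cong_ev[OF refl ev refl])
  hence "deriv (deriv (psi \<epsilon>)) \<epsilon> = (- (\<epsilon> * (\<epsilon> - 1))) / ((\<epsilon> * (\<epsilon> - 1)) * (\<epsilon> * (\<epsilon> - 1)))"
    by (rule DERIV_imp_deriv)
  also have "\<dots> = - (1 / (\<epsilon> * (\<epsilon> - 1)))" by simp
  finally have "deriv (deriv (psi \<epsilon>)) \<epsilon> = - (1 / (\<epsilon> * (\<epsilon> - 1)))" .
  moreover have "\<bar>- (1 / (\<epsilon> * (\<epsilon> - 1)))\<bar> = 1 / (\<epsilon> * (\<epsilon> - 1))"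
    using assms by (subst abs_minus_cancel, intro abs_of_nonneg) auto
  ultimately show ?thesis by (simp add: kappa_def mult.assoc)
qed

lemma kappa_pos: "\<epsilon> > 1 \<Longrightarrow> kappa \<epsilon> > 0"
  by (simp add: kappa_eq)

lemma kappa_square: "\<epsilon> > 1 \<Longrightarrow> (kappa \<epsilon>)\<^sup>2 = 1 / (2 * \<epsilon> * (\<epsilon> - 1))"
  by (simp add: kappa_eq)

lemma ball_halfplane:
  assumes "z \<in> ball (of_real \<epsilon>) (\<epsilon> - 1)" shows "Re z > 1"
proof -
  have "\<bar>Re (of_real \<epsilon> - z)\<bar> < \<epsilon> - 1"
    using assms abs_Re_le_cmod[of "of_real \<epsilon> - z"] by (auto simp: dist_norm)
  thus ?thesis by (simp add: abs_less_iff)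
qed

text \<open>The double zero at \<epsilon> is removed by two difference quotients, each extended
  holomorphically over \<epsilon>. The value of \<open>q\<close> there, half the second derivative
  of \<open>psi\<close>, follows by continuity after the factorization is differentiated and one
  factor \<open>z - \<epsilon>\<close> cancelled.\<close>

lemma psi_factorization:
  assumes \<epsilon>: "\<epsilon> > 1"
  obtains q where "q holomorphic_on ball (of_real \<epsilon>) (\<epsilon> - 1)" "q (of_real \<epsilon>) = - of_real ((kappa \<epsilon>)\<^sup>2)"
    "\<And>z. z \<in> ball (of_real \<epsilon>) (\<epsilon> - 1) \<Longrightarrow> psi \<epsilon> z - psi \<epsilon> (of_real \<epsilon>) = (z - of_real \<epsilon>)\<^sup>2 * (q z :: complex)"
proof -
  define e where "e = complex_of_real \<epsilon>"
  define S where "S = ball e (\<epsilon> - 1)"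
  have S: "open S" "e \<in> S" using \<epsilon> by (auto simp: S_def)
  have half: "Re z > 1" if "z \<in> S" for z using that ball_halfplane by (auto simp: S_def e_def)
  define D where "D = (\<lambda>z::complex. psi \<epsilon> z - psi \<epsilon> e)"
  have dD: "(D has_field_derivative (e - z) / (z * (z - 1))) (at z)" if "z \<in> S" for z
    unfolding D_def e_def using DERIV_diff[OF psi_DERIV_complex[OF half[OF that]] DERIV_const] by simp
  have D: "D holomorphic_on S" using dD S by (auto simp: holomorphic_on_open)
  define q1 where "q1 = (\<lambda>z. if z = e then deriv D e else (D z - D e) / (z - e))"
  have q1: "q1 holomorphic_on S" unfolding q1_def by (rule pole_lemma_open[OF D S(1)])
  have q1e: "q1 e = 0" using DERIV_imp_deriv[OF dD[OF S(2)]] by (simp add: q1_def)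
  define q where "q = (\<lambda>z. if z = e then deriv q1 e else (q1 z - q1 e) / (z - e))"
  have q: "q holomorphic_on S" unfolding q_def by (rule pole_lemma_open[OF q1 S(1)])
  have fac: "D z = (z - e)\<^sup>2 * q z" for z
    using q1e by (auto simp: q_def q1_def D_def power2_eq_square)
  have key: "2 * q z + (z - e) * deriv q z = - 1 / (z * (z - 1))" if z: "z \<in> S" "z \<noteq> e" for z
  proof -
    have "(q has_field_derivative deriv q z) (at z)" using q S z by (intro holomorphic_derivI)
    hence "((\<lambda>z. (z - e)\<^sup>2 * q z) has_field_derivative (2 * (z - e)) * q z + deriv q z * (z - e)\<^sup>2) (at z)"
      by (auto intro!: derivative_eq_intros)
    moreover have "(\<lambda>z. (z - e)\<^sup>2 * q z) = D" using fac by (simp add: fun_eq_iff)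
    ultimately have "(D has_field_derivative (2 * (z - e)) * q z + deriv q z * (z - e)\<^sup>2) (at z)"
      by (rule back_subst[of "\<lambda>f. (f has_field_derivative (2 * (z - e)) * q z + deriv q z * (z - e)\<^sup>2) (at z)"])
    hence "2 * (z - e) * q z + deriv q z * (z - e)\<^sup>2 = (e - z) / (z * (z - 1))"
      by (rule DERIV_unique[OF _ dD[OF z(1)]])
    moreover have "2 * (z - e) * q z + deriv q z * (z - e)\<^sup>2 = (z - e) * (2 * q z + (z - e) * deriv q z)"
      by (simp add: algebra_simps power2_eq_square)
    moreover have "(e - z) / (z * (z - 1)) = (z - e) * (- 1 / (z * (z - 1)))"
      by (simp add: divide_inverse left_diff_distrib)
    ultimately have "(z - e) * (2 * q z + (z - e) * deriv q z) = (z - e) * (- 1 / (z * (z - 1)))" by simp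
    thus ?thesis using z(2) by (simp only: mult_cancel_left) auto
  qed
  have "q e = - of_real ((kappa \<epsilon>)\<^sup>2)"
  proof -
    have c: "isCont (\<lambda>z. 2 * q z + (z - e) * deriv q z) e" "isCont (\<lambda>z. - 1 / (z * (z - 1))) e"
    proof -
      have "isCont q e" "isCont (deriv q) e"
        using q S holomorphic_deriv[OF q S(1)]
        by (auto intro!: continuous_on_interior[OF holomorphic_on_imp_continuous_on] simp: interior_open)
      thus "isCont (\<lambda>z. 2 * q z + (z - e) * deriv q z) e" by (intro continuous_intros)
      have "e * (e - 1) \<noteq> 0" using halfplane_nonpos_Reals[OF half[OF S(2)]] by simp
      thus "isCont (\<lambda>z. - 1 / (z * (z - 1))) e" by (intro continuous_intros)
    qed
    have "\<forall>\<^sub>F z in at e. z \<in> S \<and> z \<noteq> e" using S by (simp add: eventually_at_in_open' eventually_conj eventually_neq_at_within)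
    hence "\<forall>\<^sub>F z in at e. - 1 / (z * (z - 1)) = 2 * q z + (z - e) * deriv q z"
      by eventually_elim (simp add: key)
    from Lim_transform_eventually[OF isContD[OF c(2)] this] isContD[OF c(1)]
    have "- 1 / (e * (e - 1)) = 2 * q e + (e - e) * deriv q e"
      by (rule tendsto_unique[rotated]) simp
    hence 2: "2 * q e = - (1 / (e * (e - 1)))" by simp
    have "q e = (2 * q e) / 2" by simp
    also have "2 * q e = - (1 / (e * (e - 1)))" by (rule 2)
    finally have "q e = - (1 / (e * (e - 1))) / 2" .
    also have "\<dots> = - of_real ((kappa \<epsilon>)\<^sup>2)"
      unfolding kappa_square[OF \<epsilon>] by (simp add: e_def mult_ac)
    finally show ?thesis .
  qed
  thus ?thesis using q fac that[of q] by (simp add: S_def e_def D_def)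
qed

text \<open>The map \<open>v z = - \<i> * (z - \<epsilon>) * csqrt (- q z)\<close> is a holomorphic
  square root of \<open>psi z - psi \<epsilon>\<close> near the saddle, with derivative
  \<open>- \<i> * kappa\<close> there. Its local inverse is the required parametrization, since
  \<open>1 / (- \<i> * kappa) = \<i> / kappa\<close>.\<close>

lemma is_saddle_param_exists:
  assumes \<epsilon>: "\<epsilon> > 1"
  shows "\<exists>t. is_saddle_param \<epsilon> t"
proof -
  define e where "e = complex_of_real \<epsilon>"
  define S where "S = ball e (\<epsilon> - 1)"
  obtain q where q: "q holomorphic_on S" "q e = - of_real ((kappa \<epsilon>)\<^sup>2)"
    "\<And>z. z \<in> S \<Longrightarrow> psi \<epsilon> z - psi \<epsilon> e = (z - e)\<^sup>2 * q z"
    using psi_factorization[OF \<epsilon>] unfolding S_def e_def by blast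
  have k: "kappa \<epsilon> > 0" by (rule kappa_pos[OF \<epsilon>])
  have Se: "open S" "e \<in> S" using \<epsilon> by (auto simp: S_def)
  \<comment> \<open>Here \<open>- q\<close> has positive real part, so the principal square root of
    it is holomorphic.\<close>
  define S' where "S' = S \<inter> q -` {w. Re w < 0}"
  have S': "open S'" unfolding S'_def
    by (intro continuous_open_preimage holomorphic_on_imp_continuous_on q Se open_halfspace_Re_lt)
  have eS': "e \<in> S'" using Se q(2) k by (simp add: S'_def)
  define v where "v = (\<lambda>z. (z - e) * (- \<i> * csqrt (- q z)))"
  have rt: "(\<lambda>z. csqrt (- q z)) holomorphic_on S'"
  proof (rule holomorphic_on_csqrt')
    show "(\<lambda>z. - q z) holomorphic_on S'"
      using q(1) by (intro holomorphic_intros) (auto intro: holomorphic_on_subset simp: S'_def)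
  qed (auto simp: S'_def complex_nonpos_Reals_iff)
  have v: "v holomorphic_on S'" unfolding v_def by (intro holomorphic_intros rt)
  have ce: "csqrt (- q e) = of_real (kappa \<epsilon>)"
    using k by (simp add: q(2) of_real_sqrt[symmetric] flip: of_real_power)
  have g: "(\<lambda>z. - \<i> * csqrt (- q z)) holomorphic_on S'" by (intro holomorphic_intros rt)
  have "(v has_field_derivative (1 - 0) * (- \<i> * csqrt (- q e)) + deriv (\<lambda>z. - \<i> * csqrt (- q z)) e * (e - e)) (at e)"
    unfolding v_def by (intro DERIV_mult DERIV_diff DERIV_ident DERIV_const holomorphic_derivI[OF g S' eS'])
  hence "(v has_field_derivative - \<i> * of_real (kappa \<epsilon>)) (at e)" by (simp add: ce)
  hence dv: "deriv v e = - \<i> * of_real (kappa \<epsilon>)" by (rule DERIV_imp_deriv)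
  obtain r where r: "r > 0" "ball e r \<subseteq> S'" "open (v ` ball e r)" "inj_on v (ball e r)"
    using has_complex_derivative_locally_invertible[OF v eS' S'] dv k by auto
  obtain t where t: "t holomorphic_on (v ` ball e r)" "\<And>z. z \<in> ball e r \<Longrightarrow> deriv v z * deriv t (v z) = 1"
    "\<And>z. z \<in> ball e r \<Longrightarrow> t (v z) = z"
    using holomorphic_has_inverse[OF holomorphic_on_subset[OF v r(2)] open_ball r(4)] by blast
  have v0: "v e = 0" by (simp add: v_def)
  have e: "e \<in> ball e r" using r by simp
  have "is_saddle_param \<epsilon> t"
    unfolding is_saddle_param_def e_def[symmetric]
  proof (intro conjI)
    have z: "0 \<in> v ` ball e r" using e v0 by force
    show "t analytic_on {0}" by (rule holomorphic_on_imp_analytic_at[OF t(1) r(3) z])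
    show "t 0 = e" using t(3)[OF e] v0 by simp
    have "- \<i> * of_real (kappa \<epsilon>) * deriv t 0 = 1" using t(2)[OF e] v0 dv by simp
    thus "deriv t 0 = \<i> / of_real (kappa \<epsilon>)" using k by (simp add: field_simps) (simp add: complex_eq_iff)
    show "\<forall>\<^sub>F u in nhds 0. u\<^sup>2 = psi \<epsilon> (t u) - psi \<epsilon> e"
    proof (rule eventually_mono[OF eventually_nhds_in_open[OF r(3) z]])
      fix u assume "u \<in> v ` ball e r"
      then obtain z where z: "z \<in> ball e r" "u = v z" by blast
      hence "z \<in> S" using r(2) by (auto simp: S'_def)
      hence "psi \<epsilon> z - psi \<epsilon> e = (z - e)\<^sup>2 * q z" by (rule q(3))
      thus "u\<^sup>2 = psi \<epsilon> (t u) - psi \<epsilon> e" using z t(3)[OF z(1)] by (simp add: v_def power_mult_distrib)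
    qed
  qed
  thus ?thesis by blast
qed

lemma saddle_param: "\<epsilon> > 1 \<Longrightarrow> is_saddle_param \<epsilon> (saddle_param \<epsilon>)"
  unfolding saddle_param_def using is_saddle_param_exists by (rule someI_ex)

lemma saddle_param_ball:
  assumes \<epsilon>: "\<epsilon> > 1" and U: "open U" "of_real \<epsilon> \<in> U"
  obtains R where "R > 0" "saddle_param \<epsilon> holomorphic_on ball 0 R"
    "\<And>u. u \<in> ball 0 R \<Longrightarrow> saddle_param \<epsilon> u \<in> U"
    "\<And>u. u \<in> ball 0 R \<Longrightarrow> psi \<epsilon> (saddle_param \<epsilon> u) - psi \<epsilon> (of_real \<epsilon>) = u\<^sup>2"
proof -
  let ?t = "saddle_param \<epsilon>"
  note t = saddle_param[OF \<epsilon>, unfolded is_saddle_param_def]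
  obtain V where V: "open V" "0 \<in> V" "?t holomorphic_on V" using t by (auto simp: analytic_at)
  have "isCont ?t 0"
    using V by (auto intro!: continuous_on_interior[OF holomorphic_on_imp_continuous_on] simp: interior_open)
  hence "\<forall>\<^sub>F u in at 0. ?t u \<in> U"
    unfolding isCont_def using U t by (intro topological_tendstoD) auto
  hence "\<forall>\<^sub>F u in nhds 0. ?t u \<in> U" using t U by (simp add: eventually_nhds_conv_at)
  moreover have "\<forall>\<^sub>F u in nhds 0. u \<in> V" using V by (intro eventually_nhds_in_open)
  moreover have "\<forall>\<^sub>F u in nhds 0. u\<^sup>2 = psi \<epsilon> (?t u) - psi \<epsilon> (of_real \<epsilon>)" using t by blast
  ultimately have "\<forall>\<^sub>F u in nhds 0. ?t u \<in> U \<and> u \<in> V \<and> psi \<epsilon> (?t u) - psi \<epsilon> (of_real \<epsilon>) = u\<^sup>2"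
    by eventually_elim (intro conjI; (assumption | (rule sym, assumption)))
  then obtain R where R: "R > 0" "\<And>u. dist u 0 < R \<Longrightarrow> ?t u \<in> U \<and> u \<in> V \<and> psi \<epsilon> (?t u) - psi \<epsilon> (of_real \<epsilon>) = u\<^sup>2"
    unfolding eventually_nhds_metric by blast
  show ?thesis
  proof (rule that[OF R(1)])
    show "?t holomorphic_on ball 0 R"
      using V(3) by (rule holomorphic_on_subset) (use R(2) in \<open>auto simp: dist_commute\<close>)
  qed (use R(2) in \<open>auto simp: dist_commute\<close>)
qed

section \<open>Deformation near the saddle\<close>

text \<open>\<open>hfun\<close> before its pole is subtracted, the function to which Watson's lemma
  applies.\<close>

definition saddle_fun :: "real \<Rightarrow> real \<Rightarrow> complex \<Rightarrow> complex \<Rightarrow> complex \<Rightarrow> complex" where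
  "saddle_fun \<epsilon> \<alpha> a c u =
     amp a c (saddle_param \<epsilon> u) * deriv (saddle_param \<epsilon>) u / (saddle_param \<epsilon> u - of_real \<alpha>)"

definition psid :: "real \<Rightarrow> complex \<Rightarrow> complex" where
  "psid \<epsilon> z = psi \<epsilon> z - psi \<epsilon> (of_real \<epsilon>)"

text \<open>The integrand in the variable \<open>t = 1 / s\<close>, normalised so that its
  exponential factor is 1 at the saddle.\<close>

definition efun :: "real \<Rightarrow> real \<Rightarrow> complex \<Rightarrow> complex \<Rightarrow> real \<Rightarrow> complex \<Rightarrow> complex" where
  "efun \<epsilon> \<alpha> a c L z = amp a c z * exp (- of_real L * psid \<epsilon> z) / (z - of_real \<alpha>)"

text \<open>A narrow open-ended sector with its vertex at \<epsilon> removed, about the steepest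
  descent direction \<open>\<i>\<close> for \<tau> = 1 and \<open>- \<i>\<close> for \<tau> = -1. It
  is convex, so two of its points can be joined by a segment that stays inside.\<close>

definition cone :: "real \<Rightarrow> real \<Rightarrow> complex set" where
  "cone \<epsilon> \<tau> = {z. 4 * \<bar>Re z - \<epsilon>\<bar> \<le> \<tau> * Im z \<and> 0 < \<tau> * Im z}"

lemma convex_cone: "convex (cone \<epsilon> \<tau>)"
proof (rule convexI)
  fix x y and u v :: real
  assume xy: "x \<in> cone \<epsilon> \<tau>" "y \<in> cone \<epsilon> \<tau>" and uv: "0 \<le> u" "0 \<le> v" "u + v = 1"
  have I: "\<tau> * Im (u *\<^sub>R x + v *\<^sub>R y) = u * (\<tau> * Im x) + v * (\<tau> * Im y)" by (simp add: algebra_simps)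
  define X Y where "X = \<bar>Re x - \<epsilon>\<bar>" and "Y = \<bar>Re y - \<epsilon>\<bar>"
  have "u * \<epsilon> + v * \<epsilon> = \<epsilon>" using uv(3) by (metis distrib_right mult_1)
  hence "Re (u *\<^sub>R x + v *\<^sub>R y) - \<epsilon> = u * (Re x - \<epsilon>) + v * (Re y - \<epsilon>)"
    by (simp add: algebra_simps)
  hence "\<bar>Re (u *\<^sub>R x + v *\<^sub>R y) - \<epsilon>\<bar> \<le> u * X + v * Y"
    using uv abs_triangle_ineq[of "u * (Re x - \<epsilon>)" "v * (Re y - \<epsilon>)"] by (simp add: abs_mult X_def Y_def)
  hence "4 * \<bar>Re (u *\<^sub>R x + v *\<^sub>R y) - \<epsilon>\<bar> \<le> u * (4 * X) + v * (4 * Y)" by simp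
  also have "\<dots> \<le> u * (\<tau> * Im x) + v * (\<tau> * Im y)"
    using xy uv unfolding X_def Y_def by (intro add_mono mult_left_mono) (auto simp: cone_def)
  finally have "4 * \<bar>Re (u *\<^sub>R x + v *\<^sub>R y) - \<epsilon>\<bar> \<le> u * (\<tau> * Im x) + v * (\<tau> * Im y)" .
  moreover have "0 < u * (\<tau> * Im x) + v * (\<tau> * Im y)"
  proof (cases "u = 0")
    case False
    hence "0 < u * (\<tau> * Im x)" "0 \<le> v * (\<tau> * Im y)" using xy uv by (auto simp: cone_def)
    thus ?thesis by linarith
  qed (use xy uv in \<open>auto simp: cone_def\<close>)
  ultimately show "u *\<^sub>R x + v *\<^sub>R y \<in> cone \<epsilon> \<tau>"
    unfolding cone_def mem_Collect_eq I by (rule conjI)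
qed

text \<open>Near \<epsilon> the factor \<open>q\<close> differs from \<open>- k\<close> by less than
  \<open>k / 2\<close>, so with \<xi>, \<eta> the real and imaginary parts of
  \<open>z - \<epsilon>\<close> positivity follows from \<open>3 * \<xi>^2 < \<eta>^2\<close>. The
  aperture of the sector gives \<open>16 * \<xi>^2 <= \<eta>^2\<close>.\<close>

lemma cone_positive:
  assumes \<epsilon>: "\<epsilon> > 1"
  obtains \<rho> where "\<rho> > 0" "\<rho> \<le> \<epsilon> - 1"
    "\<And>z \<tau>. z \<in> ball (of_real \<epsilon>) \<rho> \<Longrightarrow> \<bar>\<tau>\<bar> = 1 \<Longrightarrow> z \<in> cone \<epsilon> \<tau> \<Longrightarrow> Re (psid \<epsilon> z) > 0"
proof -
  let ?e = "complex_of_real \<epsilon>"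
  obtain q where q: "q holomorphic_on ball ?e (\<epsilon> - 1)" "q ?e = - of_real ((kappa \<epsilon>)\<^sup>2)"
    "\<And>z. z \<in> ball ?e (\<epsilon> - 1) \<Longrightarrow> psi \<epsilon> z - psi \<epsilon> ?e = (z - ?e)\<^sup>2 * q z"
    using psi_factorization[OF \<epsilon>] by blast
  define k where "k = (kappa \<epsilon>)\<^sup>2"
  have k: "k > 0" using kappa_pos[OF \<epsilon>] by (simp add: k_def)
  have "isCont q ?e"
    using q(1) \<epsilon> by (intro continuous_on_interior[OF holomorphic_on_imp_continuous_on]) (auto simp: interior_open)
  then obtain d where d: "d > 0" "\<And>z. dist z ?e < d \<Longrightarrow> dist (q z) (q ?e) < k / 2"
    using k unfolding continuous_at_eps_delta by (metis half_gt_zero)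
  define \<rho> where "\<rho> = min d (\<epsilon> - 1)"
  show ?thesis
  proof (rule that[of \<rho>])
    fix z and \<tau> :: real assume z: "z \<in> ball ?e \<rho>" "\<bar>\<tau>\<bar> = 1" "z \<in> cone \<epsilon> \<tau>"
    define \<xi> \<eta> where "\<xi> = Re z - \<epsilon>" and "\<eta> = Im z"
    have \<eta>: "4 * \<bar>\<xi>\<bar> \<le> \<bar>\<eta>\<bar>" "\<eta> \<noteq> 0"
    proof -
      have "\<tau> * Im z \<le> \<bar>\<eta>\<bar>" using z(2) abs_ge_self[of "\<tau> * Im z"] by (simp add: abs_mult \<eta>_def)
      thus "4 * \<bar>\<xi>\<bar> \<le> \<bar>\<eta>\<bar>" "\<eta> \<noteq> 0" using z(3) by (auto simp: cone_def \<xi>_def \<eta>_def)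
    qed
    have w2: "Re ((z - ?e)\<^sup>2) = \<xi>\<^sup>2 - \<eta>\<^sup>2" "norm ((z - ?e)\<^sup>2) = \<xi>\<^sup>2 + \<eta>\<^sup>2"
      unfolding norm_power cmod_power2 by (simp_all add: \<xi>_def \<eta>_def power2_eq_square)
    have b: "norm (q z + of_real k) < k / 2"
      using d(2)[of z] z(1) by (simp add: \<rho>_def dist_norm q(2) k_def norm_minus_commute)
    have "z \<in> ball ?e (\<epsilon> - 1)" using z(1) by (auto simp: \<rho>_def)
    from q(3)[OF this] have "psid \<epsilon> z = (z - ?e)\<^sup>2 * (q z + of_real k) - of_real k * (z - ?e)\<^sup>2"
      by (simp add: psid_def algebra_simps)
    hence "Re (psid \<epsilon> z) = Re ((z - ?e)\<^sup>2 * (q z + of_real k)) - k * (\<xi>\<^sup>2 - \<eta>\<^sup>2)"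
      using w2(1) by simp
    moreover have "Re ((z - ?e)\<^sup>2 * (q z + of_real k)) \<ge> - ((\<xi>\<^sup>2 + \<eta>\<^sup>2) * (k / 2))"
    proof -
      have "norm ((z - ?e)\<^sup>2 * (q z + of_real k)) \<le> (\<xi>\<^sup>2 + \<eta>\<^sup>2) * (k / 2)"
        unfolding norm_mult w2(2) using b by (intro mult_left_mono) auto
      thus ?thesis using abs_Re_le_cmod[of "(z - ?e)\<^sup>2 * (q z + of_real k)"] by linarith
    qed
    moreover have "(\<xi>\<^sup>2 + \<eta>\<^sup>2) * (k / 2) < - (k * (\<xi>\<^sup>2 - \<eta>\<^sup>2))"
    proof -
      have "(4 * \<bar>\<xi>\<bar>)\<^sup>2 \<le> \<bar>\<eta>\<bar>\<^sup>2" using \<eta> by (intro power_mono) auto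
      hence "16 * \<xi>\<^sup>2 \<le> \<eta>\<^sup>2" by (simp add: power_mult_distrib)
      moreover have "\<eta>\<^sup>2 > 0" using \<eta> by simp
      ultimately have "3 * \<xi>\<^sup>2 < \<eta>\<^sup>2" by linarith
      hence "k / 2 * (3 * \<xi>\<^sup>2) < k / 2 * \<eta>\<^sup>2" using k by (intro mult_strict_left_mono) auto
      thus ?thesis by (simp add: algebra_simps)
    qed
    ultimately show "Re (psid \<epsilon> z) > 0" by linarith
  qed (use d \<epsilon> in \<open>auto simp: \<rho>_def\<close>)
qed

lemma amp_holomorphic: "amp a c holomorphic_on {z. Re z > 1}"
  unfolding amp_def using halfplane_nonpos_Reals
  by (intro holomorphic_intros) auto

lemma psid_holomorphic: "psid \<epsilon> holomorphic_on {z. Re z > 1}"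
proof -
  have "(psid \<epsilon> has_field_derivative (of_real \<epsilon> - z) / (z * (z - 1))) (at z)" if "Re z > 1" for z
    unfolding psid_def[abs_def] using DERIV_diff[OF psi_DERIV_complex[OF that] DERIV_const] by simp
  thus ?thesis by (auto simp: holomorphic_on_open open_halfspace_Re_gt)
qed

lemma efun_holomorphic: "efun \<epsilon> \<alpha> a c L holomorphic_on {z. Re z > 1} - {of_real \<alpha>}"
  unfolding efun_def
  by (intro holomorphic_intros holomorphic_on_subset[OF amp_holomorphic] holomorphic_on_subset[OF psid_holomorphic]) auto

lemma efun_compact_bound:
  assumes "compact S" "S \<subseteq> {z. Re z > 1} - {of_real \<alpha>}" "\<And>z. z \<in> S \<Longrightarrow> Re (psid \<epsilon> z) > 0"
  obtains B \<eta> where "B \<ge> 0" "\<eta> > 0" "\<And>L z. L \<ge> 0 \<Longrightarrow> z \<in> S \<Longrightarrow> norm (efun \<epsilon> \<alpha> a c L z) \<le> B * exp (- L * \<eta>)"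
proof (cases "S = {}")
  case False
  have "continuous_on S (psid \<epsilon>)"
    by (intro holomorphic_on_imp_continuous_on holomorphic_on_subset[OF psid_holomorphic]) (use assms in auto)
  hence "continuous_on S (\<lambda>z. Re (psid \<epsilon> z))" by (intro continuous_intros)
  from continuous_attains_inf[OF assms(1) False this] obtain z0 where z0: "z0 \<in> S" "\<And>z. z \<in> S \<Longrightarrow> Re (psid \<epsilon> z0) \<le> Re (psid \<epsilon> z)"
    by blast
  \<comment> \<open>At \<open>L = 0\<close> the exponential is absent, so this bound concerns the
    amplitude and the pole factor alone.\<close>
  have "continuous_on S (efun \<epsilon> \<alpha> a c 0)"
    using assms by (intro holomorphic_on_imp_continuous_on holomorphic_on_subset[OF efun_holomorphic]) auto
  hence "bounded (efun \<epsilon> \<alpha> a c 0 ` S)" using assms by (intro compact_imp_bounded compact_continuous_image)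
  then obtain B where B: "B > 0" "\<And>z. z \<in> S \<Longrightarrow> norm (efun \<epsilon> \<alpha> a c 0 z) \<le> B" by (auto simp: bounded_pos)
  show ?thesis
  proof (rule that[of B "Re (psid \<epsilon> z0)"])
    fix L :: real and z assume L: "L \<ge> 0" and z: "z \<in> S"
    have e: "efun \<epsilon> \<alpha> a c L z = efun \<epsilon> \<alpha> a c 0 z * exp (- of_real L * psid \<epsilon> z)"
      by (simp add: efun_def)
    have "L * Re (psid \<epsilon> z0) \<le> L * Re (psid \<epsilon> z)" using L z0 z by (intro mult_left_mono) auto
    hence "norm (exp (- of_real L * psid \<epsilon> z)) \<le> exp (- L * Re (psid \<epsilon> z0))" by (simp add: norm_exp_eq_Re)
    thus "norm (efun \<epsilon> \<alpha> a c L z) \<le> B * exp (- L * Re (psid \<epsilon> z0))"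
      unfolding e norm_mult using B z by (intro mult_mono) auto
  qed (use B z0 assms in auto)
qed (use that[of 0 1] in auto)

text \<open>The derivative at 0 is \<open>\<i> * k\<close> with \<open>k > 0\<close>. Once the
  difference quotient is within \<open>k / 8\<close> of it, its real part is below
  \<open>k / 8\<close> and its imaginary part above \<open>7 * k / 8\<close>, which leaves room for
  the aperture 4; the sign of \<open>h\<close> selects the sector.\<close>

lemma saddle_param_in_cone:
  assumes \<epsilon>: "\<epsilon> > 1" and R: "R > 0"
  obtains r where "0 < r" "r < R" "saddle_param \<epsilon> (of_real r) \<in> cone \<epsilon> 1" "saddle_param \<epsilon> (of_real (-r)) \<in> cone \<epsilon> (-1)"
proof -
  let ?t = "saddle_param \<epsilon>"
  define k where "k = 1 / kappa \<epsilon>"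
  have k: "k > 0" using kappa_pos[OF \<epsilon>] by (simp add: k_def)
  note t = saddle_param[OF \<epsilon>, unfolded is_saddle_param_def]
  have "?t field_differentiable at 0" using t by (auto intro: analytic_on_imp_differentiable_at)
  from field_differentiable_derivI[OF this] have "(?t has_field_derivative \<i> * of_real k) (at 0)"
    using t by (simp add: k_def)
  hence "((\<lambda>h. (?t h - of_real \<epsilon>) / h) \<longlongrightarrow> \<i> * of_real k) (at 0)"
    using t by (simp add: DERIV_def)
  hence "\<forall>\<^sub>F h in at 0. dist ((?t h - of_real \<epsilon>) / h) (\<i> * of_real k) < k / 8"
    using k by (intro tendstoD) auto
  then obtain d where d: "d > 0" "\<And>h. h \<noteq> 0 \<Longrightarrow> norm h < d \<Longrightarrow> norm ((?t h - of_real \<epsilon>) / h - \<i> * of_real k) < k / 8"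
    by (auto simp: eventually_at dist_norm)
  have main: "?t (of_real h) \<in> cone \<epsilon> (sgn h)" if h: "h \<noteq> 0" "\<bar>h\<bar> < d" for h :: real
  proof -
    define w where "w = (?t (of_real h) - of_real \<epsilon>) / of_real h"
    have "norm (w - \<i> * of_real k) < k / 8" using d(2)[of "of_real h"] h by (simp add: w_def)
    hence w: "\<bar>Re w\<bar> < k / 8" "\<bar>Im w - k\<bar> < k / 8"
      using abs_Re_le_cmod[of "w - \<i> * of_real k"] abs_Im_le_cmod[of "w - \<i> * of_real k"] by simp_all
    have "?t (of_real h) = of_real \<epsilon> + of_real h * w" using h by (simp add: w_def)
    hence c: "Re (?t (of_real h)) - \<epsilon> = h * Re w" "Im (?t (of_real h)) = h * Im w" by simp_all
    have "4 * \<bar>Re w\<bar> \<le> Im w" "0 < Im w" using w by linarith+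
    hence "\<bar>h\<bar> * (4 * \<bar>Re w\<bar>) \<le> \<bar>h\<bar> * Im w" and pos: "0 < \<bar>h\<bar> * Im w"
      using h by (auto intro!: mult_left_mono)
    hence le: "4 * (\<bar>h\<bar> * \<bar>Re w\<bar>) \<le> \<bar>h\<bar> * Im w" by (simp only: mult.left_commute)
    have s: "sgn h * (h * Im w) = \<bar>h\<bar> * Im w"
      by (cases "h \<ge> 0") (auto simp: sgn_if)
    show ?thesis unfolding cone_def mem_Collect_eq c s abs_mult by (rule conjI[OF le pos])
  qed
  define r where "r = min R d / 2"
  have "0 < r" "r < R" "r < d" using R d by (auto simp: r_def)
  thus ?thesis using main[of r] main[of "-r"] by (intro that[of r]) auto
qed

text \<open>Inversion sends the line to a circle through 0 and \<epsilon> with a vertical tangent at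
  \<epsilon>. At height parameter \<delta> the horizontal deviation is
  \<open>\<epsilon> * \<delta>\<close> times the vertical one, hence the condition on \<delta>.
  Inversion also swaps the half-planes, so \<open>-\<delta>\<close> lands in the upper
  sector.\<close>

lemma inverse_line_in_cone:
  assumes "\<epsilon> > 1" "0 < \<delta>" "4 * \<delta> \<le> 1 / \<epsilon>"
  shows "1 / Complex (1 / \<epsilon>) (-\<delta>) \<in> cone \<epsilon> 1" "1 / Complex (1 / \<epsilon>) \<delta> \<in> cone \<epsilon> (-1)"
proof -
  define \<sigma> where "\<sigma> = 1 / \<epsilon>"
  have \<sigma>: "\<sigma> > 0" "\<epsilon> = 1 / \<sigma>" using assms by (auto simp: \<sigma>_def)
  define m where "m = \<sigma>\<^sup>2 + \<delta>\<^sup>2"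
  have m: "m > 0" using \<sigma> by (simp add: m_def add_pos_nonneg)
  have "\<sigma> / m - 1 / \<sigma> = - (\<delta> * \<delta> / (\<sigma> * m))"
    using m \<sigma> by (simp add: divide_simps) (simp add: m_def power2_eq_square)
  hence "\<bar>\<sigma> / m - \<epsilon>\<bar> = (\<delta> / \<sigma>) * (\<delta> / m)" using m \<sigma> assms by simp
  also have "4 * ((\<delta> / \<sigma>) * (\<delta> / m)) \<le> 1 * (\<delta> / m)"
  proof -
    have "4 * (\<delta> / \<sigma>) \<le> 1" using assms \<sigma> by (simp add: \<sigma>_def[symmetric])
    from mult_right_mono[OF this, of "\<delta> / m"] show ?thesis using assms m by simp
  qed
  finally have "4 * \<bar>\<sigma> / m - \<epsilon>\<bar> \<le> \<delta> / m" by simp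
  moreover have "0 < \<delta> / m" using m assms by simp
  moreover have "Re (1 / Complex \<sigma> y) = \<sigma> / (\<sigma>\<^sup>2 + y\<^sup>2)" "Im (1 / Complex \<sigma> y) = - y / (\<sigma>\<^sup>2 + y\<^sup>2)" for y
    by (simp_all add: Re_divide Im_divide)
  ultimately show "1 / Complex (1 / \<epsilon>) (-\<delta>) \<in> cone \<epsilon> 1" "1 / Complex (1 / \<epsilon>) \<delta> \<in> cone \<epsilon> (-1)"
    unfolding \<sigma>_def[symmetric] by (simp_all add: cone_def m_def)
qed

lemma saddle_fun_holomorphic:
  assumes "saddle_param \<epsilon> holomorphic_on ball 0 R"
    and "\<And>u. u \<in> ball 0 R \<Longrightarrow> saddle_param \<epsilon> u \<in> {z. Re z > 1} - {of_real \<alpha>}"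
  shows "saddle_fun \<epsilon> \<alpha> a c holomorphic_on ball 0 R"
proof -
  have "(amp a c \<circ> saddle_param \<epsilon>) holomorphic_on ball 0 R"
    using assms(2) by (intro holomorphic_on_compose_gen[OF assms(1) amp_holomorphic]) auto
  hence "(\<lambda>u. amp a c (saddle_param \<epsilon> u)) holomorphic_on ball 0 R" by (simp add: o_def)
  thus ?thesis
    unfolding saddle_fun_def using assms(2)
    by (intro holomorphic_on_divide holomorphic_on_mult holomorphic_on_diff holomorphic_on_const assms(1) holomorphic_deriv[OF assms(1)]) auto
qed

text \<open>Both integrals are differences of values of one primitive on a disc around the saddle. Their end points
  are joined inside the cones, where the integrand is exponentially small.\<close>

lemma local_contribution:
  assumes \<epsilon>: "\<epsilon> > 1" and \<alpha>: "\<alpha> > 1" "\<alpha> \<noteq> \<epsilon>"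
  obtains R r \<delta> B \<eta> where "0 < r" "r < R" "saddle_fun \<epsilon> \<alpha> a c holomorphic_on ball 0 R" "0 < \<delta>" "\<eta> > 0"
    "\<And>L. L \<ge> 0 \<Longrightarrow> norm (integral {-\<delta>..\<delta>} (\<lambda>y. - of_real \<alpha> * ((1 / Complex (1/\<epsilon>) y)\<^sup>2 * efun \<epsilon> \<alpha> a c L (1 / Complex (1/\<epsilon>) y)))
       - \<i> * of_real \<alpha> * integral {-r..r} (\<lambda>u. of_real (exp (- L * u\<^sup>2)) * saddle_fun \<epsilon> \<alpha> a c (of_real u))) \<le> B * exp (- L * \<eta>)"
proof -
  let ?e = "complex_of_real \<epsilon>" and ?t = "saddle_param \<epsilon>"
  define \<sigma> where "\<sigma> = 1 / \<epsilon>"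
  have \<sigma>: "\<sigma> > 0" using \<epsilon> by (simp add: \<sigma>_def)
  obtain \<rho>0 where \<rho>0: "\<rho>0 > 0" "\<rho>0 \<le> \<epsilon> - 1"
    "\<And>z \<tau>. z \<in> ball ?e \<rho>0 \<Longrightarrow> \<bar>\<tau>\<bar> = 1 \<Longrightarrow> z \<in> cone \<epsilon> \<tau> \<Longrightarrow> Re (psid \<epsilon> z) > 0"
    using cone_positive[OF \<epsilon>] by blast
  \<comment> \<open>The radius keeps the disc in the region of \<open>cone_positive\<close> and away
    from the pole \<alpha>; being convex, the disc carries a primitive of the integrand.\<close>
  define U where "U = ball ?e (min \<rho>0 \<bar>\<alpha> - \<epsilon>\<bar>)"
  have U: "open U" "?e \<in> U" "convex U" using \<rho>0 \<alpha> by (auto simp: U_def)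
  have U1: "Re z > 1" if "z \<in> U" for z
    using that \<rho>0(2) by (intro ball_halfplane[of z \<epsilon>]) (auto simp: U_def)
  have U2: "z \<noteq> of_real \<alpha>" if "z \<in> U" for z
  proof
    assume "z = of_real \<alpha>"
    hence "dist ?e z = \<bar>\<epsilon> - \<alpha>\<bar>" by (simp only: dist_of_real dist_real_def)
    thus False using that abs_minus_commute[of \<epsilon> \<alpha>] by (simp add: U_def)
  qed
  have Usub: "U \<subseteq> {z. Re z > 1} - {of_real \<alpha>}" using U1 U2 by auto
  have Upos: "Re (psid \<epsilon> z) > 0" if "z \<in> U" "z \<in> cone \<epsilon> \<tau>" "\<bar>\<tau>\<bar> = 1" for z \<tau>
    using that \<rho>0(3)[of z \<tau>] by (auto simp: U_def)
  obtain R where R: "R > 0" "?t holomorphic_on ball 0 R" "\<And>u. u \<in> ball 0 R \<Longrightarrow> ?t u \<in> U"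
    "\<And>u. u \<in> ball 0 R \<Longrightarrow> psi \<epsilon> (?t u) - psi \<epsilon> ?e = u\<^sup>2"
    using saddle_param_ball[OF \<epsilon> U(1,2)] by blast
  obtain r where r: "0 < r" "r < R" "?t (of_real r) \<in> cone \<epsilon> 1" "?t (of_real (-r)) \<in> cone \<epsilon> (-1)"
    using saddle_param_in_cone[OF \<epsilon> R(1)] by blast
  have Kh: "saddle_fun \<epsilon> \<alpha> a c holomorphic_on ball 0 R"
    using R Usub by (intro saddle_fun_holomorphic) auto
  obtain d where d: "d > 0" "\<And>y. \<bar>y\<bar> < d \<Longrightarrow> 1 / Complex \<sigma> y \<in> U"
  proof -
    have "isCont (\<lambda>y. 1 / (of_real \<sigma> + \<i> * of_real y)) 0" using \<sigma> by (intro continuous_intros) auto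
    hence "isCont (\<lambda>y. 1 / Complex \<sigma> y) 0" by (simp add: Complex_eq)
    moreover have "1 / Complex \<sigma> 0 = ?e" using \<epsilon> by (simp add: \<sigma>_def Complex_eq)
    ultimately have "\<forall>\<^sub>F y in nhds 0. 1 / Complex \<sigma> y \<in> U"
      unfolding isCont_def using U by (simp add: eventually_nhds_conv_at) (metis topological_tendstoD)
    thus ?thesis using that unfolding eventually_nhds_metric by (auto simp: dist_real_def)
  qed
  \<comment> \<open>The first entry keeps the inverted segment inside \<open>U\<close>, the second
    places its end points in the sectors.\<close>
  define \<delta> where "\<delta> = min (d / 2) (\<sigma> / 4)"
  have \<delta>: "0 < \<delta>" "\<delta> < d" "4 * \<delta> \<le> 1 / \<epsilon>" using d \<sigma> by (auto simp: \<delta>_def \<sigma>_def min_def)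
  define p1 p2 where "p1 = 1 / Complex \<sigma> (-\<delta>)" and "p2 = 1 / Complex \<sigma> \<delta>"
  have p: "p1 \<in> U" "p2 \<in> U" "p1 \<in> cone \<epsilon> 1" "p2 \<in> cone \<epsilon> (-1)"
    using d(2)[of \<delta>] d(2)[of "-\<delta>"] \<delta> inverse_line_in_cone[OF \<epsilon> \<delta>(1,3)] by (auto simp: p1_def p2_def \<sigma>_def)
  have tr: "?t (of_real r) \<in> U" "?t (of_real (-r)) \<in> U" using r by (auto intro!: R(3))
  have seg: "closed_segment z w \<subseteq> U \<inter> cone \<epsilon> \<tau>" if "z \<in> U" "w \<in> U" "z \<in> cone \<epsilon> \<tau>" "w \<in> cone \<epsilon> \<tau>" for z w \<tau>
    using that U(3) convex_cone by (intro closed_segment_subset convex_Int) auto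
  define S where "S = closed_segment (?t (of_real r)) p1 \<union> closed_segment (?t (of_real (-r))) p2"
  have S1: "closed_segment (?t (of_real r)) p1 \<subseteq> U \<inter> cone \<epsilon> 1" using seg tr p r by blast
  have S2: "closed_segment (?t (of_real (-r))) p2 \<subseteq> U \<inter> cone \<epsilon> (-1)" using seg tr p r by blast
  have Spos: "Re (psid \<epsilon> z) > 0" if "z \<in> S" for z
    using that S1 S2 Upos[of z 1] Upos[of z "-1"] unfolding S_def by auto
  have SU: "S \<subseteq> U" using S1 S2 unfolding S_def by blast
  have Scomp: "compact S" unfolding S_def by (intro compact_Un compact_segment)
  obtain B \<eta> where B: "B \<ge> 0" "\<eta> > 0" "\<And>L z. L \<ge> 0 \<Longrightarrow> z \<in> S \<Longrightarrow> norm (efun \<epsilon> \<alpha> a c L z) \<le> B * exp (- L * \<eta>)"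
    using efun_compact_bound[OF Scomp order_trans[OF SU Usub] Spos] by metis
  define lens where "lens = norm (?t (of_real r) - p1) + norm (?t (of_real (-r)) - p2)"
  show ?thesis
  proof (rule that[OF r(1,2) Kh \<delta>(1) B(2)])
    fix L :: real assume L: "L \<ge> 0"
    let ?E = "efun \<epsilon> \<alpha> a c L"
    have "?E holomorphic_on U" by (rule holomorphic_on_subset[OF efun_holomorphic Usub])
    then obtain F where F: "\<And>z. z \<in> U \<Longrightarrow> (F has_field_derivative ?E z) (at z within U)"
      using holomorphic_convex_primitive'[OF U(3,1)] by blast
    have F': "(F has_field_derivative ?E z) (at z)" if "z \<in> U" for z
      using F[OF that] at_within_open[OF that U(1)] by simp
    have I1: "((\<lambda>u. of_real (exp (- L * u\<^sup>2)) * saddle_fun \<epsilon> \<alpha> a c (of_real u)) has_integral F (?t (of_real r)) - F (?t (of_real (-r)))) {-r..r}"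
    proof (rule fundamental_theorem_of_calculus)
      fix u assume u: "u \<in> {-r..r}"
      hence ub: "of_real u \<in> ball (0::complex) R" using r by auto
      have "(?t has_field_derivative deriv ?t (of_real u)) (at (of_real u))"
        by (rule holomorphic_derivI[OF R(2) open_ball ub])
      from DERIV_chain2[OF F'[OF R(3)[OF ub]] this]
      have "((\<lambda>v. F (?t v)) has_field_derivative ?E (?t (of_real u)) * deriv ?t (of_real u)) (at (of_real u))" .
      moreover have "?E (?t (of_real u)) * deriv ?t (of_real u) = of_real (exp (- L * u\<^sup>2)) * saddle_fun \<epsilon> \<alpha> a c (of_real u)"
        using R(4)[OF ub] by (simp add: efun_def saddle_fun_def psid_def exp_of_real[symmetric])
      ultimately show "((\<lambda>u. F (?t (of_real u))) has_vector_derivative of_real (exp (- L * u\<^sup>2)) * saddle_fun \<epsilon> \<alpha> a c (of_real u)) (at u within {-r..r})"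
        by (intro has_vector_derivative_real_field) simp
    qed (use r in simp)
    have I2: "((\<lambda>y. \<i> * (\<lambda>s. - ((1 / s)\<^sup>2 * ?E (1 / s))) (Complex \<sigma> y)) has_integral F p2 - F p1) {-\<delta>..\<delta>}"
      unfolding p1_def p2_def
    proof (rule has_integral_vertical_primitive[where F="\<lambda>s. F (1 / s)"])
      fix y assume "- \<delta> \<le> y" "y \<le> \<delta>"
      hence "\<bar>y\<bar> < d" using \<delta> by auto
      hence yU: "1 / Complex \<sigma> y \<in> U" by (rule d(2))
      have nz: "Complex \<sigma> y \<noteq> 0" using \<sigma> by (simp add: complex_eq_iff)
      have "((\<lambda>s. 1 / s) has_field_derivative - ((1 / s)\<^sup>2)) (at s)" if "s \<noteq> 0" for s :: complex
        using that by (auto intro!: derivative_eq_intros simp: power2_eq_square)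
      from DERIV_chain2[OF F'[OF yU] this[OF nz]]
      show "((\<lambda>s. F (1 / s)) has_field_derivative - ((1 / Complex \<sigma> y)\<^sup>2 * ?E (1 / Complex \<sigma> y))) (at (Complex \<sigma> y))"
        by (simp only: mult_minus_right mult_minus_left mult.commute)
    qed (use \<delta> in simp)
    have i2: "integral {-\<delta>..\<delta>} (\<lambda>y. - of_real \<alpha> * ((1 / Complex \<sigma> y)\<^sup>2 * ?E (1 / Complex \<sigma> y))) = of_real \<alpha> / \<i> * (F p2 - F p1)"
    proof -
      have "complex_of_real \<alpha> / \<i> * \<i> = of_real \<alpha>" by (rule nonzero_eq_divide_eq[THEN iffD1]) simp_all
      hence "complex_of_real \<alpha> / \<i> * (\<i> * - X) = - of_real \<alpha> * X" for X
        by (simp only: mult.assoc[symmetric] mult_minus_right mult_minus_left)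
      thus ?thesis using has_integral_mult_right[OF I2, of "of_real \<alpha> / \<i>"]
        by (intro integral_unique) (simp only:)
    qed
    have bd: "norm (F z - F w) \<le> B * exp (- L * \<eta>) * norm (z - w)" if "closed_segment z w \<subseteq> S" for z w
    proof (rule field_differentiable_bound[where S="closed_segment z w" and f'="?E"])
      fix v assume v: "v \<in> closed_segment z w"
      hence "v \<in> S" using that by blast
      thus "norm (?E v) \<le> B * exp (- L * \<eta>)" using B(3)[OF L] by simp
      have "(F has_field_derivative ?E v) (at v)" using F'[of v] \<open>v \<in> S\<close> SU by blast
      thus "(F has_field_derivative ?E v) (at v within closed_segment z w)"
        by (rule has_field_derivative_at_within)
    qed auto
    \<comment> \<open>As \<open>y\<close> increases the inverted line runs from \<open>p1\<close>
      above the saddle down to \<open>p2\<close>, whereas the \<open>u\<close>-path runs upwards.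
      This reversal together with \<open>1 / \<i> = - \<i>\<close> leaves only increments of
      \<open>F\<close> between end points in the same sector.\<close>
    have "of_real \<alpha> / \<i> * (F p2 - F p1) - \<i> * of_real \<alpha> * (F (?t (of_real r)) - F (?t (of_real (-r))))
       = - (\<i> * of_real \<alpha> * ((F (?t (of_real r)) - F p1) - (F (?t (of_real (-r))) - F p2)))"
      by (simp add: algebra_simps)
    also have "norm \<dots> = \<alpha> * norm ((F (?t (of_real r)) - F p1) - (F (?t (of_real (-r))) - F p2))"
      using \<alpha> by (simp add: norm_mult)
    also have "\<dots> \<le> \<alpha> * (B * exp (- L * \<eta>) * lens)"
    proof (rule mult_left_mono)
      have "norm ((F (?t (of_real r)) - F p1) - (F (?t (of_real (-r))) - F p2)) \<le>
         norm (F (?t (of_real r)) - F p1) + norm (F (?t (of_real (-r))) - F p2)" by (rule norm_triangle_ineq4)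
      also have "\<dots> \<le> B * exp (- L * \<eta>) * norm (?t (of_real r) - p1) + B * exp (- L * \<eta>) * norm (?t (of_real (-r)) - p2)"
        by (intro add_mono bd) (auto simp: S_def)
      also have "\<dots> = B * exp (- L * \<eta>) * lens" by (simp add: lens_def distrib_left)
      finally show "norm ((F (?t (of_real r)) - F p1) - (F (?t (of_real (-r))) - F p2)) \<le> B * exp (- L * \<eta>) * lens" .
    qed (use \<alpha> in simp)
    finally show "norm (integral {-\<delta>..\<delta>} (\<lambda>y. - of_real \<alpha> * ((1 / Complex (1/\<epsilon>) y)\<^sup>2 * ?E (1 / Complex (1/\<epsilon>) y)))
       - \<i> * of_real \<alpha> * integral {-r..r} (\<lambda>u. of_real (exp (- L * u\<^sup>2)) * saddle_fun \<epsilon> \<alpha> a c (of_real u))) \<le> (\<alpha> * B * lens) * exp (- L * \<eta>)"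
      unfolding i2[unfolded \<sigma>_def] integral_unique[OF I1] by (simp add: mult_ac)
  qed
qed

section \<open>The line integral for large parameter\<close>

lemma psi_of_real: "t > 1 \<Longrightarrow> psi \<epsilon> (complex_of_real t) = of_real (psi \<epsilon> t)"
  using Ln_of_real[of t] Ln_of_real[of "t - 1"] by (simp add: psi_def)

text \<open>The form \<open>ln s + (\<epsilon> - 1) * ln (1 - s)\<close> at
  \<open>s = 1 / \<epsilon>\<close>, ready for comparison with the moduli at other points of the
  line.\<close>

lemma psi_saddle:
  assumes "\<epsilon> > 1"
  shows "psi \<epsilon> \<epsilon> = ln (1 / \<epsilon>) + (\<epsilon> - 1) * ln (1 - 1 / \<epsilon>)"
proof -
  have "1 - 1 / \<epsilon> = (\<epsilon> - 1) / \<epsilon>" using assms by (simp add: field_simps)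
  moreover have "ln ((\<epsilon> - 1) / \<epsilon>) = ln (\<epsilon> - 1) - ln \<epsilon>" using assms by (simp add: ln_div)
  ultimately have 1: "ln (1 - 1 / \<epsilon>) = ln (\<epsilon> - 1) - ln \<epsilon>" by (simp only:)
  have 2: "ln (1 / \<epsilon>) = - ln \<epsilon>" using assms by (simp add: ln_div)
  have "psi \<epsilon> \<epsilon> = (\<epsilon> - 1) * ln (\<epsilon> - 1) - \<epsilon> * ln \<epsilon>" by (simp add: psi_def)
  thus ?thesis unfolding 1 2 by (simp add: algebra_simps)
qed

text \<open>In the strip \<open>s\<close> and \<open>1 - s\<close> have arguments below \<pi>/2 in
  modulus, so the principal logarithms add without a jump.\<close>

lemma Ln_inverse_minus_1:
  assumes "s \<in> strip"
  shows "Ln (1 / s) = - Ln s" "Ln (1 / s - 1) = Ln (1 - s) - Ln s"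
proof -
  have s: "s \<noteq> 0" "1 - s \<noteq> 0" "0 < Re s" "0 < Re (1 - s)" using assms by (auto simp: strip_def)
  show 1: "Ln (1 / s) = - Ln s"
    using Ln_inverse[OF strip_nonpos_Reals(1)[OF assms]] by (simp add: inverse_eq_divide)
  have "\<bar>Im (Ln s)\<bar> < pi / 2" "\<bar>Im (Ln (1 - s))\<bar> < pi / 2"
    using s Re_Ln_pos_lt by auto
  hence "Ln ((1 - s) * (1 / s)) = Ln (1 - s) + Ln (1 / s)"
    using s by (intro Ln_times_simple) (auto simp: 1)
  moreover have "(1 - s) * (1 / s) = 1 / s - 1" using s by (simp add: field_simps)
  ultimately show "Ln (1 / s - 1) = Ln (1 - s) - Ln s" by (simp add: 1)
qed

abbreviation beta_pole :: "real \<Rightarrow> real \<Rightarrow> complex \<Rightarrow> complex \<Rightarrow> real \<Rightarrow> complex \<Rightarrow> complex" where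
  "beta_pole \<epsilon> x a c L s \<equiv> bfun (c + of_real L - 1) (1 + a - c + of_real ((\<epsilon> - 1) * L)) s / (s - of_real x)"

text \<open>Under \<open>t = 1 / s\<close> the phase becomes
  \<open>Ln s + (\<epsilon> - 1) * Ln (1 - s)\<close>, and the identity is a comparison of exponents
  linear in \<open>Ln s\<close> and \<open>Ln (1 - s)\<close>.\<close>

lemma amp_exp_psi:
  assumes s: "s \<in> strip"
  shows "amp a c (1 / s) * exp (- of_real L * psi \<epsilon> (1 / s)) =
    s * bfun (c + of_real L - 1) (1 + a - c + of_real ((\<epsilon> - 1) * L)) s"
proof -
  have s0: "s \<noteq> 0" "1 - s \<noteq> 0" "1 / s \<noteq> 0" "1 / s - 1 \<noteq> 0" using s by (auto simp: strip_def)
  note ln = Ln_inverse_minus_1[OF s]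
  define p q where "p = Ln s" and "q = Ln (1 - s)"
  have sp: "exp p = s" using s0 by (simp add: p_def)
  have B: "bfun (c + of_real L - 1) (1 + a - c + of_real ((\<epsilon> - 1) * L)) s =
     exp (- (c + of_real L - 1) * p + - (1 + a - c + of_real ((\<epsilon> - 1) * L)) * q)"
    unfolding bfun_def powr_def p_def[symmetric] q_def[symmetric] by (simp only: exp_add s0 if_False)
  have A: "amp a c (1 / s) = exp ((a - 1) * - p + (c - a - 1) * (q - p))"
    unfolding amp_def powr_def ln p_def[symmetric] q_def[symmetric]
    by (simp only: exp_add s0 if_False)
  have P: "psi \<epsilon> (1 / s) = of_real (\<epsilon> - 1) * q + p"
    unfolding psi_def ln p_def[symmetric] q_def[symmetric] by (simp add: algebra_simps)
  have "((a - 1) * - p + (c - a - 1) * (q - p)) + - of_real L * (of_real (\<epsilon> - 1) * q + p)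
     = p + (- (c + of_real L - 1) * p + - (1 + a - c + of_real ((\<epsilon> - 1) * L)) * q)"
    by (simp add: algebra_simps)
  thus ?thesis unfolding A B P exp_add[symmetric] using sp by (simp only: exp_add)
qed

text \<open>The factor \<open>1 / s^2\<close> is the Jacobian of \<open>t = 1 / s\<close>. Together
  with \<open>- 1 / x\<close> it turns \<open>1 / (t - 1 / x)\<close> into
  \<open>1 / (s * (s - x))\<close>, whose extra \<open>1 / s\<close> cancels the \<open>s\<close> in
  \<open>amp_exp_psi\<close>.\<close>

lemma beta_pole_eint:
  assumes \<epsilon>: "\<epsilon> > 1" and x: "x \<noteq> 0" and s: "s \<in> strip" "s \<noteq> of_real x"
  shows "beta_pole \<epsilon> x a c L s = of_real (exp (- L * psi \<epsilon> \<epsilon>)) * (- of_real (1 / x) * ((1 / s)\<^sup>2 * efun \<epsilon> (1 / x) a c L (1 / s)))"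
proof -
  have s0: "s \<noteq> 0" "1 - s \<noteq> 0" "1 / s \<noteq> 0" "1 / s - 1 \<noteq> 0" using s by (auto simp: strip_def)
  have E: "of_real (exp (- L * psi \<epsilon> \<epsilon>)) * (amp a c (1 / s) * exp (- of_real L * psid \<epsilon> (1 / s)))
     = s * bfun (c + of_real L - 1) (1 + a - c + of_real ((\<epsilon> - 1) * L)) s"
  proof -
    have "of_real (exp (- L * psi \<epsilon> \<epsilon>)) * exp (- of_real L * psid \<epsilon> (1 / s)) = exp (- of_real L * psi \<epsilon> (1 / s))"
      unfolding exp_of_real[symmetric] exp_add[symmetric] psid_def psi_of_real[OF \<epsilon>] by (simp add: algebra_simps)
    thus ?thesis unfolding amp_exp_psi[OF s(1), symmetric] by (metis mult.left_commute)
  qed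
  have "- of_real (1 / x) * (1 / s)\<^sup>2 / (1 / s - of_real (1 / x)) = 1 / (s * (s - of_real x))"
  proof -
    have sx: "of_real x - s \<noteq> 0" "s - of_real x \<noteq> 0" "complex_of_real x \<noteq> 0" using s(2) x by auto
    have "1 / s - of_real (1 / x) = (of_real x - s) / (s * of_real x)"
      using s0 sx by (simp add: divide_simps)
    hence "- of_real (1 / x) * (1 / s)\<^sup>2 / (1 / s - of_real (1 / x)) = - 1 / (s * (of_real x - s))"
      using s0 sx by (simp add: power2_eq_square)
    also have "\<dots> = 1 / (s * (s - of_real x))"
      using s0 sx by (simp add: divide_simps)
    finally show ?thesis .
  qed
  note cancel = this
  have gen: "W * (m * (u * (Y * Z / v))) = (W * (Y * Z)) * (m * u / v)" for W m u v Y Z :: complex by simp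
  have "of_real (exp (- L * psi \<epsilon> \<epsilon>)) * (- of_real (1 / x) * ((1 / s)\<^sup>2 * efun \<epsilon> (1 / x) a c L (1 / s)))
    = (of_real (exp (- L * psi \<epsilon> \<epsilon>)) * (amp a c (1 / s) * exp (- of_real L * psid \<epsilon> (1 / s)))) * (1 / (s * (s - of_real x)))"
    unfolding efun_def gen cancel ..
  thus ?thesis unfolding E using s0 by simp
qed

text \<open>Passing from \<open>L0\<close> to \<open>L\<close> multiplies the modulus by a power of
  \<open>|s| * |1 - s| powr (\<epsilon> - 1)\<close> with exponent \<open>L0 - L\<close>. On the
  line \<open>|1 - s|\<close> is at least its saddle value, and for \<open>|y| >= \<delta>\<close>
  the logarithm of \<open>|s|\<close> exceeds its saddle value by at least \<theta>. All dependence
  on \<open>L\<close> thus leaves the integral, with the integrand at the fixed \<open>L0\<close> as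
  majorant.\<close>

lemma norm_beta_pole_tail:
  assumes \<epsilon>: "\<epsilon> > 1" and \<delta>: "\<delta> > 0"
  defines "\<theta> \<equiv> ln (sqrt ((1 / \<epsilon>)\<^sup>2 + \<delta>\<^sup>2)) - ln (1 / \<epsilon>)"
  assumes y: "\<delta> \<le> \<bar>y\<bar>" and L: "L0 \<le> L"
  shows "norm (beta_pole \<epsilon> x a c L (Complex (1 / \<epsilon>) y)) \<le>
    exp (- (L - L0) * (psi \<epsilon> \<epsilon> + \<theta>)) * norm (beta_pole \<epsilon> x a c L0 (Complex (1 / \<epsilon>) y))"
proof -
  define s where "s = Complex (1 / \<epsilon>) y"
  have s: "s \<in> strip" using \<epsilon> by (simp add: s_def)
  have s0: "s \<noteq> 0" "1 - s \<noteq> 0" using s by (auto simp: strip_def)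
  have shift: "w powr (- (u + of_real v)) = w powr (- u) * exp (- of_real v * Ln w)" if "w \<noteq> 0" for w u and v :: real
    using that by (simp add: powr_def exp_add[symmetric] algebra_simps)
  define D where "D = L - L0"
  have e: "c + of_real L - 1 = (c + of_real L0 - 1) + of_real D"
    "1 + a - c + of_real ((\<epsilon> - 1) * L) = (1 + a - c + of_real ((\<epsilon> - 1) * L0)) + of_real ((\<epsilon> - 1) * D)"
    by (simp_all add: D_def algebra_simps)
  have shifted: "beta_pole \<epsilon> x a c L s = beta_pole \<epsilon> x a c L0 s * (exp (- of_real D * Ln s) * exp (- of_real ((\<epsilon> - 1) * D) * Ln (1 - s)))"
    unfolding e bfun_def shift[OF s0(1)] shift[OF s0(2)] by (simp add: mult_ac)
  have "norm (beta_pole \<epsilon> x a c L s) = norm (beta_pole \<epsilon> x a c L0 s) * exp (- D * (ln (norm s) + (\<epsilon> - 1) * ln (norm (1 - s))))"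
  proof -
    have n: "norm (exp (- of_real v * Ln w)) = exp (- v * ln (norm w))" if "w \<noteq> 0" for w and v :: real
      using that by (simp add: norm_exp_eq_Re)
    have "exp (- D * ln (norm s)) * exp (- ((\<epsilon> - 1) * D) * ln (norm (1 - s))) = exp (- D * (ln (norm s) + (\<epsilon> - 1) * ln (norm (1 - s))))"
      unfolding exp_add[symmetric] by (simp add: algebra_simps)
    thus ?thesis unfolding shifted norm_mult n[OF s0(1)] n[OF s0(2)] by simp
  qed
  also have "\<dots> \<le> norm (beta_pole \<epsilon> x a c L0 s) * exp (- D * (psi \<epsilon> \<epsilon> + \<theta>))"
  proof -
    have "\<delta>\<^sup>2 \<le> y\<^sup>2" using y \<delta> by (simp add: abs_le_square_iff[symmetric])
    hence le: "sqrt ((1 / \<epsilon>)\<^sup>2 + \<delta>\<^sup>2) \<le> norm s" by (simp add: s_def cmod_def)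
    have pos: "sqrt ((1 / \<epsilon>)\<^sup>2 + \<delta>\<^sup>2) > 0" using \<delta> by (simp add: add_nonneg_pos)
    have "norm s > 0" using s0 by simp
    from ln_le_cancel_iff[THEN iffD2, OF pos this le]
    have 1: "ln (sqrt ((1 / \<epsilon>)\<^sup>2 + \<delta>\<^sup>2)) \<le> ln (norm s)" .
    have le: "1 - 1 / \<epsilon> \<le> norm (1 - s)" using complex_Re_le_cmod[of "1 - s"] by (simp add: s_def)
    have pos: "1 - 1 / \<epsilon> > 0" using \<epsilon> by simp
    have "norm (1 - s) > 0" using s0 by simp
    from ln_le_cancel_iff[THEN iffD2, OF pos this le]
    have "ln (1 - 1 / \<epsilon>) \<le> ln (norm (1 - s))" .
    hence "(\<epsilon> - 1) * ln (1 - 1 / \<epsilon>) \<le> (\<epsilon> - 1) * ln (norm (1 - s))" using \<epsilon> by (intro mult_left_mono) auto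
    with 1 have "psi \<epsilon> \<epsilon> + \<theta> \<le> ln (norm s) + (\<epsilon> - 1) * ln (norm (1 - s))"
      unfolding psi_saddle[OF \<epsilon>] \<theta>_def by linarith
    hence "D * (psi \<epsilon> \<epsilon> + \<theta>) \<le> D * (ln (norm s) + (\<epsilon> - 1) * ln (norm (1 - s)))"
      using L by (intro mult_left_mono) (auto simp: D_def)
    thus ?thesis by (intro mult_left_mono) auto
  qed
  finally show ?thesis by (simp add: s_def D_def mult.commute)
qed

lemma vline_beta_pole_tail:
  assumes \<epsilon>: "\<epsilon> > 1" and \<delta>: "\<delta> > 0" and x: "x \<noteq> 1 / \<epsilon>"
  obtains B \<theta> L0 where "\<theta> > 0" "\<And>L. L \<ge> L0 \<Longrightarrow>
    norm (of_real (exp (L * psi \<epsilon> \<epsilon>)) * vline (1 / \<epsilon>) (beta_pole \<epsilon> x a c L) -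
      of_real (exp (L * psi \<epsilon> \<epsilon>)) * integral {-\<delta>..\<delta>} (\<lambda>y. beta_pole \<epsilon> x a c L (Complex (1 / \<epsilon>) y))) \<le> B * exp (- L * \<theta>)"
proof -
  define \<theta> where "\<theta> = ln (sqrt ((1 / \<epsilon>)\<^sup>2 + \<delta>\<^sup>2)) - ln (1 / \<epsilon>)"
  have "sqrt ((1 / \<epsilon>)\<^sup>2) < sqrt ((1 / \<epsilon>)\<^sup>2 + \<delta>\<^sup>2)" using \<delta> by (intro real_sqrt_less_mono) simp
  hence "1 / \<epsilon> < sqrt ((1 / \<epsilon>)\<^sup>2 + \<delta>\<^sup>2)" using \<epsilon> by simp
  moreover have "0 < 1 / \<epsilon>" using \<epsilon> by simp
  ultimately have "ln (1 / \<epsilon>) < ln (sqrt ((1 / \<epsilon>)\<^sup>2 + \<delta>\<^sup>2))"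
    using ln_less_cancel_iff order.strict_trans by blast
  hence \<theta>: "\<theta> > 0" by (simp add: \<theta>_def)
  \<comment> \<open>From here on both beta parameters have real part at least 1, so the integrand is
    integrable.\<close>
  define L0 where "L0 = max 0 (max (2 - Re c) ((Re c - Re a) / (\<epsilon> - 1)))"
  have L0: "Re (c + of_real L - 1) \<ge> 1" "Re (1 + a - c + of_real ((\<epsilon> - 1) * L)) \<ge> 1" if "L \<ge> L0" for L
  proof -
    have "2 - Re c \<le> L" "(Re c - Re a) / (\<epsilon> - 1) \<le> L" using that by (auto simp: L0_def)
    thus "Re (c + of_real L - 1) \<ge> 1" "Re (1 + a - c + of_real ((\<epsilon> - 1) * L)) \<ge> 1"
      using \<epsilon> by (auto simp: field_simps)
  qed
  let ?g = "\<lambda>L y. beta_pole \<epsilon> x a c L (Complex (1 / \<epsilon>) y)"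
  have ig: "integrable lborel (?g L)" if "L \<ge> L0" for L
    using L0[OF that] \<epsilon> x by (intro integrable_bfun_pole) auto
  define T where "T = (LINT y|lborel. norm (?g L0 y))"
  show ?thesis
  proof (rule that[OF \<theta>, of L0 "exp (L0 * (psi \<epsilon> \<epsilon> + \<theta>)) * T"])
    fix L assume L: "L \<ge> L0"
    let ?I = "{-\<delta>..\<delta>}"
    have si: "set_integrable lborel ?I (?g L)"
      unfolding set_integrable_def by (rule integrable_mult_indicator) (use ig[OF L] in auto)
    have eq: "vline (1 / \<epsilon>) (beta_pole \<epsilon> x a c L) - integral ?I (?g L) = (LINT y|lborel. ?g L y - indicator ?I y *\<^sub>R ?g L y)"
      using set_borel_integral_eq_integral(2)[OF si] ig[OF L] si
      by (simp add: vline_def set_lebesgue_integral_def set_integrable_def Bochner_Integration.integral_diff)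
    have "norm (vline (1 / \<epsilon>) (beta_pole \<epsilon> x a c L) - integral ?I (?g L)) \<le> (LINT y|lborel. norm (?g L y - indicator ?I y *\<^sub>R ?g L y))"
      unfolding eq by (rule integral_norm_bound)
    also have "\<dots> \<le> (LINT y|lborel. exp (- (L - L0) * (psi \<epsilon> \<epsilon> + \<theta>)) * norm (?g L0 y))"
    proof (rule integral_mono)
      show "integrable lborel (\<lambda>y. norm (?g L y - indicator ?I y *\<^sub>R ?g L y))"
        using ig[OF L] si unfolding set_integrable_def by (intro integrable_norm Bochner_Integration.integrable_diff)
      show "integrable lborel (\<lambda>y. exp (- (L - L0) * (psi \<epsilon> \<epsilon> + \<theta>)) * norm (?g L0 y))"
        using ig[of L0] by (intro integrable_mult_right integrable_norm) auto
      fix y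
      show "norm (?g L y - indicator ?I y *\<^sub>R ?g L y) \<le> exp (- (L - L0) * (psi \<epsilon> \<epsilon> + \<theta>)) * norm (?g L0 y)"
      proof (cases "y \<in> ?I")
        case False
        hence "\<delta> \<le> \<bar>y\<bar>" by auto
        from norm_beta_pole_tail[OF \<epsilon> \<delta> this L] False show ?thesis by (simp add: \<theta>_def)
      qed simp
    qed
    also have "\<dots> = exp (- (L - L0) * (psi \<epsilon> \<epsilon> + \<theta>)) * T" unfolding T_def by (rule integral_mult_right_zero)
    finally have "exp (L * psi \<epsilon> \<epsilon>) * norm (vline (1 / \<epsilon>) (beta_pole \<epsilon> x a c L) - integral ?I (?g L)) \<le>
        exp (L * psi \<epsilon> \<epsilon>) * (exp (- (L - L0) * (psi \<epsilon> \<epsilon> + \<theta>)) * T)" by (intro mult_left_mono) auto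
    also have "\<dots> = (exp (L0 * (psi \<epsilon> \<epsilon> + \<theta>)) * T) * exp (- L * \<theta>)"
    proof -
      have "exp (L * psi \<epsilon> \<epsilon>) * exp (- (L - L0) * (psi \<epsilon> \<epsilon> + \<theta>)) = exp (L0 * (psi \<epsilon> \<epsilon> + \<theta>)) * exp (- L * \<theta>)"
        unfolding exp_add[symmetric] by (simp add: algebra_simps)
      thus ?thesis by (simp add: mult_ac)
    qed
    finally show "norm (of_real (exp (L * psi \<epsilon> \<epsilon>)) * vline (1 / \<epsilon>) (beta_pole \<epsilon> x a c L) -
      of_real (exp (L * psi \<epsilon> \<epsilon>)) * integral ?I (?g L)) \<le> (exp (L0 * (psi \<epsilon> \<epsilon> + \<theta>)) * T) * exp (- L * \<theta>)"
      by (simp add: right_diff_distrib[symmetric] norm_mult)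
  qed
qed

text \<open>The error has three parts: the tail beyond \<delta>, the deformation of the remaining
  segment to the \<open>u\<close>-path, and the Watson remainder. Relative to the saddle value the
  first two are exponentially small.\<close>

theorem vline_beta_pole_asymp:
  assumes \<epsilon>: "\<epsilon> > 1" and x: "0 < x" "x < 1" "\<epsilon> * x \<noteq> 1"
  shows "(\<lambda>L. of_real (exp (L * psi \<epsilon> \<epsilon>)) * vline (1 / \<epsilon>) (beta_pole \<epsilon> x a c L) -
      \<i> * of_real (1 / x) * (\<Sum>k<N. tcoeff (saddle_fun \<epsilon> (1 / x) a c) (2 * k) * of_real (gterm k L)))
    \<in> O[at_top](\<lambda>L. of_real (L powr (- real N - 1/2)))"
proof -
  have \<alpha>: "1 / x > 1" "1 / x \<noteq> \<epsilon>" and x': "x \<noteq> 1 / \<epsilon>" using x \<epsilon> by (auto simp: field_simps)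
  obtain R r \<delta> B \<eta> where loc: "0 < r" "r < R" "saddle_fun \<epsilon> (1 / x) a c holomorphic_on ball 0 R" "0 < \<delta>" "\<eta> > 0"
    "\<And>L. L \<ge> 0 \<Longrightarrow> norm (integral {-\<delta>..\<delta>} (\<lambda>y. - of_real (1 / x) * ((1 / Complex (1/\<epsilon>) y)\<^sup>2 * efun \<epsilon> (1 / x) a c L (1 / Complex (1/\<epsilon>) y)))
       - \<i> * of_real (1 / x) * integral {-r..r} (\<lambda>u. of_real (exp (- L * u\<^sup>2)) * saddle_fun \<epsilon> (1 / x) a c (of_real u))) \<le> B * exp (- L * \<eta>)"
    by (rule local_contribution[OF \<epsilon> \<alpha>, where a=a and c=c]) (rule that; assumption)
  obtain B' \<theta> L0 where tail: "\<theta> > 0" "\<And>L. L \<ge> L0 \<Longrightarrow>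
    norm (of_real (exp (L * psi \<epsilon> \<epsilon>)) * vline (1 / \<epsilon>) (beta_pole \<epsilon> x a c L) -
      of_real (exp (L * psi \<epsilon> \<epsilon>)) * integral {-\<delta>..\<delta>} (\<lambda>y. beta_pole \<epsilon> x a c L (Complex (1 / \<epsilon>) y))) \<le> B' * exp (- L * \<theta>)"
    by (rule vline_beta_pole_tail[OF \<epsilon> loc(4) x', where a=a and c=c]) (rule that; assumption)
  let ?p = "\<lambda>L. complex_of_real (L powr (- real N - 1/2))"
  let ?V = "\<lambda>L. of_real (exp (L * psi \<epsilon> \<epsilon>)) * vline (1 / \<epsilon>) (beta_pole \<epsilon> x a c L)"
  let ?I = "\<lambda>L. integral {-\<delta>..\<delta>} (\<lambda>y. - of_real (1 / x) * ((1 / Complex (1/\<epsilon>) y)\<^sup>2 * efun \<epsilon> (1 / x) a c L (1 / Complex (1/\<epsilon>) y)))"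
  let ?W = "\<lambda>L. integral {-r..r} (\<lambda>u. of_real (exp (- L * u\<^sup>2)) * saddle_fun \<epsilon> (1 / x) a c (of_real u))"
  have I: "of_real (exp (L * psi \<epsilon> \<epsilon>)) * integral {-\<delta>..\<delta>} (\<lambda>y. beta_pole \<epsilon> x a c L (Complex (1 / \<epsilon>) y)) = ?I L" for L
  proof -
    have "beta_pole \<epsilon> x a c L (Complex (1 / \<epsilon>) y) = of_real (exp (- L * psi \<epsilon> \<epsilon>)) * (- of_real (1 / x) * ((1 / Complex (1/\<epsilon>) y)\<^sup>2 * efun \<epsilon> (1 / x) a c L (1 / Complex (1/\<epsilon>) y)))" for y
      using \<epsilon> x x' by (intro beta_pole_eint) (auto simp: complex_eq_iff)
    hence "integral {-\<delta>..\<delta>} (\<lambda>y. beta_pole \<epsilon> x a c L (Complex (1 / \<epsilon>) y)) = of_real (exp (- L * psi \<epsilon> \<epsilon>)) * ?I L"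
      by (simp only: Henstock_Kurzweil_Integration.integral_mult_right)
    moreover have "complex_of_real (exp (L * psi \<epsilon> \<epsilon>)) * of_real (exp (- L * psi \<epsilon> \<epsilon>)) = 1"
      unfolding of_real_mult[symmetric] exp_add[symmetric] by simp
    ultimately show ?thesis by (simp only: mult.assoc[symmetric] mult_1)
  qed
  have ebig: "(\<lambda>L. complex_of_real (exp (- L * \<eta>))) \<in> O[at_top](?p)" if "\<eta> > 0" for \<eta>
    using that by (intro bigo_of_real exp_bigo_powr)
  have 1: "(\<lambda>L. ?V L - ?I L) \<in> O[at_top](?p)"
  proof (rule landau_o.big_trans[OF _ ebig[OF tail(1)]], rule bigoI)
    show "\<forall>\<^sub>F L in at_top. norm (?V L - ?I L) \<le> B' * norm (complex_of_real (exp (- L * \<theta>)))"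
      using eventually_ge_at_top[of L0]
    proof eventually_elim
      case (elim L)
      show ?case using tail(2)[OF elim] unfolding I by simp
    qed
  qed
  have 2: "(\<lambda>L. ?I L - \<i> * of_real (1 / x) * ?W L) \<in> O[at_top](?p)"
  proof (rule landau_o.big_trans[OF _ ebig[OF loc(5)]], rule bigoI)
    show "\<forall>\<^sub>F L in at_top. norm (?I L - \<i> * of_real (1 / x) * ?W L) \<le> B * norm (complex_of_real (exp (- L * \<eta>)))"
      using eventually_ge_at_top[of 0]
    proof eventually_elim
      case (elim L)
      show ?case using loc(6)[OF elim] by simp
    qed
  qed
  have 3: "(\<lambda>L. (\<i> * of_real (1 / x)) * (?W L - (\<Sum>k<N. tcoeff (saddle_fun \<epsilon> (1 / x) a c) (2 * k) * of_real (gterm k L)))) \<in> O[at_top](?p)"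
    by (intro bigo_cmult Watson_symmetric[OF loc(3,1,2)])
  from sum_in_bigo(1)[OF 1 sum_in_bigo(1)[OF 2 3]] show ?thesis
    by (simp only: right_diff_distrib diff_add_cancel) (simp add: algebra_simps)
qed

section \<open>The expansion\<close>

lemma psi_less_saddle:
  fixes t :: real
  assumes "\<epsilon> > 1" "t > 1" "t \<noteq> \<epsilon>"
  shows "psi \<epsilon> t < psi \<epsilon> \<epsilon>"
proof -
  have d: "(psi \<epsilon> has_real_derivative (\<epsilon> - w) / (w * (w - 1))) (at w)" if "w > 1" for w
    using that by (rule psi_DERIV_real)
  have cont: "continuous_on {u..v} (psi \<epsilon> :: real \<Rightarrow> real)" if "u > 1" for u v
  proof (intro continuous_at_imp_continuous_on ballI)
    fix w assume "w \<in> {u..v}"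
    hence "w > 1" using that by simp
    thus "isCont (psi \<epsilon>) w" by (rule DERIV_isCont[OF d])
  qed
  show ?thesis
  proof (cases "t < \<epsilon>")
    case True
    show ?thesis
    proof (rule DERIV_pos_imp_increasing_open[OF True _ cont[OF assms(2)]])
      fix w assume "t < w" "w < \<epsilon>"
      hence w: "w > 1" "\<epsilon> - w > 0" using assms by linarith+
      hence "(\<epsilon> - w) / (w * (w - 1)) > 0" by (intro divide_pos_pos mult_pos_pos) auto
      thus "\<exists>y. DERIV (psi \<epsilon>) w :> y \<and> 0 < y" using d[OF w(1)] by blast
    qed
  next
    case False
    hence lt: "\<epsilon> < t" using assms by auto
    show ?thesis
    proof (rule DERIV_neg_imp_decreasing_open[OF lt _ cont[OF assms(1)]])
      fix w assume "\<epsilon> < w" "w < t"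
      hence w: "w > 1" "\<epsilon> - w < 0" using assms by linarith+
      hence "(\<epsilon> - w) / (w * (w - 1)) < 0" by (intro divide_neg_pos mult_pos_pos) auto
      thus "\<exists>y. DERIV (psi \<epsilon>) w :> y \<and> y < 0" using d[OF w(1)] by blast
    qed
  qed
qed

lemma pdist_props:
  assumes "\<epsilon> > 1" "\<alpha> > 1" "\<alpha> \<noteq> \<epsilon>"
  shows "pdist \<epsilon> \<alpha> > 0" "(pdist \<epsilon> \<alpha>)\<^sup>2 = psi \<epsilon> \<epsilon> - psi \<epsilon> \<alpha>"
  using psi_less_saddle[OF assms] by (simp_all add: pdist_def)

lemma higher_deriv_simple_pole:
  fixes p :: complex
  shows "u \<noteq> p \<Longrightarrow> (deriv ^^ n) (\<lambda>u. A / (u - p)) u = A * (-1) ^ n * fact n / (u - p) ^ Suc n"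
proof (induction n arbitrary: u)
  case (Suc n)
  have "deriv ((deriv ^^ n) (\<lambda>u. A / (u - p))) u = deriv (\<lambda>u. A * (-1) ^ n * fact n / (u - p) ^ Suc n) u"
  proof (rule deriv_cong_ev[OF _ refl])
    have "\<forall>\<^sub>F v in nhds u. v \<in> - {p}" using Suc.prems by (intro eventually_nhds_in_open) auto
    thus "\<forall>\<^sub>F v in nhds u. (deriv ^^ n) (\<lambda>u. A / (u - p)) v = A * (-1) ^ n * fact n / (v - p) ^ Suc n"
      by eventually_elim (simp add: Suc.IH)
  qed
  also have "\<dots> = A * (-1) ^ Suc n * fact (Suc n) / (u - p) ^ Suc (Suc n)"
  proof (rule DERIV_imp_deriv)
    define w where "w = u - p"
    have w: "w \<noteq> 0" using Suc.prems by (simp add: w_def)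
    have "((\<lambda>u. (u - p) ^ Suc n) has_field_derivative of_nat (Suc n) * w ^ n) (at u)"
      using DERIV_power_Suc[OF DERIV_diff[OF DERIV_ident DERIV_const[of p]], of n] by (simp add: w_def)
    hence "((\<lambda>u. A * (-1) ^ n * fact n / (u - p) ^ Suc n) has_field_derivative
       (0 * (u - p) ^ Suc n - A * (-1) ^ n * fact n * (of_nat (Suc n) * w ^ n)) / ((u - p) ^ Suc n * (u - p) ^ Suc n)) (at u)"
      using w by (intro DERIV_divide DERIV_const) (auto simp: w_def)
    also have "(0 * (u - p) ^ Suc n - A * (-1) ^ n * fact n * (of_nat (Suc n) * w ^ n)) / ((u - p) ^ Suc n * (u - p) ^ Suc n)
      = A * (-1) ^ Suc n * fact (Suc n) / (u - p) ^ Suc (Suc n)"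
    proof -
      have "w ^ Suc n * w ^ Suc n = w ^ Suc (Suc n) * w ^ n" by (simp add: power_add[symmetric])
      moreover have "0 * w ^ Suc n - A * (-1) ^ n * fact n * (of_nat (Suc n) * w ^ n) = A * (-1) ^ Suc n * fact (Suc n) * w ^ n"
        by (simp add: mult_ac)
      moreover have "X * w ^ n / (Y * w ^ n) = X / Y" for X Y using w by simp
      ultimately show ?thesis unfolding w_def[symmetric] by (simp only:)
    qed
    finally show "((\<lambda>u. A * (-1) ^ n * fact n / (u - p) ^ Suc n) has_field_derivative
      A * (-1) ^ Suc n * fact (Suc n) / (u - p) ^ Suc (Suc n)) (at u)" .
  qed
  finally show ?case by simp
qed simp

text \<open>Near 0 the subtracted pole is a geometric series in \<open>u / pole_u\<close>; removing
  it adds one reciprocal power of \<open>pole_u\<close> to each Taylor coefficient.\<close>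

lemma dcoeff_eq:
  assumes \<epsilon>: "\<epsilon> > 1" and \<alpha>: "\<alpha> > 1" "\<alpha> \<noteq> \<epsilon>"
  shows "dcoeff \<epsilon> \<alpha> a c m = \<i> * (tcoeff (saddle_fun \<epsilon> \<alpha> a c) m + amp a c (of_real \<alpha>) / pole_u \<epsilon> \<alpha> ^ Suc m)"
proof -
  let ?p = "pole_u \<epsilon> \<alpha>" and ?A = "amp a c (of_real \<alpha>)"
  have p: "?p \<noteq> 0" using pdist_props[OF assms] by (auto simp: pole_u_def)
  have "open ({z. Re z > 1} - {complex_of_real \<alpha>})" by (intro open_Diff open_halfspace_Re_gt) auto
  moreover have "complex_of_real \<epsilon> \<in> {z. Re z > 1} - {complex_of_real \<alpha>}" using \<epsilon> \<alpha> by auto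
  ultimately obtain R where R: "R > 0" "saddle_param \<epsilon> holomorphic_on ball 0 R"
    "\<And>u. u \<in> ball 0 R \<Longrightarrow> saddle_param \<epsilon> u \<in> {z. Re z > 1} - {complex_of_real \<alpha>}"
    using saddle_param_ball[OF \<epsilon>] by metis
  have K: "saddle_fun \<epsilon> \<alpha> a c holomorphic_on ball 0 R" by (rule saddle_fun_holomorphic[OF R(2,3)])
  define S where "S = ball 0 R - {?p}"
  have S: "open S" "0 \<in> S" using R p by (auto simp: S_def)
  have "(deriv ^^ m) (\<lambda>u. saddle_fun \<epsilon> \<alpha> a c u - ?A / (u - ?p)) 0 = (deriv ^^ m) (saddle_fun \<epsilon> \<alpha> a c) 0 - (deriv ^^ m) (\<lambda>u. ?A / (u - ?p)) 0"
  proof (rule higher_deriv_diff[OF _ _ S])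
    show "saddle_fun \<epsilon> \<alpha> a c holomorphic_on S" by (rule holomorphic_on_subset[OF K]) (auto simp: S_def)
    show "(\<lambda>u. ?A / (u - ?p)) holomorphic_on S" by (intro holomorphic_intros) (auto simp: S_def)
  qed
  also have "(\<lambda>u. saddle_fun \<epsilon> \<alpha> a c u - ?A / (u - ?p)) = hfun \<epsilon> \<alpha> a c"
    by (simp add: hfun_def saddle_fun_def fun_eq_iff)
  also have "(deriv ^^ m) (\<lambda>u. ?A / (u - ?p)) 0 = - (fact m * (?A / ?p ^ Suc m))"
  proof -
    have "(- ?p) ^ Suc m = - ((-1) ^ m * ?p ^ Suc m)"
      using power_minus[of ?p "Suc m"] by simp
    thus ?thesis using p by (subst higher_deriv_simple_pole) auto
  qed
  finally show ?thesis
    by (simp add: dcoeff_def fps_expansion_def tcoeff_def add_divide_distrib)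
qed

lemma powr_half_odd:
  assumes "L > 0"
  shows "(sqrt L * p) ^ (2 * k + 1) = L powr (real k + 1/2) * p ^ (2 * k + 1)"
proof -
  have "sqrt L ^ (2 * k + 1) = (sqrt L ^ 2) ^ k * sqrt L" by (simp only: power_add power_mult power_one_right)
  also have "\<dots> = L powr (real k + 1/2)"
    using assms by (simp add: powr_add powr_realpow powr_half_sqrt)
  finally have "sqrt L ^ (2 * k + 1) = L powr (real k + 1/2)" .
  thus ?thesis by (simp only: power_mult_distrib)
qed

text \<open>The factor \<open>exp (L * p^2)\<close> measures the \<open>erfc\<close> term on the
  scale of the saddle, since \<open>p^2\<close> is
  \<open>psi \<epsilon> \<epsilon> - psi \<epsilon> \<alpha>\<close>. It cancels the Gaussian in
  every term and leaves half-integer powers of \<open>L\<close>.\<close>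

lemma erfc_scaled_bigo:
  assumes p: "p > 0"
  shows "(\<lambda>L. exp (L * p\<^sup>2) * erfc (sqrt L * p) - (\<Sum>k<N. (-1) ^ k * gterm k L / p ^ (2 * k + 1)) / pi) \<in> O[at_top](\<lambda>L. L powr (- real N - 1/2))"
proof (rule bigoI)
  let ?c = "\<bar>erfc_cf N\<bar> / pi / p ^ (2 * N + 1)"
  show "\<forall>\<^sub>F L in at_top. norm (exp (L * p\<^sup>2) * erfc (sqrt L * p) - (\<Sum>k<N. (-1) ^ k * gterm k L / p ^ (2 * k + 1)) / pi) \<le> ?c * norm (L powr (- real N - 1/2))"
    using eventually_gt_at_top[of 0]
  proof eventually_elim
    case (elim L)
    have g: "exp (L * p\<^sup>2) * gauss (sqrt L * p) = 1"
      using elim by (simp add: power_mult_distrib exp_add[symmetric])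
    have t: "exp (L * p\<^sup>2) * (e * (gauss (sqrt L * p) / (sqrt L * p) ^ (2 * k + 1))) = e / L powr (real k + 1/2) / p ^ (2 * k + 1)" for e k
    proof -
      have "exp (L * p\<^sup>2) * (e * (gauss (sqrt L * p) / (sqrt L * p) ^ (2 * k + 1))) = (exp (L * p\<^sup>2) * gauss (sqrt L * p)) * e / (sqrt L * p) ^ (2 * k + 1)"
        by simp
      thus ?thesis unfolding g powr_half_odd[OF elim] by simp
    qed
    define Y Z where "Y = erfc (sqrt L * p)" and "Z = (\<Sum>k<N. erfc_cf k * (gauss (sqrt L * p) / (sqrt L * p) ^ (2 * k + 1))) / pi"
    have s: "exp (L * p\<^sup>2) * Z = (\<Sum>k<N. (-1) ^ k * gterm k L / p ^ (2 * k + 1)) / pi"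
    proof -
      have "exp (L * p\<^sup>2) * (\<Sum>k<N. erfc_cf k * (gauss (sqrt L * p) / (sqrt L * p) ^ (2 * k + 1))) = (\<Sum>k<N. (-1) ^ k * gterm k L / p ^ (2 * k + 1))"
        unfolding sum_distrib_left t by (simp add: erfc_cf_def gterm_def)
      thus ?thesis unfolding Z_def times_divide_eq_right by (rule arg_cong)
    qed
    have "\<bar>Y - Z\<bar> \<le> \<bar>erfc_cf N\<bar> / pi * (gauss (sqrt L * p) / (sqrt L * p) ^ (2 * N + 1))"
      unfolding Y_def Z_def using elim p by (intro erfc_expansion_bound) auto
    hence "exp (L * p\<^sup>2) * \<bar>Y - Z\<bar> \<le> exp (L * p\<^sup>2) * (\<bar>erfc_cf N\<bar> / pi * (gauss (sqrt L * p) / (sqrt L * p) ^ (2 * N + 1)))"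
      by (intro mult_left_mono) auto
    also have "\<dots> = ?c * L powr (- real N - 1/2)"
    proof -
      have e: "- real N - 1/2 = - (real N + 1/2)" by simp
      have "u / v / w = u / w * inverse v" for u v w :: real by (simp add: divide_inverse mult_ac)
      thus ?thesis unfolding t e powr_minus by blast
    qed
    finally have "exp (L * p\<^sup>2) * \<bar>Y - Z\<bar> \<le> ?c * L powr (- real N - 1/2)" .
    moreover have "\<bar>exp (L * p\<^sup>2) * Y - exp (L * p\<^sup>2) * Z\<bar> = exp (L * p\<^sup>2) * \<bar>Y - Z\<bar>"
      unfolding right_diff_distrib[symmetric] abs_mult by simp
    ultimately have "\<bar>exp (L * p\<^sup>2) * Y - exp (L * p\<^sup>2) * Z\<bar> \<le> ?c * L powr (- real N - 1/2)" by simp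
    thus ?case unfolding s Y_def by simp
  qed
qed

theorem theorem1:
  fixes \<epsilon> x \<alpha> :: real and a c :: complex and N :: nat
  assumes "\<epsilon> > 1" and "0 < x" and "x < 1" and "\<epsilon> * x \<noteq> 1"
    and "\<alpha> = 1 / x"
  shows "\<exists>E :: real \<Rightarrow> complex.
    E \<in> O[at_top](\<lambda>L. of_real (exp (- L * psi \<epsilon> \<epsilon>) * L powr (- real N - 1 / 2))) \<and>
    (\<forall>\<^sub>F L in at_top.
      hyp2F1 (a + of_real (\<epsilon> * L)) 1 (c + of_real L) (of_real x) =
        Gfac \<epsilon> a c L / (2 * of_real x) *
        (of_real (exp (- L * psi \<epsilon> \<alpha>)) * amp a c (of_real \<alpha>)
           * of_real (erfc ((if \<alpha> > \<epsilon> then 1 else - 1) * sqrt L * pdist \<epsilon> \<alpha>))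
         + of_real (exp (- L * psi \<epsilon> \<epsilon>)) / of_real pi
           * (\<Sum>k<N. dcoeff \<epsilon> \<alpha> a c (2 * k)
                * of_real (Gamma (real k + 1 / 2) / L powr (real k + 1 / 2)))
         + E L))"
proof -
  have \<alpha>: "\<alpha> > 1" "\<alpha> \<noteq> \<epsilon>" and x': "1 / \<epsilon> \<noteq> x" and xr: "complex_of_real x \<noteq> 0"
    unfolding assms(5) using assms(1-4) by (auto simp: field_simps)
  have ax: "1 / x = \<alpha>" using assms by simp
  define \<tau> :: real where "\<tau> = (if \<alpha> > \<epsilon> then 1 else - 1)"
  define p where "p = pdist \<epsilon> \<alpha>"
  have p: "p > 0" "p\<^sup>2 = psi \<epsilon> \<epsilon> - psi \<epsilon> \<alpha>" using pdist_props[OF assms(1) \<alpha>] by (simp_all add: p_def)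
  define A where "A = amp a c (of_real \<alpha>)"
  define KS where "KS = (\<lambda>L. \<Sum>k<N. tcoeff (saddle_fun \<epsilon> \<alpha> a c) (2 * k) * of_real (gterm k L))"
  define PS where "PS = (\<lambda>L. \<Sum>k<N. (-1) ^ k * gterm k L / p ^ (2 * k + 1))"
  define V where "V = (\<lambda>L. vline (1 / \<epsilon>) (beta_pole \<epsilon> x a c L))"
  define R1 where "R1 = (\<lambda>L. of_real (exp (L * psi \<epsilon> \<epsilon>)) * V L - \<i> * of_real \<alpha> * KS L)"
  define R2 where "R2 = (\<lambda>L. exp (L * p\<^sup>2) * erfc (sqrt L * p) - PS L / pi)"
  \<comment> \<open>The witness: \<open>R1\<close> is the error of the line integral, rescaled by
    \<open>x / pi\<close> from the normalisation of the representation, and \<open>R2\<close> that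
    of \<open>erfc\<close>. The expansion of \<open>erfc\<close> enters with the opposite sign
    because it is moved into the coefficients \<open>dcoeff\<close>.\<close>
  define E where "E = (\<lambda>L. of_real (exp (- L * psi \<epsilon> \<epsilon>)) * (of_real (x / pi) * R1 L + - (of_real \<tau> * A) * of_real (R2 L)))"
  have R1: "R1 \<in> O[at_top](\<lambda>L. of_real (L powr (- real N - 1/2)))"
    using vline_beta_pole_asymp[OF assms(1-4), of c a N] unfolding R1_def V_def KS_def ax .
  have R2: "(\<lambda>L. complex_of_real (R2 L)) \<in> O[at_top](\<lambda>L. of_real (L powr (- real N - 1/2)))"
    unfolding R2_def PS_def by (rule bigo_of_real[OF erfc_scaled_bigo[OF p(1)]])
  have "E \<in> O[at_top](\<lambda>L. of_real (exp (- L * psi \<epsilon> \<epsilon>)) * of_real (L powr (- real N - 1/2)))"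
    unfolding E_def by (intro landau_o.big.mult landau_o.big_refl sum_in_bigo(1) bigo_cmult R1 R2)
  hence "E \<in> O[at_top](\<lambda>L. of_real (exp (- L * psi \<epsilon> \<epsilon>) * L powr (- real N - 1 / 2)))"
    by simp
  moreover have dsum: "(\<Sum>k<N. dcoeff \<epsilon> \<alpha> a c (2 * k) * of_real (gterm k L)) = \<i> * KS L - of_real \<tau> * A * of_real (PS L)" for L
  proof -
    have "dcoeff \<epsilon> \<alpha> a c (2 * k) * of_real (gterm k L) =
      \<i> * (tcoeff (saddle_fun \<epsilon> \<alpha> a c) (2 * k) * of_real (gterm k L)) - of_real \<tau> * A * of_real ((-1) ^ k * gterm k L / p ^ (2 * k + 1))" for k
    proof -
      \<comment> \<open>Only odd powers of the pole occur here. With \<tau>^2 = 1, the power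
        \<open>2 * k + 1\<close> of \<open>- \<i> * \<tau>\<close> is \<open>(-1) ^ k\<close> times
        itself, which produces the alternating signs of the \<open>erfc\<close> expansion.\<close>
      have pu: "pole_u \<epsilon> \<alpha> = - \<i> * of_real \<tau> * of_real p" by (simp add: pole_u_def \<tau>_def p_def)
      have t2: "\<tau>\<^sup>2 = 1" by (simp add: \<tau>_def)
      have "(- \<i> * complex_of_real \<tau>)\<^sup>2 = - of_real (\<tau>\<^sup>2)" by (simp add: power_mult_distrib)
      hence "(- \<i> * complex_of_real \<tau>)\<^sup>2 = -1" unfolding t2 by simp
      hence "(- \<i> * complex_of_real \<tau>) ^ Suc (2 * k) = (-1) ^ k * (- \<i> * of_real \<tau>)"
        by (simp add: power_mult del: power_mult_distrib)
      hence "pole_u \<epsilon> \<alpha> ^ Suc (2 * k) = (-1) ^ k * (- \<i> * of_real \<tau>) * of_real (p ^ (2 * k + 1))"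
        unfolding pu power_mult_distrib[of "- \<i> * complex_of_real \<tau>"] by simp
      moreover have "\<i> * (A / ((-1) ^ k * (- \<i> * of_real \<tau>) * of_real (p ^ (2 * k + 1)))) = - (of_real \<tau> * A * of_real ((-1) ^ k / p ^ (2 * k + 1)))"
        by (cases "even k") (auto simp: \<tau>_def field_simps)
      ultimately have "dcoeff \<epsilon> \<alpha> a c (2 * k) = \<i> * tcoeff (saddle_fun \<epsilon> \<alpha> a c) (2 * k) - of_real \<tau> * A * of_real ((-1) ^ k / p ^ (2 * k + 1))"
        unfolding dcoeff_eq[OF assms(1) \<alpha>] A_def[symmetric] by (simp only: distrib_left) simp
      moreover have "complex_of_real ((-1) ^ k * gterm k L / p ^ (2 * k + 1)) = of_real ((-1) ^ k / p ^ (2 * k + 1)) * of_real (gterm k L)"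
        by simp
      ultimately show ?thesis by (simp only: left_diff_distrib mult.assoc)
    qed
    thus ?thesis by (simp add: KS_def PS_def sum_subtractf sum_distrib_left)
  qed
  \<comment> \<open>The last three entries secure \<open>Re C >= 2\<close>, \<open>Re Q >= 2\<close>
    and \<open>Re (a + \<epsilon> * L) >= 1\<close>, so the representation holds and the Gamma
    values in \<open>Gfac\<close> do not vanish.\<close>
  define L0 where "L0 = max 1 (max (2 - Re c) (max ((1 + Re c - Re a) / (\<epsilon> - 1)) ((1 - Re a) / \<epsilon>)))"
  have "\<forall>\<^sub>F L in at_top.
      hyp2F1 (a + of_real (\<epsilon> * L)) 1 (c + of_real L) (of_real x) =
        Gfac \<epsilon> a c L / (2 * of_real x) *
        (of_real (exp (- L * psi \<epsilon> \<alpha>)) * A * of_real (erfc (\<tau> * sqrt L * p))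
         + of_real (exp (- L * psi \<epsilon> \<epsilon>)) / of_real pi
           * (\<Sum>k<N. dcoeff \<epsilon> \<alpha> a c (2 * k) * of_real (gterm k L))
         + E L)"
    using eventually_ge_at_top[of L0]
  proof eventually_elim
    case (elim L)
    have L: "L \<ge> 1" "2 - Re c \<le> L" "(1 + Re c - Re a) / (\<epsilon> - 1) \<le> L" "(1 - Re a) / \<epsilon> \<le> L"
      using elim by (auto simp: L0_def)
    define C Q where "C = c + of_real L" and "Q = 1 + a - c + of_real ((\<epsilon> - 1) * L)"
    have CQ: "Re C \<ge> 2" "Re Q \<ge> 2" "Re (C + Q - 1) > 0"
      using L assms(1) by (auto simp: C_def Q_def field_simps)
    have s: "C + Q - 1 = a + of_real (\<epsilon> * L)" by (simp add: C_def Q_def algebra_simps)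
    define F where "F = hyp2F1 (a + of_real (\<epsilon> * L)) 1 C (of_real x)"
    have G: "Gfac \<epsilon> a c L = Gamma C * Gamma Q / Gamma (C + Q - 1)" unfolding Gfac_def s by (simp only: C_def Q_def)
    have G0: "Gfac \<epsilon> a c L \<noteq> 0"
      using CQ unfolding G by (simp add: Gamma_nonzero_Re_pos)
    have rep: "2 * of_real pi * (F / Gfac \<epsilon> a c L) = V L + (if 1 / \<epsilon> < x then 2 * of_real pi * bfun (C - 1) Q (of_real x) else 0)"
      using hyp2F1_vline[OF CQ(1,2) assms(2,3) _ _ x'] assms(1) unfolding G V_def F_def s C_def[symmetric] Q_def[symmetric] by simp
    have lt: "1 / \<epsilon> < x \<longleftrightarrow> \<not> \<alpha> > \<epsilon>"
      unfolding assms(5) using assms(1-4) by (auto simp: field_simps)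
    have W: "of_real x * bfun (C - 1) Q (of_real x) = of_real (exp (- L * psi \<epsilon> \<alpha>)) * A"
    proof -
      have "complex_of_real x \<in> strip" using assms by (simp add: strip_def)
      from amp_exp_psi[OF this, of a c L \<epsilon>]
      have "A * exp (- of_real L * psi \<epsilon> (complex_of_real \<alpha>)) = of_real x * bfun (C - 1) Q (of_real x)"
        by (simp add: A_def C_def Q_def ax[symmetric])
      thus ?thesis unfolding psi_of_real[OF \<alpha>(1)] by (simp add: exp_of_real[symmetric] mult.commute)
    qed
    \<comment> \<open>The factor \<open>1 - \<tau>\<close> is 0 or 2 and encodes the absence or
      presence of the residue without a case distinction.\<close>
    have main: "2 * of_real x * (F / Gfac \<epsilon> a c L) = of_real (x / pi) * V L + of_real (1 - \<tau>) * (of_real (exp (- L * psi \<epsilon> \<alpha>)) * A)"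
    proof -
      have "2 * of_real x * (F / Gfac \<epsilon> a c L) = of_real (x / pi) * (2 * of_real pi * (F / Gfac \<epsilon> a c L))"
        by simp
      also have "\<dots> = of_real (x / pi) * V L + of_real (1 - \<tau>) * (of_real x * bfun (C - 1) Q (of_real x))"
        unfolding rep lt by (simp add: \<tau>_def distrib_left)
      finally show ?thesis unfolding W .
    qed
    \<comment> \<open>The same \<open>1 - \<tau>\<close> appears in the reflection formula, so the
      residue cancels against it for both signs.\<close>
    have erf: "erfc (\<tau> * sqrt L * p) = \<tau> * erfc (sqrt L * p) + (1 - \<tau>)"
      using erfc_minus[of "sqrt L * p"] by (simp add: \<tau>_def)
    have e1: "complex_of_real (exp (- L * psi \<epsilon> \<epsilon>)) * of_real (exp (L * psi \<epsilon> \<epsilon>)) = 1"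
      unfolding of_real_mult[symmetric] exp_add[symmetric] by simp
    have e2: "complex_of_real (exp (- L * psi \<epsilon> \<epsilon>)) * of_real (exp (L * p\<^sup>2)) = of_real (exp (- L * psi \<epsilon> \<alpha>))"
      unfolding of_real_mult[symmetric] exp_add[symmetric] p(2) by (simp add: algebra_simps)
    define ee where "ee = complex_of_real (exp (- L * psi \<epsilon> \<epsilon>))"
    define ea where "ea = complex_of_real (exp (- L * psi \<epsilon> \<alpha>))"
    have xa: "of_real (x / pi) * (\<i> * of_real \<alpha> * KS L) = \<i> / of_real pi * KS L"
      using assms by simp
    have EL: "E L = of_real (x / pi) * V L - ee * (\<i> / of_real pi * KS L) - of_real \<tau> * A * (ea * of_real (erfc (sqrt L * p)))
        + ee * (of_real \<tau> * A * of_real (PS L) / of_real pi)"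
    proof -
      have "E L = of_real (x / pi) * ((ee * of_real (exp (L * psi \<epsilon> \<epsilon>))) * V L) - ee * (of_real (x / pi) * (\<i> * of_real \<alpha> * KS L))
         - of_real \<tau> * A * ((ee * of_real (exp (L * p\<^sup>2))) * of_real (erfc (sqrt L * p))) + ee * (of_real \<tau> * A * of_real (PS L) / of_real pi)"
        unfolding E_def R1_def R2_def ee_def by (simp add: algebra_simps diff_divide_distrib)
      thus ?thesis unfolding xa e1[folded ee_def] e2[folded ee_def ea_def] by simp
    qed
    have "ea * A * of_real (erfc (\<tau> * sqrt L * p)) + ee / of_real pi * (\<i> * KS L - of_real \<tau> * A * of_real (PS L)) + E L
        = of_real (x / pi) * V L + of_real (1 - \<tau>) * (ea * A)"
      unfolding EL erf by (simp add: algebra_simps diff_divide_distrib)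
    also have "\<dots> = 2 * of_real x * (F / Gfac \<epsilon> a c L)" unfolding main ea_def ..
    finally have "Gfac \<epsilon> a c L / (2 * of_real x) * (ea * A * of_real (erfc (\<tau> * sqrt L * p)) + ee / of_real pi * (\<i> * KS L - of_real \<tau> * A * of_real (PS L)) + E L) = F"
      using G0 xr by simp
    thus ?case unfolding dsum F_def C_def ee_def ea_def by simp
  qed
  ultimately show ?thesis unfolding gterm_def A_def \<tau>_def p_def by blast
qed

end
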